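(* Let $E$ be a complex Banach lattice and let $(e^{tA})_{t\ge 0}$ be a real $C_0$-semigroup on $E$ with generator $A$ which is individually eventually strongly positive with respect to a quasi-interior point $u$ of $E_+$. Suppose that the spectral bound $s(A)$ is not equal to $-\infty$ and that it is a pole of the resolvent $\mathcal{R}(\cdot,A)$. Then the following assertions are equivalent: (i) For every positive operator $B\in\mathcal{L}(E)$ the perturbed semigroup $(e^{t(A+B)})_{t\ge 0}$ is individually eventually positive. (ii) For every positive rank-$1$ operator $B\in\mathcal{L}(E)$ the perturbed semigroup $(e^{t(A+B)})_{t\ge 0}$ is individually eventually positive. (iii) The semigroup $(e^{tA})_{t\ge 0}$ is positive, i.e. $e^{tA}\ge 0$ for all $t\ge 0$.
   Context: A complex Banach lattice $E$ is the complexification of a real Banach lattice $E_{\mathbb{R}}$; $E_+$ is its positive cone, $f\ge 0$ means $f\in E_+$, and $f>0$ means $f\ge 0$, $f\ne 0$. $\mathcal{L}(E)$ is the space of bounded linear operators on $E$; $T\in\mathcal{L}(E)$ is positive ($T\ge 0$) if $TE_+\subseteq E_+$. A linear operator $A\colon E\supseteq D(A)\to E$ is real if $D(A)=E_{\mathbb{R}}\cap D(A)+i\,(E_{\mathbb{R}}\cap D(A))$ and $A$ maps $E_{\mathbb{R}}\cap D(A)$ into $E_{\mathbb{R}}$; a $C_0$-semigroup is real if all its operators are real (equivalently, its generator is real). The spectral bound is $s(A)=\sup\{\operatorname{Re}\lambda:\lambda\in\sigma(A)\}\in[-\infty,\infty]$, and $\mathcal{R}(\lambda,A)=(\lambda I-A)^{-1}$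 for $\lambda\in\rho(A)$. For $u\in E_+$ let $E_u=\{x\in E:\ |x|\le cu\text{ for some }c\ge 0\}$. The vector $u\in E_+$ is a quasi-interior point of $E_+$ if $E_u$ is dense in $E$. For $f\in E$ write $f\gg_u 0$ if there is $\varepsilon>0$ with $f\ge\varepsilon u$. A $C_0$-semigroup $(e^{tA})_{t\ge0}$ on $E$ is individually eventually positive if for every $0\le f\in E$ there is $t_0\ge 0$ such that $e^{tA}f\ge 0$ for all $t\ge t_0$. It is individually eventually strongly positive with respect to a quasi-interior point $u$ if for every $0<f\in E$ there is $t_0\ge 0$ such that $e^{tA}f\gg_u 0$ for all $t\ge t_0$. *)

theory Defs
  imports "HOL-Analysis.Analysis" "HOL-Library.Lattice_Algebras"
begin

section \<open>Real Banach lattices\<close>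

class banach_lattice = banach + ordered_real_vector + lattice_ab_group_add_abs +
  assumes norm_mono_abs: "\<bar>x\<bar> \<le> \<bar>y\<bar> \<Longrightarrow> norm x \<le> norm y"

instance real :: banach_lattice
  by standard (auto simp: sup_real_def)

lemma norm_mono_nonneg:
  fixes x y :: "'a::banach_lattice"
  assumes "0 \<le> x" "x \<le> y"
  shows "norm x \<le> norm y"
  using assms by (intro norm_mono_abs) auto

lemma norm_abs_eq [simp]: "norm \<bar>x::'a::banach_lattice\<bar> = norm x"
  by (intro order.antisym norm_mono_abs) auto

lemma scaleR_le_abs: "a *\<^sub>R x \<le> \<bar>a\<bar> *\<^sub>R \<bar>x::'a::banach_lattice\<bar>"
proof (cases "a \<ge> 0")
  case True
  then show ?thesis by (simp add: scaleR_left_mono abs_ge_self)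
next
  case False
  then have "(-a) *\<^sub>R (-x) \<le> (-a) *\<^sub>R \<bar>x\<bar>"
    by (intro scaleR_left_mono) (auto simp: abs_ge_minus_self)
  with False show ?thesis by simp
qed

lemma nonneg_closed:
  fixes X :: "nat \<Rightarrow> 'a::banach_lattice"
  assumes lim: "X \<longlonglongrightarrow> x" and nonneg: "\<And>n. 0 \<le> X n"
  shows "0 \<le> x"
proof -
  have "norm (pprt (-x)) \<le> norm (X n - x)" for n
  proof -
    have "-x \<le> \<bar>X n - x\<bar>"
      using nonneg[of n] abs_ge_self[of "X n - x"]
      by (metis add_0 diff_right_mono minus_add_distrib order_trans diff_0)
    then have "pprt (-x) \<le> \<bar>X n - x\<bar>" by (simp add: pprt_def)
    then show ?thesis
      by (metis norm_abs_eq norm_mono_nonneg zero_le_pprt)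
  qed
  moreover have "(\<lambda>n. norm (X n - x)) \<longlonglongrightarrow> 0"
    using lim by (simp add: LIM_zero tendsto_norm_zero)
  ultimately have "norm (pprt (-x)) \<le> 0"
    by (meson LIMSEQ_le_const)
  then have "pprt (-x) = 0" by simp
  then have "-x \<le> 0" using le_zero_iff_zero_pprt by blast
  then show ?thesis by simp
qed

lemma le_closed:
  fixes X Y :: "nat \<Rightarrow> 'a::banach_lattice"
  assumes "X \<longlonglongrightarrow> x" "Y \<longlonglongrightarrow> y" "\<And>n. X n \<le> Y n"
  shows "x \<le> y"
  using nonneg_closed[OF tendsto_diff[OF assms(2,1)]] assms(3) by simp

section \<open>Complexification\<close>

datatype 'a complexification = Cplx (re_part: 'a) (im_part: 'a)

lemma complexification_eqI: "re_part z = re_part w \<Longrightarrow> im_part z = im_part w \<Longrightarrow> z = w"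
  by (cases z; cases w) simp

lemma complexification_eq_iff: "z = w \<longleftrightarrow> re_part z = re_part w \<and> im_part z = im_part w"
  by (auto intro: complexification_eqI)

instantiation complexification :: (real_vector) real_vector
begin
definition "0 = Cplx 0 0"
definition "z + w = Cplx (re_part z + re_part w) (im_part z + im_part w)"
definition "- z = Cplx (- re_part z) (- im_part z)"
definition "z - w = Cplx (re_part z - re_part w) (im_part z - im_part w)"
definition "r *\<^sub>R z = Cplx (r *\<^sub>R re_part z) (r *\<^sub>R im_part z)"
instance
  by standard (simp_all add: complexification_eq_iff zero_complexification_def
      plus_complexification_def uminus_complexification_def minus_complexification_def
      scaleR_complexification_def algebra_simps)
end

lemma re_im_simps [simp]:
  fixes z w :: "'a::real_vector complexification"
  shows "re_part (0 :: 'a complexification) = 0" "im_part (0 :: 'a complexification) = 0"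
    "re_part (z + w) = re_part z + re_part w" "im_part (z + w) = im_part z + im_part w"
    "re_part (- z) = - re_part z" "im_part (- z) = - im_part z"
    "re_part (z - w) = re_part z - re_part w" "im_part (z - w) = im_part z - im_part w"
    "re_part (r *\<^sub>R z) = r *\<^sub>R re_part z" "im_part (r *\<^sub>R z) = r *\<^sub>R im_part z"
  by (simp_all add: zero_complexification_def plus_complexification_def uminus_complexification_def
      minus_complexification_def scaleR_complexification_def)

definition scaleC :: "complex \<Rightarrow> 'a::real_vector complexification \<Rightarrow> 'a complexification"
    (infixr \<open>*\<^sub>C\<close> 75) where
  "c *\<^sub>C z = Cplx (Re c *\<^sub>R re_part z - Im c *\<^sub>R im_part z) (Re c *\<^sub>R im_part z + Im c *\<^sub>R re_part z)"

lemma re_im_scaleC [simp]: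
  "re_part (c *\<^sub>C z) = Re c *\<^sub>R re_part z - Im c *\<^sub>R im_part z"
  "im_part (c *\<^sub>C z) = Re c *\<^sub>R im_part z + Im c *\<^sub>R re_part z"
  by (simp_all add: scaleC_def)

interpretation complexification: vector_space scaleC
  by standard (simp_all add: complexification_eq_iff algebra_simps)

lemma scaleC_of_real: "complex_of_real r *\<^sub>C z = r *\<^sub>R z"
  by (simp add: complexification_eq_iff)

text \<open>
  The order is the one with positive cone \<open>E\<^sub>+ = {Cplx x 0 | x \<ge> 0}\<close>; comparable elements have the
  same imaginary part.
\<close>

instantiation complexification :: (ordered_real_vector) ordered_real_vector
begin
definition "z \<le> w \<longleftrightarrow> re_part z \<le> re_part w \<and> im_part z = im_part w"
definition less_complexification :: "'a complexification \<Rightarrow> 'a complexification \<Rightarrow> bool"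
  where "less_complexification z w \<longleftrightarrow> z \<le> w \<and> z \<noteq> w"
instance
  by standard (auto simp: less_eq_complexification_def less_complexification_def
      complexification_eq_iff scaleR_left_mono scaleR_right_mono)
end

text \<open>
  The modulus \<open>|x + iy| = sup {cos \<theta> x + sin \<theta> y | \<theta>}\<close>, as an element of the underlying real Banach
  lattice.
\<close>

definition is_modulus :: "'a::banach_lattice complexification \<Rightarrow> 'a \<Rightarrow> bool" where
  "is_modulus z m \<longleftrightarrow>
     (\<forall>\<theta>. cos \<theta> *\<^sub>R re_part z + sin \<theta> *\<^sub>R im_part z \<le> m) \<and>
     (\<forall>b. (\<forall>\<theta>. cos \<theta> *\<^sub>R re_part z + sin \<theta> *\<^sub>R im_part z \<le> b) \<longrightarrow> m \<le> b)"

definition modulus :: "'a::banach_lattice complexification \<Rightarrow> 'a" where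
  "modulus z = (THE m. is_modulus z m)"

lemma is_modulus_unique: "is_modulus z m \<Longrightarrow> is_modulus z m' \<Longrightarrow> m = m'"
  unfolding is_modulus_def by (meson order.antisym)

lemma rotation_lipschitz:
  fixes x y :: "'a::banach_lattice"
  shows "cos t *\<^sub>R x + sin t *\<^sub>R y \<le> cos s *\<^sub>R x + sin s *\<^sub>R y + \<bar>t - s\<bar> *\<^sub>R (\<bar>x\<bar> + \<bar>y\<bar>)"
proof -
  have *: "\<bar>sin ((t - s) / 2)\<bar> \<le> \<bar>t - s\<bar> / 2"
    using abs_sin_x_le_abs_x[of "(t - s) / 2"] by simp
  have c: "\<bar>cos t - cos s\<bar> \<le> \<bar>t - s\<bar>"
  proof -
    have "\<bar>cos t - cos s\<bar> = 2 * (\<bar>sin ((t + s) / 2)\<bar> * \<bar>sin ((t - s) / 2)\<bar>)"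
    proof -
      have "(s - t) / 2 = - ((t - s) / 2)" by (simp add: field_simps)
      then have "sin ((s - t) / 2) = - sin ((t - s) / 2)" by (simp only: sin_minus)
      then show ?thesis by (simp add: cos_diff_cos abs_mult)
    qed
    also have "\<dots> \<le> 2 * (1 * (\<bar>t - s\<bar> / 2))"
      using * by (intro mult_left_mono mult_mono) auto
    finally show ?thesis by simp
  qed
  have s: "\<bar>sin t - sin s\<bar> \<le> \<bar>t - s\<bar>"
  proof -
    have "\<bar>sin t - sin s\<bar> = 2 * (\<bar>sin ((t - s) / 2)\<bar> * \<bar>cos ((t + s) / 2)\<bar>)"
      by (subst sin_diff_sin) (simp add: abs_mult)
    also have "\<dots> \<le> 2 * ((\<bar>t - s\<bar> / 2) * 1)"
      using * by (intro mult_left_mono mult_mono) auto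
    finally show ?thesis by simp
  qed
  have "(cos t - cos s) *\<^sub>R x \<le> \<bar>t - s\<bar> *\<^sub>R \<bar>x\<bar>"
    using scaleR_le_abs[of "cos t - cos s" x] scaleR_right_mono[OF c, of "\<bar>x\<bar>"] by simp
  moreover have "(sin t - sin s) *\<^sub>R y \<le> \<bar>t - s\<bar> *\<^sub>R \<bar>y\<bar>"
    using scaleR_le_abs[of "sin t - sin s" y] scaleR_right_mono[OF s, of "\<bar>y\<bar>"] by simp
  ultimately have "(cos t - cos s) *\<^sub>R x + (sin t - sin s) *\<^sub>R y \<le> \<bar>t - s\<bar> *\<^sub>R \<bar>x\<bar> + \<bar>t - s\<bar> *\<^sub>R \<bar>y\<bar>"
    by (rule add_mono)
  then show ?thesis by (simp add: algebra_simps)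
qed

lemma ex_modulus: "\<exists>m. is_modulus (z::'a::banach_lattice complexification) m"
proof -
  define x y where "x = re_part z" and "y = im_part z"
  define f where "f t = cos t *\<^sub>R x + sin t *\<^sub>R y" for t :: real
  define w where "w = \<bar>x\<bar> + \<bar>y\<bar>"
  define e where "e n = 1 / real (Suc n)" for n
  define G where "G n = (\<lambda>k. real k * e n) ` {..7 * Suc n}" for n
  define a where "a n = Sup_fin (f ` G n)" for n
  have e_pos: "e n > 0" for n by (simp add: e_def)
  have e_lim: "e \<longlonglongrightarrow> 0"
    unfolding e_def using LIMSEQ_inverse_real_of_nat by (simp add: inverse_eq_divide)
  have w: "0 \<le> w" by (simp add: w_def)
  have G: "finite (f ` G n)" "f ` G n \<noteq> {}" for n by (auto simp: G_def)
  have f_le: "f t \<le> a n + e n *\<^sub>R w" for t n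
  proof -
    obtain s where s: "0 \<le> s" "s < 2 * pi" "cos t = cos s" "sin t = sin s"
      using sincos_total_2pi[of "cos t" "sin t"] by (metis sin_cos_squared_add2 add.commute)
    define k where "k = nat \<lfloor>s * real (Suc n)\<rfloor>"
    have k1: "real k \<le> s * real (Suc n)" "s * real (Suc n) < real k + 1"
      using s(1) by (auto simp: k_def)
    have "s < 7" using s(2) pi_less_4 pi_approx by simp
    then have "s * real (Suc n) \<le> 7 * real (Suc n)" by (intro mult_right_mono) auto
    then have "k \<le> 7 * Suc n" using k1(1) by linarith
    then have mem: "real k * e n \<in> G n" by (auto simp: G_def)
    have "real k * e n \<le> s" "s \<le> real k * e n + e n"
      using k1 by (auto simp: e_def field_simps)
    then have "\<bar>s - real k * e n\<bar> \<le> e n" by auto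
    have "f t = f s" by (simp add: f_def s)
    also have "\<dots> \<le> f (real k * e n) + \<bar>s - real k * e n\<bar> *\<^sub>R w"
      unfolding f_def w_def by (rule rotation_lipschitz)
    also have "\<dots> \<le> a n + e n *\<^sub>R w"
      using mem G \<open>\<bar>s - real k * e n\<bar> \<le> e n\<close> w unfolding a_def
      by (intro add_mono Sup_fin.coboundedI scaleR_right_mono) auto
    finally show ?thesis .
  qed
  have a_le: "a m \<le> b" if "\<And>t. f t \<le> b" for b m
    unfolding a_def using G that by (intro Sup_fin.boundedI) auto
  have aa: "a m - a n \<le> e n *\<^sub>R w" for m n
    using a_le[OF f_le, of m n] by (simp add: algebra_simps)
  have dist_a: "norm (a m - a n) \<le> max (e m) (e n) * norm w" for m n
  proof -
    let ?M = "max (e m) (e n)"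
    have "a m - a n \<le> ?M *\<^sub>R w"
      using aa[of m n] scaleR_right_mono[of "e n" ?M w] w by simp
    moreover have "-(a m - a n) \<le> ?M *\<^sub>R w"
      using aa[of n m] scaleR_right_mono[of "e m" ?M w] w by simp
    ultimately have "\<bar>a m - a n\<bar> \<le> ?M *\<^sub>R w" by (simp only: abs_leI)
    then have "norm (a m - a n) \<le> norm (?M *\<^sub>R w)"
      by (metis abs_ge_zero norm_abs_eq norm_mono_nonneg)
    then show ?thesis using e_pos[of m] by simp
  qed
  have "Cauchy a"
  proof (rule metric_CauchyI)
    fix r :: real assume r: "r > 0"
    have "(\<lambda>n. e n * norm w) \<longlonglongrightarrow> 0" using e_lim by (rule tendsto_mult_left_zero)
    then obtain N where N: "\<And>n. n \<ge> N \<Longrightarrow> e n * norm w < r"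
      using r by (auto simp: lim_sequentially e_pos abs_mult less_imp_le)
    have "dist (a m) (a n) < r" if "m \<ge> N" "n \<ge> N" for m n
      using dist_a[of m n] N[of m] N[of n] that by (auto simp: dist_norm max_def split: if_splits)
    then show "\<exists>N. \<forall>m\<ge>N. \<forall>n\<ge>N. dist (a m) (a n) < r" by blast
  qed
  then obtain l where l: "a \<longlonglongrightarrow> l" using Cauchy_convergent_iff convergent_def by blast
  have "(\<lambda>n. a n + e n *\<^sub>R w) \<longlonglongrightarrow> l + 0 *\<^sub>R w"
    by (intro tendsto_intros l e_lim)
  then have "f t \<le> l" for t using le_closed[OF tendsto_const _ f_le] by simp
  moreover have "l \<le> b" if "\<And>t. f t \<le> b" for b
    using le_closed[OF l tendsto_const a_le] that by blast
  ultimately show ?thesis by (auto simp: is_modulus_def f_def x_def y_def)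
qed

lemma is_modulus_modulus: "is_modulus z (modulus z)"
  unfolding modulus_def using ex_modulus is_modulus_unique by (metis theI)

lemma modulus_upper: "cos t *\<^sub>R re_part z + sin t *\<^sub>R im_part z \<le> modulus z"
  using is_modulus_modulus[of z] by (auto simp: is_modulus_def)

lemma modulus_least:
  "(\<And>t. cos t *\<^sub>R re_part z + sin t *\<^sub>R im_part z \<le> b) \<Longrightarrow> modulus z \<le> b"
  using is_modulus_modulus[of z] by (auto simp: is_modulus_def)

lemma abs_re_le_modulus: "\<bar>re_part z\<bar> \<le> modulus z"
  using modulus_upper[of 0 z] modulus_upper[of pi z] by (simp add: abs_leI)

lemma abs_im_le_modulus: "\<bar>im_part z\<bar> \<le> modulus z"
  using modulus_upper[of "pi/2" z] modulus_upper[of "-pi/2" z] by (simp add: abs_leI)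

lemma modulus_nonneg [simp]: "0 \<le> modulus z"
  using abs_re_le_modulus[of z] abs_ge_zero order_trans by blast

lemma modulus_Cplx_0: "modulus (Cplx x 0) = \<bar>x\<bar>"
proof (rule order.antisym)
  show "modulus (Cplx x 0) \<le> \<bar>x\<bar>"
  proof (rule modulus_least)
    fix t :: real
    have "cos t *\<^sub>R x \<le> \<bar>cos t\<bar> *\<^sub>R \<bar>x\<bar>" by (rule scaleR_le_abs)
    also have "\<dots> \<le> 1 *\<^sub>R \<bar>x\<bar>" by (intro scaleR_right_mono) auto
    finally show "cos t *\<^sub>R re_part (Cplx x 0) + sin t *\<^sub>R im_part (Cplx x 0) \<le> \<bar>x\<bar>" by simp
  qed
  show "\<bar>x\<bar> \<le> modulus (Cplx x 0)" using abs_re_le_modulus[of "Cplx x 0"] by simp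
qed

lemma modulus_le_sum: "modulus z \<le> \<bar>re_part z\<bar> + \<bar>im_part z\<bar>"
proof (rule modulus_least)
  fix t :: real
  have "cos t *\<^sub>R re_part z \<le> 1 *\<^sub>R \<bar>re_part z\<bar>"
    by (rule order_trans[OF scaleR_le_abs]) (intro scaleR_right_mono, auto)
  moreover have "sin t *\<^sub>R im_part z \<le> 1 *\<^sub>R \<bar>im_part z\<bar>"
    by (rule order_trans[OF scaleR_le_abs]) (intro scaleR_right_mono, auto)
  ultimately show "cos t *\<^sub>R re_part z + sin t *\<^sub>R im_part z \<le> \<bar>re_part z\<bar> + \<bar>im_part z\<bar>"
    by (auto intro: add_mono)
qed

lemma modulus_triangle: "modulus (z + w) \<le> modulus z + modulus w"
proof (rule modulus_least)
  fix t :: real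
  show "cos t *\<^sub>R re_part (z + w) + sin t *\<^sub>R im_part (z + w) \<le> modulus z + modulus w"
    using add_mono[OF modulus_upper[of t z] modulus_upper[of t w]] by (simp add: algebra_simps)
qed

lemma modulus_scaleC_le: "modulus (c *\<^sub>C z) \<le> cmod c *\<^sub>R modulus z"
proof (rule modulus_least)
  fix t :: real
  define r p where "r = cmod c" and "p = Arg c"
  have c: "Re c = r * cos p" "Im c = r * sin p"
    using rcis_cmod_Arg[of c] by (metis Re_rcis r_def p_def, metis Im_rcis r_def p_def)
  have "cos t *\<^sub>R re_part (c *\<^sub>C z) + sin t *\<^sub>R im_part (c *\<^sub>C z) =
      r *\<^sub>R (cos (t - p) *\<^sub>R re_part z + sin (t - p) *\<^sub>R im_part z)"
    by (simp add: c cos_diff sin_diff algebra_simps)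
  also have "\<dots> \<le> r *\<^sub>R modulus z"
    by (intro scaleR_left_mono modulus_upper) (simp add: r_def)
  finally show "cos t *\<^sub>R re_part (c *\<^sub>C z) + sin t *\<^sub>R im_part (c *\<^sub>C z) \<le> cmod c *\<^sub>R modulus z"
    by (simp add: r_def)
qed

lemma modulus_eq_0_iff [simp]: "modulus z = 0 \<longleftrightarrow> z = 0"
proof
  assume "modulus z = 0"
  then show "z = 0"
    using abs_re_le_modulus[of z] abs_im_le_modulus[of z] by (simp add: complexification_eq_iff)
next
  assume "z = 0"
  then show "modulus z = 0" using modulus_Cplx_0[of 0] by (simp add: zero_complexification_def)
qed

lemma modulus_scaleC: "modulus (c *\<^sub>C z) = cmod c *\<^sub>R modulus z"
proof (cases "c = 0")
  case False
  have "modulus (inverse c *\<^sub>C (c *\<^sub>C z)) \<le> inverse (cmod c) *\<^sub>R modulus (c *\<^sub>C z)"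
    using modulus_scaleC_le[of "inverse c" "c *\<^sub>C z"] by (simp add: norm_inverse)
  then have "cmod c *\<^sub>R modulus z \<le> cmod c *\<^sub>R (inverse (cmod c) *\<^sub>R modulus (c *\<^sub>C z))"
    using False by (intro scaleR_left_mono) auto
  then have "cmod c *\<^sub>R modulus z \<le> modulus (c *\<^sub>C z)" using False by simp
  then show ?thesis using modulus_scaleC_le[of c z] by (simp add: order.antisym)
qed simp

text \<open>The norm of the complexification is \<open>\<parallel>z\<parallel> = \<parallel>|z|\<parallel>\<close>.\<close>

instantiation complexification :: (banach_lattice) real_normed_vector
begin
definition "norm z = norm (modulus z)"
definition "dist z w = norm (z - w :: 'a complexification)"
definition "sgn z = z /\<^sub>R norm (z :: 'a complexification)"
definition uniformity_complexification_def [code del]: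
  "(uniformity :: ('a complexification \<times> 'a complexification) filter) =
     (INF e\<in>{0 <..}. principal {(x, y). dist x y < e})"
definition open_complexification_def [code del]:
  "open (U :: 'a complexification set) \<longleftrightarrow>
     (\<forall>x\<in>U. eventually (\<lambda>(x', y). x' = x \<longrightarrow> y \<in> U) uniformity)"
instance
proof
  fix r :: real and z w :: "'a complexification"
  show "norm z = 0 \<longleftrightarrow> z = 0" by (simp add: norm_complexification_def)
  have "norm (z + w) \<le> norm (modulus z + modulus w)"
    unfolding norm_complexification_def by (intro norm_mono_nonneg modulus_triangle modulus_nonneg)
  also have "\<dots> \<le> norm z + norm w"
    unfolding norm_complexification_def by (rule norm_triangle_ineq)
  finally show "norm (z + w) \<le> norm z + norm w" .
  show "norm (r *\<^sub>R z) = \<bar>r\<bar> * norm z"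
    using modulus_scaleC[of "of_real r" z] by (simp add: norm_complexification_def scaleC_of_real)
qed (simp_all add: dist_complexification_def sgn_complexification_def
      uniformity_complexification_def open_complexification_def)
end

lemma norm_scaleC: "norm (c *\<^sub>C z) = cmod c * norm (z :: 'a::banach_lattice complexification)"
  by (simp add: norm_complexification_def modulus_scaleC)

lemma norm_re_le: "norm (re_part z) \<le> norm (z :: 'a::banach_lattice complexification)"
  unfolding norm_complexification_def using abs_re_le_modulus[of z]
  by (metis abs_ge_zero norm_abs_eq norm_mono_nonneg)

lemma norm_im_le: "norm (im_part z) \<le> norm (z :: 'a::banach_lattice complexification)"
  unfolding norm_complexification_def using abs_im_le_modulus[of z]
  by (metis abs_ge_zero norm_abs_eq norm_mono_nonneg)

lemma norm_le_re_im:
  "norm (z :: 'a::banach_lattice complexification) \<le> norm (re_part z) + norm (im_part z)"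
proof -
  have "norm z \<le> norm (\<bar>re_part z\<bar> + \<bar>im_part z\<bar>)"
    unfolding norm_complexification_def by (intro norm_mono_nonneg modulus_le_sum modulus_nonneg)
  then show ?thesis using norm_triangle_ineq[of "\<bar>re_part z\<bar>" "\<bar>im_part z\<bar>"] by simp
qed

instance complexification :: (banach_lattice) banach
proof
  fix X :: "nat \<Rightarrow> 'a complexification"
  assume X: "Cauchy X"
  have bnd: "norm (re_part (X m) - re_part (X n)) \<le> norm (X m - X n)"
    "norm (im_part (X m) - im_part (X n)) \<le> norm (X m - X n)" for m n
    using norm_re_le[of "X m - X n"] norm_im_le[of "X m - X n"] by simp_all
  have "Cauchy (\<lambda>n. re_part (X n))" "Cauchy (\<lambda>n. im_part (X n))"
    using X unfolding Cauchy_def dist_norm by (meson bnd le_less_trans)+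
  then obtain x y where xy: "(\<lambda>n. re_part (X n)) \<longlonglongrightarrow> x" "(\<lambda>n. im_part (X n)) \<longlonglongrightarrow> y"
    using Cauchy_convergent_iff convergent_def by metis
  have "(\<lambda>n. norm (re_part (X n) - x) + norm (im_part (X n) - y)) \<longlonglongrightarrow> 0"
    by (intro tendsto_add_zero tendsto_norm_zero LIM_zero xy)
  then have "(\<lambda>n. norm (X n - Cplx x y)) \<longlonglongrightarrow> 0"
  proof (rule tendsto_0_le[where K = 1], intro always_eventually allI)
    fix n show "norm (norm (X n - Cplx x y)) \<le>
        norm (norm (re_part (X n) - x) + norm (im_part (X n) - y)) * 1"
      using norm_le_re_im[of "X n - Cplx x y"] by simp
  qed
  then have "X \<longlonglongrightarrow> Cplx x y" by (simp add: LIM_zero_iff tendsto_norm_zero_iff)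
  then show "convergent X" by (auto simp: convergent_def)
qed

text \<open>The modulus viewed as an element of the complexification itself.\<close>

instantiation complexification :: (banach_lattice) abs
begin
definition "\<bar>z\<bar> = Cplx (modulus z) 0"
instance ..
end

definition real_elements :: "'a::banach_lattice complexification set" where
  "real_elements = {z. im_part z = 0}"

definition principal_ideal ::
    "'a::banach_lattice complexification \<Rightarrow> 'a complexification set" where
  "principal_ideal u = {x. \<exists>c\<ge>0. \<bar>x\<bar> \<le> c *\<^sub>R u}"

definition quasi_interior :: "'a::banach_lattice complexification \<Rightarrow> bool" where
  "quasi_interior u \<longleftrightarrow> 0 \<le> u \<and> closure (principal_ideal u) = UNIV"

definition strongly_positive_wrt ::
    "'a::banach_lattice complexification \<Rightarrow> 'a complexification \<Rightarrow> bool" where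
  "strongly_positive_wrt u f \<longleftrightarrow> (\<exists>\<epsilon>>0. \<epsilon> *\<^sub>R u \<le> f)"

section \<open>Operators\<close>

definition bounded_clinear ::
    "('a::banach_lattice complexification \<Rightarrow> 'a complexification) \<Rightarrow> bool" where
  "bounded_clinear T \<longleftrightarrow> bounded_linear T \<and> Vector_Spaces.linear scaleC scaleC T"

definition positive_operator ::
    "('a::banach_lattice complexification \<Rightarrow> 'a complexification) \<Rightarrow> bool" where
  "positive_operator T \<longleftrightarrow> (\<forall>f\<ge>0. 0 \<le> T f)"

definition rank_one ::
    "('a::banach_lattice complexification \<Rightarrow> 'a complexification) \<Rightarrow> bool" where
  "rank_one T \<longleftrightarrow> complexification.dim (range T) = 1"

text \<open>
  An unbounded operator is given by its domain \<open>D\<close> and a total function \<open>A\<close> of which only the values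
  on \<open>D\<close> matter.
\<close>

definition real_operator ::
    "'a::banach_lattice complexification set \<Rightarrow> ('a complexification \<Rightarrow> 'a complexification) \<Rightarrow> bool" where
  "real_operator D A \<longleftrightarrow>
     D = {x + \<i> *\<^sub>C y | x y. x \<in> real_elements \<inter> D \<and> y \<in> real_elements \<inter> D} \<and>
     A ` (real_elements \<inter> D) \<subseteq> real_elements"

definition resolvent ::
    "'a::banach_lattice complexification set \<Rightarrow> ('a complexification \<Rightarrow> 'a complexification) \<Rightarrow>
     complex \<Rightarrow> 'a complexification \<Rightarrow> 'a complexification" where
  "resolvent D A \<mu> = inv_into D (\<lambda>x. \<mu> *\<^sub>C x - A x)"

definition resolvent_set ::
    "'a::banach_lattice complexification set \<Rightarrow> ('a complexification \<Rightarrow> 'a complexification) \<Rightarrow>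
     complex set" where
  "resolvent_set D A =
     {\<mu>. bij_betw (\<lambda>x. \<mu> *\<^sub>C x - A x) D UNIV \<and> bounded_clinear (resolvent D A \<mu>)}"

definition spectrum ::
    "'a::banach_lattice complexification set \<Rightarrow> ('a complexification \<Rightarrow> 'a complexification) \<Rightarrow>
     complex set" where
  "spectrum D A = - resolvent_set D A"

definition spectral_bound ::
    "'a::banach_lattice complexification set \<Rightarrow> ('a complexification \<Rightarrow> 'a complexification) \<Rightarrow>
     ereal" where
  "spectral_bound D A = (SUP \<mu>\<in>spectrum D A. ereal (Re \<mu>))"

text \<open>
  \<open>\<mu>\<^sub>0\<close> is a pole of order \<open>m \<ge> 1\<close> of the resolvent if in a punctured neighbourhood there is an expansion
  \<open>R(\<mu>, A) = (\<Sum>k. (\<mu> - \<mu>\<^sub>0)^(k - m) U k)\<close>, convergent in operator norm, with bounded coefficients and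
  \<open>U 0 \<noteq> 0\<close>. Mere divergence of the resolvent to infinity (as in \<open>is_pole\<close> for scalar functions) would not
  do: the norm of the resolvent also tends to infinity at isolated essential singularities.
\<close>

definition resolvent_pole ::
    "'a::banach_lattice complexification set \<Rightarrow> ('a complexification \<Rightarrow> 'a complexification) \<Rightarrow>
     complex \<Rightarrow> bool" where
  "resolvent_pole D A \<mu>\<^sub>0 \<longleftrightarrow>
     (\<exists>r>0. \<exists>m\<ge>1::nat. \<exists>U :: nat \<Rightarrow> 'a complexification \<Rightarrow> 'a complexification.
        (\<forall>k. bounded_clinear (U k)) \<and> U 0 \<noteq> (\<lambda>x. 0) \<and>
        (\<forall>\<mu>\<in>ball \<mu>\<^sub>0 r - {\<mu>\<^sub>0}. \<mu> \<in> resolvent_set D A \<and>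
           (\<lambda>n. onorm (\<lambda>x. resolvent D A \<mu> x -
                  (\<Sum>k<n. ((\<mu> - \<mu>\<^sub>0) powi (int k - int m)) *\<^sub>C U k x))) \<longlonglongrightarrow> 0))"

section \<open>Semigroups\<close>

definition C0_semigroup ::
    "(real \<Rightarrow> 'a::banach_lattice complexification \<Rightarrow> 'a complexification) \<Rightarrow> bool" where
  "C0_semigroup T \<longleftrightarrow>
     (\<forall>t\<ge>0. bounded_clinear (T t)) \<and> T 0 = id \<and>
     (\<forall>s\<ge>0. \<forall>t\<ge>0. T (s + t) = T s \<circ> T t) \<and>
     (\<forall>x. ((\<lambda>t. T t x) \<longlongrightarrow> x) (at_right 0))"

definition has_generator ::
    "(real \<Rightarrow> 'a::banach_lattice complexification \<Rightarrow> 'a complexification) \<Rightarrow>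
     'a complexification set \<Rightarrow> ('a complexification \<Rightarrow> 'a complexification) \<Rightarrow> bool" where
  "has_generator T D A \<longleftrightarrow>
     D = {x. \<exists>y. ((\<lambda>h. (T h x - x) /\<^sub>R h) \<longlongrightarrow> y) (at_right 0)} \<and>
     (\<forall>x\<in>D. ((\<lambda>h. (T h x - x) /\<^sub>R h) \<longlongrightarrow> A x) (at_right 0))"

definition real_semigroup ::
    "(real \<Rightarrow> 'a::banach_lattice complexification \<Rightarrow> 'a complexification) \<Rightarrow> bool" where
  "real_semigroup T \<longleftrightarrow> (\<forall>t\<ge>0. real_operator UNIV (T t))"

definition positive_semigroup ::
    "(real \<Rightarrow> 'a::banach_lattice complexification \<Rightarrow> 'a complexification) \<Rightarrow> bool" where
  "positive_semigroup T \<longleftrightarrow> (\<forall>t\<ge>0. positive_operator (T t))"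

definition individually_eventually_positive ::
    "(real \<Rightarrow> 'a::banach_lattice complexification \<Rightarrow> 'a complexification) \<Rightarrow> bool" where
  "individually_eventually_positive T \<longleftrightarrow> (\<forall>f\<ge>0. \<exists>t\<^sub>0\<ge>0. \<forall>t\<ge>t\<^sub>0. 0 \<le> T t f)"

definition individually_eventually_strongly_positive ::
    "'a::banach_lattice complexification \<Rightarrow>
     (real \<Rightarrow> 'a complexification \<Rightarrow> 'a complexification) \<Rightarrow> bool" where
  "individually_eventually_strongly_positive u T \<longleftrightarrow>
     (\<forall>f>0. \<exists>t\<^sub>0\<ge>0. \<forall>t\<ge>t\<^sub>0. strongly_positive_wrt u (T t f))"

text \<open>
  The perturbed semigroup \<open>(e^(t(A+B)))\<close> is the \<open>C\<^sub>0\<close>-semigroup generated by \<open>A + B\<close> with domain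
  \<open>D(A)\<close>. For bounded \<open>B\<close> it exists and is unique (as a family indexed by \<open>t \<ge> 0\<close>) by the bounded
  perturbation theorem.
\<close>

definition perturbed_semigroup ::
    "'a::banach_lattice complexification set \<Rightarrow> ('a complexification \<Rightarrow> 'a complexification) \<Rightarrow>
     ('a complexification \<Rightarrow> 'a complexification) \<Rightarrow>
     (real \<Rightarrow> 'a complexification \<Rightarrow> 'a complexification) \<Rightarrow> bool" where
  "perturbed_semigroup D A B S \<longleftrightarrow> C0_semigroup S \<and> has_generator S D (\<lambda>x. A x + B x)"

end

theory Submission
  imports Defs "HOL-Real_Asymp.Real_Asymp"
begin

text \<open>
If the semigroup \<open>T\<close> is positive, so is its perturbation by a positive \<open>B\<close>: every term of the Dyson
series is built from \<open>T\<close> and \<open>B\<close> by composition and integration and hence leaves the positive cone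
invariant (\<open>bounded_perturbation_exists\<close>, \<open>positive_perturbation\<close>).

The substance is the converse, which needs only perturbations of rank one, and among these only such
with range spanned by an eigenvector. Eventual positivity and the pole at \<open>s\<close> yield a positive eigenvector,
\<open>A w = s w\<close> (\<open>positive_eigenvector\<close>): vectors with positive orbits form a closed cone that is invariant under
\<open>R(l, A)\<close> for large \<open>l\<close> by the Laplace transform, therefore for all \<open>l > s\<close> by Neumann series, and therefore
under the leading Laurent coefficient at \<open>s\<close>, whose range consists of eigenvectors. Strong positivity
gives \<open>w \<ge> \<epsilon> u\<close>, so every nonzero positive functional \<open>\<phi>\<close> is strictly positive at \<open>w\<close> and may be
normalised by \<open>\<phi>(w) = l - s\<close>, where \<open>l\<close> is any number beyond \<open>s\<close> and the growth bound of \<open>T\<close>.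

For \<open>B x = \<phi>(x) w\<close> the perturbed semigroup \<open>S\<close> is explicit. The functional \<open>\<psi> = \<phi> \<circ> R(l, A)\<close> and the
operator \<open>P x = x - \<psi>(x) w\<close> satisfy \<open>(A + B) P = P A\<close>, so \<open>S(t) P = P T(t)\<close>; moreover \<open>S(t) w = exp (l t) w\<close>.
Consequently \<open>exp (- l t) S(t) g\<close> tends to \<open>\<psi>(g) w\<close> as \<open>t\<close> grows. If \<open>S\<close> is individually eventually
positive, then \<open>\<phi>(R(l, A) g) = \<psi>(g) \<ge> 0\<close> for all \<open>g \<ge> 0\<close> (\<open>resolvent_functional_nonneg\<close>). By the
Hahn-Banach theorem the positive functionals determine the positive cone (\<open>positive_functional_separates\<close>), so
\<open>R(l, A)\<close> is positive for all large \<open>l\<close>, and Euler's formula, \<open>T(t)\<close> being the limit of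
\<open>(n/t R(n/t, A))\<^sup>n\<close>, shows that \<open>T\<close> is positive (\<open>euler_invariance\<close>).
\<close>

section \<open>Integrals\<close>

text \<open>
The integral is a limit of Riemann sums over gauge-fine tagged divisions, and these are
combinations of values of \<open>f\<close> with nonnegative coefficients.
\<close>

lemma integral_mem_closed_convex_cone:
  fixes f :: "real \<Rightarrow> 'b::banach"
  assumes "f integrable_on {a..b}" "closed C" "convex_cone C" "\<And>s. s \<in> {a..b} \<Longrightarrow> f s \<in> C"
  shows "integral {a..b} f \<in> C"
proof -
  have "integral {a..b} f \<in> closure C"
    unfolding closure_approachable
  proof (intro allI impI)
    fix e :: real assume "e > 0"
    then obtain \<gamma> where g: "gauge \<gamma>" "\<And>\<D>. \<D> tagged_division_of {a..b} \<Longrightarrow> \<gamma> fine \<D> \<Longrightarrow>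
        norm (sum (\<lambda>(x,k). measure lborel k *\<^sub>R f x) \<D> - integral {a..b} f) < e"
      using integrable_integral[OF assms(1)] unfolding has_integral_real by meson
    obtain p where p: "p tagged_division_of {a..b}" "\<gamma> fine p"
      using fine_division_exists_real[OF g(1)] by blast
    have "finite p" using p(1) by blast
    have "(case q of (x,k) \<Rightarrow> measure lborel k *\<^sub>R f x) \<in> C" if "q \<in> p" for q
    proof (cases q)
      case (Pair x k)
      then have "x \<in> {a..b}" using p(1) that by (meson tag_in_interval)
      then show ?thesis using Pair assms by (simp add: convex_cone_scaleR)
    qed
    then have "sum (\<lambda>(x,k). measure lborel k *\<^sub>R f x) p \<in> C"
      using \<open>finite p\<close>
      by (induction p rule: infinite_finite_induct)
        (auto simp: convex_cone_contains_0 convex_cone_add assms)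
    then show "\<exists>y\<in>C. dist y (integral {a..b} f) < e"
      using g(2)[OF p] by (auto simp: dist_norm)
  qed
  then show ?thesis using assms(2) by simp
qed

lemma has_vector_derivative_within_quotient:
  fixes f :: "real \<Rightarrow> 'b::real_normed_vector"
  shows "(f has_vector_derivative d) (at x within S) \<longleftrightarrow>
     ((\<lambda>y. (f y - f x) /\<^sub>R (y - x)) \<longlongrightarrow> d) (at x within S)"
proof -
  have "(f has_vector_derivative d) (at x within S) \<longleftrightarrow>
      ((\<lambda>y. norm (f y - f x - (y - x) *\<^sub>R d) / norm (y - x)) \<longlongrightarrow> 0) (at x within S)"
    by (simp add: has_vector_derivative_def has_derivative_iff_norm bounded_linear_scaleR_left)
  also have "\<dots> \<longleftrightarrow> ((\<lambda>y. norm ((f y - f x) /\<^sub>R (y - x) - d)) \<longlongrightarrow> 0) (at x within S)"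
  proof (rule filterlim_cong[OF refl refl])
    show "\<forall>\<^sub>F y in at x within S. norm (f y - f x - (y - x) *\<^sub>R d) / norm (y - x) =
        norm ((f y - f x) /\<^sub>R (y - x) - d)"
      unfolding eventually_at_filter
    proof (intro always_eventually allI impI)
      fix y assume "y \<noteq> x"
      then have "(f y - f x) /\<^sub>R (y - x) - d = (f y - f x - (y - x) *\<^sub>R d) /\<^sub>R (y - x)"
        by (simp add: scaleR_diff_right)
      then show "norm (f y - f x - (y - x) *\<^sub>R d) / norm (y - x) =
        norm ((f y - f x) /\<^sub>R (y - x) - d)" by (simp add: divide_inverse mult.commute)
    qed
  qed
  finally show ?thesis by (simp add: tendsto_norm_zero_iff LIM_zero_iff)
qed

lemma norm_integral_exp_bound:
  fixes f :: "real \<Rightarrow> 'b::banach"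
  assumes "f integrable_on {a..b}" "a \<le> b" "d \<noteq> 0"
    and "\<And>s. s \<in> {a..b} \<Longrightarrow> norm (f s) \<le> K * exp (d * s)"
  shows "norm (integral {a..b} f) \<le> K / d * (exp (d * b) - exp (d * a))"
proof -
  have "((\<lambda>s. K * exp (d * s)) has_integral (K / d * exp (d * b) - K / d * exp (d * a))) {a..b}"
    using assms(2,3)
    by (intro fundamental_theorem_of_calculus)
      (auto simp: has_real_derivative_iff_has_vector_derivative[symmetric] intro!: derivative_eq_intros)
  then show ?thesis
    using integral_norm_bound_integral[OF assms(1), of "\<lambda>s. K * exp (d * s)"] assms(4)
    by (auto simp: has_integral_iff algebra_simps)
qed

lemma uniform_limit_integral_tendsto:
  fixes f :: "'i \<Rightarrow> real \<Rightarrow> 'b::banach"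
  assumes u: "uniform_limit {a..b} f g F" and c: "\<And>n. continuous_on {a..b} (f n)" and F: "F \<noteq> bot"
  shows "((\<lambda>n. integral {a..b} (f n)) \<longlongrightarrow> integral {a..b} g) F"
proof -
  obtain I J where "\<And>n. (f n has_integral I n) {a..b}" "(g has_integral J) {a..b}"
    and lim: "(I \<longlongrightarrow> J) F"
    using uniform_limit_integral[OF u c F] by metis
  then have "I = (\<lambda>n. integral {a..b} (f n))" "J = integral {a..b} g"
    by (auto simp: has_integral_iff)
  with lim show ?thesis by simp
qed

section \<open>Strongly continuous semigroups\<close>

locale c0_semigroup =
  fixes T :: "real \<Rightarrow> 'b::banach \<Rightarrow> 'b"
  assumes bounded_linear: "0 \<le> t \<Longrightarrow> bounded_linear (T t)"
    and zero [simp]: "T 0 x = x"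
    and add: "0 \<le> s \<Longrightarrow> 0 \<le> t \<Longrightarrow> T (s + t) x = T s (T t x)"
    and right_continuous: "((\<lambda>t. T t x) \<longlongrightarrow> x) (at_right 0)"
begin

lemma commute: "0 \<le> s \<Longrightarrow> 0 \<le> t \<Longrightarrow> T s (T t x) = T t (T s x)"
  by (metis add add.commute)

lemmas lin_simps =
  linear_add[OF bounded_linear.linear[OF bounded_linear]]
  linear_diff[OF bounded_linear.linear[OF bounded_linear]]
  linear_scale[OF bounded_linear.linear[OF bounded_linear]]
  linear_0[OF bounded_linear.linear[OF bounded_linear]]
  linear_neg[OF bounded_linear.linear[OF bounded_linear]]

text \<open>
Baire's theorem, applied to the closed sets of vectors whose orbits are bounded by \<open>n + 1\<close> on
\<open>[0, 1/(n + 1)]\<close>: these sets exhaust the space by continuity at \<open>0\<close>, so one of them contains a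
ball, and linearity turns the bound on a ball into an operator bound.
\<close>

lemma bounded_near_zero:
  obtains \<tau> K where "\<tau> > 0" "K \<ge> 1" "\<And>t x. 0 \<le> t \<Longrightarrow> t \<le> \<tau> \<Longrightarrow> norm (T t x) \<le> K * norm x"
proof -
  define F where "F n = {x. \<forall>t\<in>{0..1 / real (Suc n)}. norm (T t x) \<le> real (Suc n)}" for n :: nat
  have closed: "closed (F n)" for n
  proof -
    have "F n = (\<Inter>t\<in>{0..1 / real (Suc n)}. {x. norm (T t x) \<le> real (Suc n)})"
      by (auto simp: F_def)
    moreover have "closed {x. norm (T t x) \<le> real (Suc n)}" if "t \<in> {0..1 / real (Suc n)}" for t
    proof (rule closed_Collect_le)
      show "continuous_on UNIV (\<lambda>x. norm (T t x))"
        using that by (intro continuous_on_norm linear_continuous_on bounded_linear) auto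
    qed (rule continuous_on_const)
    ultimately show ?thesis by (simp add: closed_INT)
  qed
  have "x \<in> (\<Union>n. F n)" for x
  proof -
    have "((\<lambda>t. norm (T t x)) \<longlongrightarrow> norm x) (at_right 0)"
      by (intro tendsto_norm right_continuous)
    then have "\<forall>\<^sub>F t in at_right 0. norm (T t x) < norm x + 1"
      by (rule order_tendstoD) simp
    then obtain d where d: "d > 0" "\<And>t. 0 < t \<Longrightarrow> t < d \<Longrightarrow> norm (T t x) < norm x + 1"
      by (auto simp: eventually_at_right_field)
    obtain n :: nat where n: "real n > max (1 / d) (norm x + 1)"
      using reals_Archimedean2 by blast
    have "1 / d < real (Suc n)" using n by simp
    then have "1 / real (Suc n) < d" using d(1) by (simp add: field_simps)
    then have "norm (T t x) \<le> real (Suc n)" if "t \<in> {0..1 / real (Suc n)}" for t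
      using d(2)[of t] n that by (cases "t = 0") auto
    then have "x \<in> F n" by (simp add: F_def)
    then show ?thesis by blast
  qed
  then have U: "(\<Union>n. F n) = UNIV" by blast
  have "\<exists>n. interior (F n) \<noteq> {}"
  proof (rule ccontr)
    assume "\<nexists>n. interior (F n) \<noteq> {}"
    then have "euclidean interior_of \<Union>(range F) = {}"
      using closed by (intro Baire_category_alt) (auto simp: completely_metrizable_space_euclidean)
    then show False using U by simp
  qed
  then obtain n x0 r where r: "r > 0" "ball x0 r \<subseteq> F n"
    by (meson all_not_in_conv mem_interior)
  define N where "N = real (Suc n)"
  have N: "N \<ge> 1" by (simp add: N_def)
  have *: "norm (T t x) \<le> (4 * N / r) * norm x" if "0 \<le> t" "t \<le> 1 / N" for t x
  proof (cases "x = 0")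
    case False
    interpret Tt: bounded_linear "T t" by (rule bounded_linear) fact
    define c where "c = r / (2 * norm x)"
    have c: "c > 0" "c * norm x = r / 2" using False r(1) by (auto simp: c_def)
    \<comment> \<open>\<open>c x\<close> is the vector of norm \<open>r/2\<close> in the direction of \<open>x\<close>.\<close>
    have "x0 + c *\<^sub>R x \<in> ball x0 r" using c r(1) by (simp add: dist_norm)
    then have "norm (T t (x0 + c *\<^sub>R x)) \<le> N" using r(2) that by (auto simp: F_def N_def)
    moreover have "x0 \<in> F n" using r by auto
    then have "norm (T t x0) \<le> N" using that by (auto simp: F_def N_def)
    ultimately have "norm (T t (x0 + c *\<^sub>R x) - T t x0) \<le> 2 * N"
      using norm_triangle_ineq4[of "T t (x0 + c *\<^sub>R x)" "T t x0"] by linarith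
    then have "c * norm (T t x) \<le> 2 * N" using c(1) by (simp add: Tt.add Tt.scaleR)
    then have "norm (T t x) \<le> 2 * N / c" using c(1) by (simp add: field_simps)
    then show ?thesis by (simp add: c_def field_simps)
  qed (use that lin_simps in auto)
  have "norm (T t x) \<le> max 1 (4 * N / r) * norm x" if "0 \<le> t" "t \<le> 1 / N" for t x
    using *[OF that, of x] by (rule order_trans) (intro mult_right_mono, auto)
  then show ?thesis using that[of "1 / N" "max 1 (4 * N / r)"] N by auto
qed

lemma growth_bound:
  obtains M \<omega> where "M \<ge> 1" "\<omega> \<ge> 0" "\<And>t x. 0 \<le> t \<Longrightarrow> norm (T t x) \<le> M * exp (\<omega> * t) * norm x"
proof -
  obtain \<tau> K where K: "\<tau> > 0" "K \<ge> 1" "\<And>t x. 0 \<le> t \<Longrightarrow> t \<le> \<tau> \<Longrightarrow> norm (T t x) \<le> K * norm x"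
    by (rule bounded_near_zero) blast
  define \<omega> where "\<omega> = ln K / \<tau>"
  have pow: "norm (T (real k * \<tau>) x) \<le> K ^ k * norm x" for k x
  proof (induction k)
    case (Suc k)
    have "norm (T (real (Suc k) * \<tau>) x) = norm (T \<tau> (T (real k * \<tau>) x))"
      using add[of \<tau> "real k * \<tau>"] K(1) by (simp add: algebra_simps)
    also have "\<dots> \<le> K * norm (T (real k * \<tau>) x)" using K by simp
    also have "\<dots> \<le> K * (K ^ k * norm x)" using K Suc by (intro mult_left_mono) auto
    finally show ?case by simp
  qed simp
  have "norm (T t x) \<le> K * exp (\<omega> * t) * norm x" if "0 \<le> t" for t x
  proof -
    define k where "k = nat \<lfloor>t / \<tau>\<rfloor>"
    have k: "real k \<le> t / \<tau>" "t / \<tau> < real k + 1"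
      using that K(1) by (auto simp: k_def)
    then have k': "real k * \<tau> \<le> t" "t - real k * \<tau> \<le> \<tau>" using K(1) by (auto simp: field_simps)
    have "norm (T t x) = norm (T (t - real k * \<tau>) (T (real k * \<tau>) x))"
      using add[of "t - real k * \<tau>" "real k * \<tau>" x] k' K(1) by simp
    also have "\<dots> \<le> K * norm (T (real k * \<tau>) x)" using K(3) k' by simp
    also have "\<dots> \<le> K * (K ^ k * norm x)" using K pow by (intro mult_left_mono) auto
    also have "K ^ k \<le> exp (\<omega> * t)"
    proof -
      have "K ^ k = exp (real k * ln K)" using K(2) by (simp add: exp_of_nat_mult)
      also have "\<dots> \<le> exp (\<omega> * t)"
        using mult_right_mono[OF k(1), of "ln K"] K(2) by (simp add: \<omega>_def mult.commute)
      finally show ?thesis .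
    qed
    finally show ?thesis using K(2) by (simp add: mult.assoc mult_left_mono mult_right_mono)
  qed
  then show ?thesis using that[of K \<omega>] K by (simp add: \<omega>_def)
qed

lemma continuous_orbit: "continuous_on {0..} (\<lambda>t. T t x)"
proof -
  obtain M \<omega> where M: "M \<ge> 1" "\<omega> \<ge> 0" "\<And>t x. 0 \<le> t \<Longrightarrow> norm (T t x) \<le> M * exp (\<omega> * t) * norm x"
    by (rule growth_bound) blast
  have le: "norm (T t x - T s x) \<le> M * exp (\<omega> * t) * norm (T \<bar>t - s\<bar> x - x)"
    if "0 \<le> s" "s \<le> t" "0 \<le> t" for s t
  proof -
    have "T t x - T s x = T s (T (t - s) x - x)"
      using add[of s "t - s" x] that by (simp add: lin_simps)
    then have "norm (T t x - T s x) \<le> M * exp (\<omega> * s) * norm (T \<bar>t - s\<bar> x - x)"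
      using M(3)[of s "T (t - s) x - x"] that by simp
    also have "\<dots> \<le> M * exp (\<omega> * t) * norm (T \<bar>t - s\<bar> x - x)"
      using M that by (intro mult_right_mono mult_left_mono) (auto intro: mult_left_mono)
    finally show ?thesis .
  qed
  show ?thesis
    unfolding continuous_on_def
  proof
    fix t :: real assume t: "t \<in> {0..}"
    have lim: "((\<lambda>s. T \<bar>t - s\<bar> x) \<longlongrightarrow> x) (at t within {0..})"
    proof (rule filterlim_compose[OF right_continuous])
      show "filterlim (\<lambda>s. \<bar>t - s\<bar>) (at_right 0) (at t within {0..})"
        unfolding filterlim_at
        by (intro conjI tendsto_eq_intros) (auto simp: eventually_at_filter)
    qed
    have "((\<lambda>s. T s x - T t x) \<longlongrightarrow> 0) (at t within {0..})"
    proof (rule Lim_null_comparison)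
      show "((\<lambda>s. M * exp (\<omega> * (t + \<bar>t - s\<bar>)) * norm (T \<bar>t - s\<bar> x - x)) \<longlongrightarrow> 0) (at t within {0..})"
        by (rule tendsto_eq_intros lim refl | simp)+
      show "\<forall>\<^sub>F s in at t within {0..}. norm (T s x - T t x)
          \<le> M * exp (\<omega> * (t + \<bar>t - s\<bar>)) * norm (T \<bar>t - s\<bar> x - x)"
        unfolding eventually_at_filter
      proof (intro always_eventually allI impI)
        fix s :: real assume s: "s \<in> {0..}"
        have mono: "M * exp (\<omega> * r) * norm (T \<bar>t - s\<bar> x - x) \<le>
          M * exp (\<omega> * (t + \<bar>t - s\<bar>)) * norm (T \<bar>t - s\<bar> x - x)" if "r \<le> t + \<bar>t - s\<bar>" for r
          using M that by (intro mult_right_mono mult_left_mono) (auto intro: mult_left_mono)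
        show "norm (T s x - T t x) \<le> M * exp (\<omega> * (t + \<bar>t - s\<bar>)) * norm (T \<bar>t - s\<bar> x - x)"
        proof (cases "s \<le> t")
          case True
          then show ?thesis using le[of s t] mono[of t] s t
            by (simp add: norm_minus_commute)
        next
          case False
          then show ?thesis using le[of t s] mono[of s] s t
            by (simp add: norm_minus_commute abs_minus_commute)
        qed
      qed
    qed
    then show "((\<lambda>s. T s x) \<longlongrightarrow> T t x) (at t within {0..})" by (simp add: LIM_zero_iff)
  qed
qed

text \<open>
Joint continuity of \<open>(t, x) \<mapsto> T t x\<close>. The formulation with a filter also serves difference
quotients, which are not defined at the limit point.
\<close>

lemma tendsto_orbit:
  assumes g: "(g \<longlongrightarrow> l) F" and nonneg: "\<forall>\<^sub>F s in F. 0 \<le> g s" "0 \<le> l" and f: "(f \<longlongrightarrow> y) F"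
  shows "((\<lambda>s. T (g s) (f s)) \<longlongrightarrow> T l y) F"
proof -
  obtain M \<omega> where M: "M \<ge> 1" "\<omega> \<ge> 0" "\<And>t x. 0 \<le> t \<Longrightarrow> norm (T t x) \<le> M * exp (\<omega> * t) * norm x"
    by (rule growth_bound) blast
  have "((\<lambda>s. T (g s) (f s - y)) \<longlongrightarrow> 0) F"
  proof (rule Lim_null_comparison)
    show "((\<lambda>s. M * exp (\<omega> * g s) * norm (f s - y)) \<longlongrightarrow> 0) F"
      by (rule tendsto_eq_intros g f refl | simp)+
    show "\<forall>\<^sub>F s in F. norm (T (g s) (f s - y)) \<le> M * exp (\<omega> * g s) * norm (f s - y)"
      using nonneg(1) by eventually_elim (rule M(3))
  qed
  moreover have "((\<lambda>s. T (g s) y) \<longlongrightarrow> T l y) F"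
    by (rule continuous_on_tendsto_compose[OF continuous_orbit g]) (use nonneg in auto)
  ultimately have "((\<lambda>s. T (g s) (f s - y) + T (g s) y) \<longlongrightarrow> 0 + T l y) F"
    by (rule tendsto_add)
  then have lim: "((\<lambda>s. T (g s) (f s - y) + T (g s) y) \<longlongrightarrow> T l y) F" by simp
  have "\<forall>\<^sub>F s in F. T (g s) (f s - y) + T (g s) y = T (g s) (f s)"
    using nonneg(1) by eventually_elim (simp add: lin_simps)
  then show ?thesis by (rule Lim_transform_eventually[OF lim])
qed

lemma continuous_on_orbit:
  assumes "continuous_on S g" "\<And>s. s \<in> S \<Longrightarrow> 0 \<le> g s" "continuous_on S f"
  shows "continuous_on S (\<lambda>s. T (g s) (f s))"
  unfolding continuous_on_def
proof
  fix s assume "s \<in> S"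
  then show "((\<lambda>s. T (g s) (f s)) \<longlongrightarrow> T (g s) (f s)) (at s within S)"
    using assms by (intro tendsto_orbit) (auto simp: continuous_on_def eventually_at_filter)
qed

lemma integrable_orbit: "0 \<le> a \<Longrightarrow> (\<lambda>s. T s x) integrable_on {a..b}"
  by (intro integrable_continuous_real continuous_on_subset[OF continuous_orbit]) auto

end

section \<open>The generator of a semigroup\<close>

lemma integral_right_derivative:
  fixes f :: "real \<Rightarrow> 'b::banach"
  assumes "continuous_on {0..} f" "0 \<le> a"
  shows "((\<lambda>h. integral {a..a + h} f /\<^sub>R h) \<longlongrightarrow> f a) (at_right 0)"
proof -
  have "((\<lambda>u. integral {a..u} f) has_vector_derivative f a) (at a within {a..a + 1})"
    using assms(2) by (intro integral_has_vector_derivative continuous_on_subset[OF assms(1)]) auto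
  then have lim: "((\<lambda>u. integral {a..u} f /\<^sub>R (u - a)) \<longlongrightarrow> f a) (at_right a)"
    by (simp add: has_vector_derivative_within_quotient at_within_Icc_at_right)
  have "filterlim (\<lambda>h. a + h) (at_right a) (at_right 0)"
    using filterlim_at_right_to_0[of "\<lambda>x. x" "at_right a" a]
    by (simp add: filterlim_ident add.commute)
  from filterlim_compose[OF lim this] show ?thesis by simp
qed

locale generated_semigroup = c0_semigroup T for T :: "real \<Rightarrow> 'b::banach \<Rightarrow> 'b" +
  fixes D :: "'b set" and A :: "'b \<Rightarrow> 'b"
  assumes domain: "D = {x. \<exists>y. ((\<lambda>h. (T h x - x) /\<^sub>R h) \<longlongrightarrow> y) (at_right 0)}"
    and generator: "x \<in> D \<Longrightarrow> ((\<lambda>h. (T h x - x) /\<^sub>R h) \<longlongrightarrow> A x) (at_right 0)"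
begin

lemma generatorI:
  assumes "((\<lambda>h. (T h x - x) /\<^sub>R h) \<longlongrightarrow> y) (at_right 0)"
  shows "x \<in> D" "A x = y"
proof -
  show "x \<in> D" using assms domain by blast
  then show "A x = y"
    using tendsto_unique[OF trivial_limit_at_right_real generator assms] by simp
qed

lemma generator_add:
  assumes "x \<in> D" "y \<in> D"
  shows "x + y \<in> D" "A (x + y) = A x + A y"
proof -
  have lim: "((\<lambda>h. (T h x - x) /\<^sub>R h + (T h y - y) /\<^sub>R h) \<longlongrightarrow> A x + A y) (at_right 0)"
    by (intro tendsto_add generator assms)
  have "\<forall>\<^sub>F h in at_right 0. (T h x - x) /\<^sub>R h + (T h y - y) /\<^sub>R h = (T h (x + y) - (x + y)) /\<^sub>R h"
    unfolding eventually_at_filter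
    by (intro always_eventually) (auto simp: lin_simps algebra_simps)
  then have "((\<lambda>h. (T h (x + y) - (x + y)) /\<^sub>R h) \<longlongrightarrow> A x + A y) (at_right 0)"
    by (rule Lim_transform_eventually[OF lim])
  then show "x + y \<in> D" "A (x + y) = A x + A y" by (rule generatorI)+
qed

lemma generator_linear_image:
  assumes P: "bounded_linear P" "\<And>t. 0 \<le> t \<Longrightarrow> P (T t x) = T t (P x)" and "x \<in> D"
  shows "P x \<in> D" "A (P x) = P (A x)"
proof -
  interpret P: bounded_linear P by fact
  have lim: "((\<lambda>h. P ((T h x - x) /\<^sub>R h)) \<longlongrightarrow> P (A x)) (at_right 0)"
    by (intro P.tendsto generator assms)
  have "\<forall>\<^sub>F h in at_right 0. P ((T h x - x) /\<^sub>R h) = (T h (P x) - P x) /\<^sub>R h"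
    unfolding eventually_at_filter
    by (intro always_eventually) (auto simp: P.scaleR P.diff P(2))
  then have "((\<lambda>h. (T h (P x) - P x) /\<^sub>R h) \<longlongrightarrow> P (A x)) (at_right 0)"
    by (rule Lim_transform_eventually[OF lim])
  then show "P x \<in> D" "A (P x) = P (A x)" by (rule generatorI)+
qed

lemma generator_scaleR: "x \<in> D \<Longrightarrow> c *\<^sub>R x \<in> D" "x \<in> D \<Longrightarrow> A (c *\<^sub>R x) = c *\<^sub>R A x"
  using generator_linear_image[of "\<lambda>x. c *\<^sub>R x" x]
  by (auto simp: bounded_linear_scaleR_right lin_simps)

lemma generator_orbit:
  assumes "x \<in> D" "0 \<le> t"
  shows "T t x \<in> D" "A (T t x) = T t (A x)"
  using generator_linear_image[of "T t" x] assms by (auto simp: bounded_linear commute)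

lemma orbit_derivative:
  assumes x: "x \<in> D" and t: "0 \<le> t"
  shows "((\<lambda>s. T s x) has_vector_derivative T t (A x)) (at t within {0..})"
  unfolding has_vector_derivative_within_quotient
proof -
  \<comment> \<open>Both one-sided quotients at \<open>t\<close> are \<open>T (min s t)\<close> applied to the right-hand quotient
     at \<open>0\<close> with step \<open>|t - s|\<close>, so joint continuity settles them together.\<close>
  have "((\<lambda>s. (T \<bar>t - s\<bar> x - x) /\<^sub>R \<bar>t - s\<bar>) \<longlongrightarrow> A x) (at t within {0..})"
  proof (rule filterlim_compose[OF generator[OF x]])
    show "filterlim (\<lambda>s. \<bar>t - s\<bar>) (at_right 0) (at t within {0..})"
      unfolding filterlim_at
      by (intro conjI tendsto_eq_intros) (auto simp: eventually_at_filter)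
  qed
  moreover have "((\<lambda>s. min s t) \<longlongrightarrow> t) (at t within {0..})"
    by (rule tendsto_eq_intros refl | simp)+
  ultimately have lim: "((\<lambda>s. T (min s t) ((T \<bar>t - s\<bar> x - x) /\<^sub>R \<bar>t - s\<bar>)) \<longlongrightarrow> T t (A x)) (at t within {0..})"
    using t by (intro tendsto_orbit) (auto simp: eventually_at_filter)
  have "\<forall>\<^sub>F s in at t within {0..}. T (min s t) ((T \<bar>t - s\<bar> x - x) /\<^sub>R \<bar>t - s\<bar>) = (T s x - T t x) /\<^sub>R (s - t)"
    unfolding eventually_at_filter
  proof (intro always_eventually allI impI)
    fix s assume s: "s \<noteq> t" "s \<in> {0..}"
    show "T (min s t) ((T \<bar>t - s\<bar> x - x) /\<^sub>R \<bar>t - s\<bar>) = (T s x - T t x) /\<^sub>R (s - t)"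
    proof (cases "s < t")
      case True
      then have "T (min s t) ((T \<bar>t - s\<bar> x - x) /\<^sub>R \<bar>t - s\<bar>) = (T t x - T s x) /\<^sub>R (t - s)"
        using s add[of s "t - s" x] by (simp add: lin_simps)
      also have "\<dots> = - ((T s x - T t x) /\<^sub>R (t - s))" by (simp flip: scaleR_minus_right)
      also have "\<dots> = (T s x - T t x) /\<^sub>R (s - t)"
        by (metis inverse_minus_eq minus_diff_eq scaleR_minus_left)
      finally show ?thesis .
    next
      case False
      then show ?thesis using s t add[of t "s - t" x] by (simp add: lin_simps)
    qed
  qed
  then show "((\<lambda>s. (T s x - T t x) /\<^sub>R (s - t)) \<longlongrightarrow> T t (A x)) (at t within {0..})"
    by (rule Lim_transform_eventually[OF lim])
qed

lemma integral_generator_orbit: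
  assumes "x \<in> D" "0 \<le> t"
  shows "integral {0..t} (\<lambda>s. T s (A x)) = T t x - x"
proof -
  have "((\<lambda>s. T s (A x)) has_integral (T t x - T 0 x)) {0..t}"
    using assms(2)
    by (intro fundamental_theorem_of_calculus has_vector_derivative_within_subset[OF orbit_derivative]
        assms) auto
  then show ?thesis by (simp add: integral_unique)
qed

lemma orbit_integral_shift:
  assumes "0 \<le> h" "0 \<le> t"
  shows "T h (integral {0..t} (\<lambda>s. T s x)) = integral {h..t + h} (\<lambda>s. T s x)"
proof -
  have "T h (integral {0..t} (\<lambda>s. T s x)) = integral {0..t} (T h \<circ> (\<lambda>s. T s x))"
    using assms by (intro integral_linear[symmetric] integrable_orbit bounded_linear) auto
  also have "\<dots> = integral {0..t} ((\<lambda>s. T s x) \<circ> (+) h)"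
    using assms by (intro integral_cong) (simp add: add)
  also have "\<dots> = integral {h..t + h} (\<lambda>s. T s x)"
    by (simp add: integral_shift_Icc_real)
  finally show ?thesis .
qed

lemma generator_integral:
  assumes t: "0 \<le> t"
  shows "integral {0..t} (\<lambda>s. T s x) \<in> D" "A (integral {0..t} (\<lambda>s. T s x)) = T t x - x"
proof -
  let ?I = "\<lambda>a b. integral {a..b} (\<lambda>s. T s x)"
  have lim: "((\<lambda>h. ?I t (t + h) /\<^sub>R h - ?I 0 (0 + h) /\<^sub>R h) \<longlongrightarrow> T t x - T 0 x) (at_right 0)"
    using t by (intro tendsto_diff integral_right_derivative continuous_orbit) auto
  have "\<forall>\<^sub>F h in at_right 0. ?I t (t + h) /\<^sub>R h - ?I 0 (0 + h) /\<^sub>R h = (T h (?I 0 t) - ?I 0 t) /\<^sub>R h"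
    unfolding eventually_at_filter
  proof (intro always_eventually allI impI)
    fix h :: real assume "h \<in> {0<..}"
    then have h: "0 \<le> h" by simp
    have "?I 0 h + ?I h (t + h) = ?I 0 (t + h)"
      by (rule Henstock_Kurzweil_Integration.integral_combine) (use h t in \<open>auto intro!: integrable_orbit\<close>)
    moreover have "?I 0 t + ?I t (t + h) = ?I 0 (t + h)"
      by (rule Henstock_Kurzweil_Integration.integral_combine) (use h t in \<open>auto intro!: integrable_orbit\<close>)
    ultimately have "T h (?I 0 t) - ?I 0 t = ?I t (t + h) - ?I 0 h"
      using orbit_integral_shift[OF h t] by (simp add: algebra_simps)
    then show "?I t (t + h) /\<^sub>R h - ?I 0 (0 + h) /\<^sub>R h = (T h (?I 0 t) - ?I 0 t) /\<^sub>R h"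
      by (simp add: scaleR_diff_right)
  qed
  then have "((\<lambda>h. (T h (?I 0 t) - ?I 0 t) /\<^sub>R h) \<longlongrightarrow> T t x - T 0 x) (at_right 0)"
    by (rule Lim_transform_eventually[OF lim])
  from generatorI[OF this] show "?I 0 t \<in> D" "A (?I 0 t) = T t x - x" by simp_all
qed

text \<open>
The means of an orbit over \<open>[0, h]\<close> lie in the domain and tend to the initial value.
\<close>

lemma domain_dense: "closure D = UNIV"
proof -
  have "x \<in> closure D" for x
  proof (rule Lim_in_closed_set[OF closed_closure _ trivial_limit_at_right_real])
    show "((\<lambda>h. integral {0..0 + h} (\<lambda>s. T s x) /\<^sub>R h) \<longlongrightarrow> x) (at_right 0)"
      using integral_right_derivative[OF continuous_orbit, of 0 x] by simp
    show "\<forall>\<^sub>F h in at_right 0. integral {0..0 + h} (\<lambda>s. T s x) /\<^sub>R h \<in> closure D"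
      unfolding eventually_at_filter
      by (intro always_eventually)
        (auto intro!: closure_subset[THEN subsetD] generator_scaleR generator_integral)
  qed
  then show ?thesis by blast
qed

lemma bounded_linear_eq_on_domain:
  assumes "bounded_linear P" "bounded_linear Q" "\<And>x. x \<in> D \<Longrightarrow> P x = Q x"
  shows "P x = Q x"
proof -
  have "closed {x. P x = Q x}"
    using assms(1,2) by (intro closed_Collect_eq linear_continuous_on)
  then have "closure D \<subseteq> {x. P x = Q x}"
    using assms(3) by (intro closure_minimal) auto
  then show ?thesis using domain_dense by blast
qed

text \<open>
The identity \<open>T t x - x = \<integral>\<^sub>0\<^sup>t T s (A x) ds\<close> survives the limit, and differentiating it at
\<open>0\<close> recovers the generator.
\<close>

lemma generator_closed:
  assumes xn: "\<And>n. X n \<in> D" and x: "X \<longlonglongrightarrow> x" and y: "(\<lambda>n. A (X n)) \<longlonglongrightarrow> y"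
  shows "x \<in> D" "A x = y"
proof -
  obtain M \<omega> where M: "M \<ge> 1" "\<omega> \<ge> 0" "\<And>t x. 0 \<le> t \<Longrightarrow> norm (T t x) \<le> M * exp (\<omega> * t) * norm x"
    by (rule growth_bound) blast
  have eq: "T t x - x = integral {0..t} (\<lambda>s. T s y)" if t: "0 \<le> t" for t
  proof (rule LIMSEQ_unique)
    show "(\<lambda>n. T t (X n) - X n) \<longlonglongrightarrow> T t x - x"
      using t by (intro tendsto_diff x bounded_linear.tendsto[OF bounded_linear])
    show "(\<lambda>n. T t (X n) - X n) \<longlonglongrightarrow> integral {0..t} (\<lambda>s. T s y)"
    proof -
      have "uniform_limit {0..t} (\<lambda>n s. T s (A (X n))) (\<lambda>s. T s y) sequentially"
      proof (rule uniform_limitI)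
        fix e :: real assume "e > 0"
        define K where "K = M * exp (\<omega> * t)"
        have K: "K > 0" using M by (simp add: K_def)
        have "\<forall>\<^sub>F n in sequentially. norm (A (X n) - y) < e / K"
          using tendstoD[OF y, of "e / K"] \<open>e > 0\<close> K by (simp add: dist_norm)
        then show "\<forall>\<^sub>F n in sequentially. \<forall>s\<in>{0..t}. dist (T s (A (X n))) (T s y) < e"
        proof eventually_elim
          case (elim n)
          show ?case
          proof
            fix s assume s: "s \<in> {0..t}"
            have "dist (T s (A (X n))) (T s y) = norm (T s (A (X n) - y))"
              using s by (simp add: dist_norm lin_simps)
            also have "\<dots> \<le> M * exp (\<omega> * s) * norm (A (X n) - y)" using s M(3) by simp
            also have "\<dots> \<le> K * norm (A (X n) - y)"
              unfolding K_def using s M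
              by (intro mult_right_mono mult_left_mono) (auto intro: mult_left_mono)
            also have "\<dots> < e" using elim K by (simp add: field_simps)
            finally show "dist (T s (A (X n))) (T s y) < e" .
          qed
        qed
      qed
      moreover have "continuous_on {0..t} (\<lambda>s. T s z)" for z
        by (rule continuous_on_subset[OF continuous_orbit]) auto
      ultimately have "(\<lambda>n. integral {0..t} (\<lambda>s. T s (A (X n)))) \<longlonglongrightarrow> integral {0..t} (\<lambda>s. T s y)"
        by (rule uniform_limit_integral_tendsto) auto
      then show ?thesis using integral_generator_orbit[OF xn t] by simp
    qed
  qed
  have lim: "((\<lambda>h. integral {0..0 + h} (\<lambda>s. T s y) /\<^sub>R h) \<longlongrightarrow> T 0 y) (at_right 0)"
    by (intro integral_right_derivative continuous_orbit) auto
  have "\<forall>\<^sub>F h in at_right 0. integral {0..0 + h} (\<lambda>s. T s y) /\<^sub>R h = (T h x - x) /\<^sub>R h"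
    unfolding eventually_at_filter by (intro always_eventually) (auto simp: eq)
  then have "((\<lambda>h. (T h x - x) /\<^sub>R h) \<longlongrightarrow> T 0 y) (at_right 0)"
    by (rule Lim_transform_eventually[OF lim])
  from generatorI[OF this] show "x \<in> D" "A x = y" by simp_all
qed

end

text \<open>
For \<open>x\<close> in the domain the curve \<open>r \<mapsto> S (t - r) (P (T r x))\<close> has derivative zero, so its values
at \<open>0\<close> and \<open>t\<close> agree; density does the rest. With \<open>P\<close> a scalar multiplication, a map
\<open>c \<mapsto> c w\<close> from the scalars, or a projection, this yields complex linearity, orbits of
eigenvectors, and the explicit form of a perturbed semigroup.
\<close>

lemma semigroup_intertwine:
  assumes S: "generated_semigroup S D' C" and T: "generated_semigroup T D A"
    and P: "bounded_linear P" "\<And>x. x \<in> D \<Longrightarrow> P x \<in> D'" "\<And>x. x \<in> D \<Longrightarrow> C (P x) = P (A x)"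
    and t: "0 \<le> t"
  shows "S t (P x) = P (T t x)"
proof -
  interpret S: generated_semigroup S D' C by fact
  interpret T: generated_semigroup T D A by fact
  interpret P: bounded_linear P by fact
  have *: "S t (P x) = P (T t x)" if x: "x \<in> D" for x
  proof -
    define f where "f r = S (t - r) (P (T r x))" for r
    have "(f has_vector_derivative 0) (at r within {0..t})" if r: "r \<in> {0..t}" for r
      unfolding has_vector_derivative_within_quotient
    proof -
      let ?F = "at r within {0..t}"
      let ?y = "P (T r x)"
      have y: "?y \<in> D'" using r x by (intro P(2) T.generator_orbit) auto
      have "((\<lambda>s. T s x) has_vector_derivative T r (A x)) ?F"
        using r by (intro has_vector_derivative_within_subset[OF T.orbit_derivative] x) auto
      then have "((\<lambda>s. P ((T s x - T r x) /\<^sub>R (s - r))) \<longlongrightarrow> P (T r (A x))) ?F"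
        by (intro P.tendsto) (simp add: has_vector_derivative_within_quotient)
      moreover have "((\<lambda>s. t - s) \<longlongrightarrow> t - r) ?F" by (intro tendsto_intros)
      ultimately have 1: "((\<lambda>s. S (t - s) (P ((T s x - T r x) /\<^sub>R (s - r)))) \<longlongrightarrow> S (t - r) (P (T r (A x)))) ?F"
        using r by (intro S.tendsto_orbit) (auto simp: eventually_at_filter)
      have "((\<lambda>s. S s ?y) has_vector_derivative S (t - r) (C ?y)) (at (t - r) within {0..})"
        using r by (intro S.orbit_derivative y) auto
      then have "((\<lambda>s. (S s ?y - S (t - r) ?y) /\<^sub>R (s - (t - r))) \<longlongrightarrow> S (t - r) (C ?y)) (at (t - r) within {0..})"
        by (simp add: has_vector_derivative_within_quotient)
      moreover have "filterlim (\<lambda>s. t - s) (at (t - r) within {0..}) ?F"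
        unfolding filterlim_at by (intro conjI tendsto_intros) (auto simp: eventually_at_filter)
      ultimately have 2: "((\<lambda>s. (S (t - s) ?y - S (t - r) ?y) /\<^sub>R ((t - s) - (t - r))) \<longlongrightarrow> S (t - r) (C ?y)) ?F"
        by (rule filterlim_compose)
      have C: "C ?y = P (T r (A x))" using r x P(3)[OF T.generator_orbit(1)] T.generator_orbit(2) by simp
      have lim: "((\<lambda>s. S (t - s) (P ((T s x - T r x) /\<^sub>R (s - r))) - (S (t - s) ?y - S (t - r) ?y) /\<^sub>R ((t - s) - (t - r))) \<longlongrightarrow> 0) ?F"
        using tendsto_diff[OF 1 2] by (simp add: C)
      have "\<forall>\<^sub>F s in ?F. S (t - s) (P ((T s x - T r x) /\<^sub>R (s - r))) - (S (t - s) ?y - S (t - r) ?y) /\<^sub>R ((t - s) - (t - r))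
          = (f s - f r) /\<^sub>R (s - r)"
        unfolding eventually_at_filter
      proof (intro always_eventually allI impI)
        fix s assume "s \<noteq> r" "s \<in> {0..t}"
        have "inverse ((t - s) - (t - r)) = - inverse (s - r)"
          by (simp flip: inverse_minus_eq)
        then show "S (t - s) (P ((T s x - T r x) /\<^sub>R (s - r))) - (S (t - s) ?y - S (t - r) ?y) /\<^sub>R ((t - s) - (t - r))
          = (f s - f r) /\<^sub>R (s - r)"
          using \<open>s \<in> {0..t}\<close> by (simp add: f_def S.lin_simps P.scaleR P.diff scaleR_diff_right)
      qed
      then show "((\<lambda>s. (f s - f r) /\<^sub>R (s - r)) \<longlongrightarrow> 0) ?F"
        by (rule Lim_transform_eventually[OF lim])
    qed
    note deriv = this
    have "f 0 = f t"
    proof (rule has_vector_derivative_zero_constant[OF convex_real_interval(5) deriv])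
      fix c assume "\<And>r. r \<in> {0..t} \<Longrightarrow> f r = c"
      then show "f 0 = f t" using t by simp
    qed
    then show ?thesis by (simp add: f_def)
  qed
  show ?thesis
  proof (rule T.bounded_linear_eq_on_domain[of "\<lambda>x. S t (P x)" "\<lambda>x. P (T t x)"])
    show "bounded_linear (\<lambda>x. S t (P x))"
      using bounded_linear_compose[OF S.bounded_linear[OF t] P(1)] .
    show "bounded_linear (\<lambda>x. P (T t x))"
      using bounded_linear_compose[OF P(1) T.bounded_linear[OF t]] .
  qed (rule *)
qed

section \<open>Exponentially stable semigroups and resolvents\<close>

locale stable_semigroup = generated_semigroup T D A
  for T :: "real \<Rightarrow> 'b::banach \<Rightarrow> 'b" and D A +
  fixes M \<delta> :: real
  assumes rate: "\<delta> > 0" and stable: "0 \<le> t \<Longrightarrow> norm (T t x) \<le> M * exp (- \<delta> * t) * norm x"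
begin

text \<open>
The operator \<open>x \<mapsto> \<integral>\<^sub>0\<^sup>\<infinity> T s x ds\<close>, which is the inverse of \<open>-A\<close>. Applied to a rescaled semigroup
it is the Laplace transform and gives the resolvent.
\<close>

definition orbit_integral :: "'b \<Rightarrow> 'b" where
  "orbit_integral x = lim (\<lambda>n. integral {0..real n} (\<lambda>s. T s x))"

lemma orbit_integral_tail:
  assumes "\<And>t. 0 \<le> t \<Longrightarrow> norm (T t x) \<le> K * exp (- \<delta> * t)" "0 \<le> a" "a \<le> b"
  shows "norm (integral {a..b} (\<lambda>s. T s x)) \<le> K / \<delta> * exp (- \<delta> * a)"
proof -
  have "0 \<le> K" using order_trans[OF norm_ge_zero assms(1)[of 0]] by simp
  have "norm (integral {a..b} (\<lambda>s. T s x)) \<le> K / (- \<delta>) * (exp (- \<delta> * b) - exp (- \<delta> * a))"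
    using assms rate by (intro norm_integral_exp_bound integrable_orbit) auto
  also have "\<dots> \<le> K / \<delta> * exp (- \<delta> * a)"
    using rate \<open>0 \<le> K\<close> by (simp add: field_simps)
  finally show ?thesis .
qed

lemma orbit_integral_LIMSEQ: "(\<lambda>n. integral {0..real n} (\<lambda>s. T s x)) \<longlonglongrightarrow> orbit_integral x"
proof -
  let ?F = "\<lambda>n. integral {0..real n} (\<lambda>s. T s x)"
  have bound: "norm (?F n - ?F m) \<le> M * norm x / \<delta> * exp (- \<delta> * real m)" if "m \<le> n" for m n
  proof -
    have "?F m + integral {real m..real n} (\<lambda>s. T s x) = ?F n"
      using that by (intro Henstock_Kurzweil_Integration.integral_combine integrable_orbit) auto
    then have "?F n - ?F m = integral {real m..real n} (\<lambda>s. T s x)"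
      by (simp add: algebra_simps)
    moreover have "norm (T t x) \<le> M * norm x * exp (- \<delta> * t)" if "0 \<le> t" for t
      using stable[OF that, of x] by (simp add: mult_ac)
    ultimately show ?thesis using orbit_integral_tail[of x "M * norm x" "real m" "real n"] that by simp
  qed
  have "((\<lambda>m. M * norm x / \<delta> * exp (- \<delta> * real m)) \<longlonglongrightarrow> 0)"
    using rate by real_asymp
  have "Cauchy ?F"
  proof (rule CauchyI')
    fix e :: real assume "e > 0"
    with \<open>_ \<longlonglongrightarrow> 0\<close> have "\<forall>\<^sub>F m in sequentially. M * norm x / \<delta> * exp (- \<delta> * real m) < e"
      by (rule order_tendstoD)
    then obtain N where N: "\<And>m. m \<ge> N \<Longrightarrow> M * norm x / \<delta> * exp (- \<delta> * real m) < e"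
      by (auto simp: eventually_sequentially)
    have "dist (?F m) (?F n) < e" if "N \<le> m" "m < n" for m n
      using bound[of m n] N[of m] that by (simp add: dist_norm norm_minus_commute)
    then show "\<exists>N. \<forall>m\<ge>N. \<forall>n>m. dist (?F m) (?F n) < e" by blast
  qed
  then show ?thesis
    unfolding orbit_integral_def Cauchy_convergent_iff convergent_LIMSEQ_iff .
qed

lemma orbit_LIMSEQ_zero: "(\<lambda>n. T (real n) x) \<longlonglongrightarrow> 0"
proof (rule Lim_null_comparison)
  show "(\<lambda>n. M * exp (- \<delta> * real n) * norm x) \<longlonglongrightarrow> 0" using rate by real_asymp
  show "\<forall>\<^sub>F n in sequentially. norm (T (real n) x) \<le> M * exp (- \<delta> * real n) * norm x"
    by (intro always_eventually allI stable) simp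
qed

text \<open>
The generator maps \<open>\<integral>\<^sub>0\<^sup>n T s x ds\<close> to \<open>T n x - x\<close>, which tends to \<open>-x\<close>; the generator is closed.
\<close>

lemma generator_orbit_integral: "orbit_integral x \<in> D" "A (orbit_integral x) = - x"
proof -
  have "(\<lambda>n. T (real n) x - x) \<longlonglongrightarrow> 0 - x"
    by (intro tendsto_diff orbit_LIMSEQ_zero tendsto_const)
  then have lim: "(\<lambda>n. A (integral {0..real n} (\<lambda>s. T s x))) \<longlonglongrightarrow> - x"
    by (simp add: generator_integral)
  have "integral {0..real n} (\<lambda>s. T s x) \<in> D" for n by (rule generator_integral) simp
  note closed = generator_closed[OF this orbit_integral_LIMSEQ lim]
  show "orbit_integral x \<in> D" by (rule closed)
  show "A (orbit_integral x) = - x" by (rule closed)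
qed

lemma orbit_integral_generator:
  assumes "x \<in> D" shows "orbit_integral (A x) = - x"
proof (rule LIMSEQ_unique[OF orbit_integral_LIMSEQ])
  have "(\<lambda>n. T (real n) x - x) \<longlonglongrightarrow> 0 - x"
    by (intro tendsto_diff orbit_LIMSEQ_zero tendsto_const)
  moreover have "integral {0..real n} (\<lambda>s. T s (A x)) = T (real n) x - x" for n
    by (intro integral_generator_orbit assms) simp
  ultimately show "(\<lambda>n. integral {0..real n} (\<lambda>s. T s (A x))) \<longlonglongrightarrow> - x" by simp
qed

lemma orbit_integral_mem_cone:
  assumes "closed C" "convex_cone C" "\<And>t. 0 \<le> t \<Longrightarrow> T t x \<in> C"
  shows "orbit_integral x \<in> C"
  by (rule closed_sequentially[OF assms(1) _ orbit_integral_LIMSEQ])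
    (auto intro!: integral_mem_closed_convex_cone integrable_orbit assms)

lemma norm_orbit_integral_le:
  assumes "\<And>t. 0 \<le> t \<Longrightarrow> norm (T t x) \<le> K * exp (- \<delta> * t)"
  shows "norm (orbit_integral x) \<le> K / \<delta>"
  by (rule LIMSEQ_le_const2[OF tendsto_norm[OF orbit_integral_LIMSEQ]])
    (use orbit_integral_tail[OF assms, of 0] in auto)

lemma orbit_integral_commute:
  assumes P: "bounded_linear P" "\<And>t y. 0 \<le> t \<Longrightarrow> P (T t y) = T t (P y)"
  shows "P (orbit_integral x) = orbit_integral (P x)"
proof (rule LIMSEQ_unique)
  show "(\<lambda>n. P (integral {0..real n} (\<lambda>s. T s x))) \<longlonglongrightarrow> P (orbit_integral x)"
    by (intro bounded_linear.tendsto[OF P(1)] orbit_integral_LIMSEQ)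
  have "P (integral {0..real n} (\<lambda>s. T s x)) = integral {0..real n} (\<lambda>s. T s (P x))" for n
  proof -
    have "P (integral {0..real n} (\<lambda>s. T s x)) = integral {0..real n} (P \<circ> (\<lambda>s. T s x))"
      by (intro integral_linear[symmetric] integrable_orbit P) auto
    also have "\<dots> = integral {0..real n} (\<lambda>s. T s (P x))"
      by (intro integral_cong) (simp add: P)
    finally show ?thesis .
  qed
  then show "(\<lambda>n. P (integral {0..real n} (\<lambda>s. T s x))) \<longlonglongrightarrow> orbit_integral (P x)"
    by (simp add: orbit_integral_LIMSEQ)
qed

lemma bounded_linear_orbit_integral: "bounded_linear orbit_integral"
proof (rule bounded_linear_intro)
  fix x y and r :: real
  show "orbit_integral (x + y) = orbit_integral x + orbit_integral y"
  proof (rule LIMSEQ_unique[OF orbit_integral_LIMSEQ])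
    have "integral {0..real n} (\<lambda>s. T s (x + y)) =
        integral {0..real n} (\<lambda>s. T s x) + integral {0..real n} (\<lambda>s. T s y)" for n
    proof -
      have "integral {0..real n} (\<lambda>s. T s (x + y)) = integral {0..real n} (\<lambda>s. T s x + T s y)"
        by (intro integral_cong) (simp add: lin_simps)
      also have "\<dots> = integral {0..real n} (\<lambda>s. T s x) + integral {0..real n} (\<lambda>s. T s y)"
        by (intro integral_add integrable_orbit) auto
      finally show ?thesis .
    qed
    then show "(\<lambda>n. integral {0..real n} (\<lambda>s. T s (x + y))) \<longlonglongrightarrow> orbit_integral x + orbit_integral y"
      by (simp add: tendsto_add orbit_integral_LIMSEQ)
  qed
  show "orbit_integral (r *\<^sub>R x) = r *\<^sub>R orbit_integral x"
    by (rule orbit_integral_commute[symmetric]) (auto simp: bounded_linear_scaleR_right lin_simps)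
  have "norm (orbit_integral x) \<le> M * norm x / \<delta>"
    by (rule norm_orbit_integral_le) (use stable[of _ x] in \<open>simp add: mult_ac\<close>)
  then show "norm (orbit_integral x) \<le> norm x * (M / \<delta>)" by (simp add: mult_ac)
qed

end

text \<open>
The scalar multiplication \<open>sc\<close> is a parameter because rescaling is needed with real scalars on
an arbitrary Banach space and with complex scalars on a complexification. The domain does not grow
since multiplication by \<open>exp (- t m)\<close> undoes the rescaling.
\<close>

lemma scaled_semigroup:
  fixes sc :: "'k::{real_normed_field,banach} \<Rightarrow> 'b::banach \<Rightarrow> 'b"
  assumes T: "generated_semigroup T D A"
    and sc: "bounded_bilinear sc" "\<And>x. sc 1 x = x" "\<And>a b x. sc (a * b) x = sc a (sc b x)"
    and comm: "\<And>t a x. 0 \<le> t \<Longrightarrow> T t (sc a x) = sc a (T t x)"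
  shows "generated_semigroup (\<lambda>t x. sc (exp (of_real t * m)) (T t x)) D (\<lambda>x. A x + sc m x)"
proof -
  interpret T: generated_semigroup T D A by fact
  interpret sc: bounded_bilinear sc by fact
  have exp0: "((\<lambda>t. exp (of_real t * m)) \<longlongrightarrow> 1) (at_right (0::real))" for m :: 'k
    by (rule tendsto_eq_intros refl | simp)+
  \<comment> \<open>The product rule at \<open>0\<close>. The family \<open>V\<close> is arbitrary so that the rule also applies to the
     rescaled semigroup, whose rescaling by \<open>- m\<close> is \<open>T\<close> again.\<close>
  have lim: "((\<lambda>h. (sc (exp (of_real h * m)) (V h) - x) /\<^sub>R h) \<longlongrightarrow> y + sc m x) (at_right 0)"
    if V: "((\<lambda>h. (V h - x) /\<^sub>R h) \<longlongrightarrow> y) (at_right 0)" for V x y and m :: 'k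
  proof -
    have "((\<lambda>h. exp (of_real h * m)) has_vector_derivative m) (at 0 within {0..})"
      by (rule has_vector_derivative_real_field) (auto intro!: derivative_eq_intros)
    then have "((\<lambda>h. (exp (of_real h * m) - 1) /\<^sub>R h) \<longlongrightarrow> m) (at 0 within {0..})"
      by (simp add: has_vector_derivative_within_quotient)
    then have "((\<lambda>h. (exp (of_real h * m) - 1) /\<^sub>R h) \<longlongrightarrow> m) (at_right 0)"
      by (rule tendsto_within_subset) auto
    then have L: "((\<lambda>h. sc (exp (of_real h * m)) ((V h - x) /\<^sub>R h) +
        sc ((exp (of_real h * m) - 1) /\<^sub>R h) x) \<longlongrightarrow> sc 1 y + sc m x) (at_right 0)"
      by (intro tendsto_add sc.tendsto exp0 V tendsto_const)
    have "\<forall>\<^sub>F h in at_right 0. sc (exp (of_real h * m)) ((V h - x) /\<^sub>R h) +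
        sc ((exp (of_real h * m) - 1) /\<^sub>R h) x = (sc (exp (of_real h * m)) (V h) - x) /\<^sub>R h"
      by (intro always_eventually allI)
        (simp add: sc.scaleR_left sc.scaleR_right sc.diff_left sc.diff_right sc(2) scaleR_diff_right)
    then show ?thesis using Lim_transform_eventually[OF L] by (simp add: sc(2))
  qed
  have undo: "sc (exp (of_real h * - m)) (sc (exp (of_real h * m)) z) = z" for h :: real and z
  proof -
    have "exp (of_real h * - m) * exp (of_real h * m) = (1::'k)"
      by (simp add: exp_minus_inverse mult.commute exp_minus)
    then show ?thesis by (metis sc(2) sc(3))
  qed
  show ?thesis
  proof (intro generated_semigroup.intro c0_semigroup.intro generated_semigroup_axioms.intro)
    fix t s :: real and x
    show "bounded_linear (\<lambda>x. sc (exp (of_real t * m)) (T t x))" if "0 \<le> t"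
      by (rule bounded_linear_compose[OF sc.bounded_linear_right T.bounded_linear[OF that]])
    show "sc (exp (of_real 0 * m)) (T 0 x) = x" by (simp add: sc(2))
    show "sc (exp (of_real (s + t) * m)) (T (s + t) x) =
        sc (exp (of_real s * m)) (T s (sc (exp (of_real t * m)) (T t x)))" if "0 \<le> s" "0 \<le> t"
      using that by (simp add: comm T.add distrib_right exp_add sc(3))
    have "((\<lambda>t. sc (exp (of_real t * m)) (T t x)) \<longlongrightarrow> sc 1 x) (at_right 0)"
      by (intro sc.tendsto exp0 T.right_continuous)
    then show "((\<lambda>t. sc (exp (of_real t * m)) (T t x)) \<longlongrightarrow> x) (at_right 0)" by (simp add: sc(2))
    show "((\<lambda>h. (sc (exp (of_real h * m)) (T h x) - x) /\<^sub>R h) \<longlongrightarrow> A x + sc m x) (at_right 0)"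
      if "x \<in> D" by (intro lim T.generator that)
    show "D = {x. \<exists>y. ((\<lambda>h. (sc (exp (of_real h * m)) (T h x) - x) /\<^sub>R h) \<longlongrightarrow> y) (at_right 0)}"
    proof (intro equalityI subsetI CollectI)
      fix x assume "x \<in> D"
      then show "\<exists>y. ((\<lambda>h. (sc (exp (of_real h * m)) (T h x) - x) /\<^sub>R h) \<longlongrightarrow> y) (at_right 0)"
        using lim[OF T.generator] by blast
    next
      fix x assume "x \<in> {x. \<exists>y. ((\<lambda>h. (sc (exp (of_real h * m)) (T h x) - x) /\<^sub>R h) \<longlongrightarrow> y) (at_right 0)}"
      then obtain y where "((\<lambda>h. (sc (exp (of_real h * m)) (T h x) - x) /\<^sub>R h) \<longlongrightarrow> y) (at_right 0)"
        by blast
      from lim[OF this, of "- m"] show "x \<in> D" unfolding undo by (rule T.generatorI)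
    qed
  qed
qed

lemma (in generated_semigroup) stable_scaleR:
  assumes "\<And>t x. 0 \<le> t \<Longrightarrow> norm (T t x) \<le> M * exp (\<omega> * t) * norm x" "\<omega> < l"
  shows "stable_semigroup (\<lambda>t x. exp (- l * t) *\<^sub>R T t x) D (\<lambda>x. A x - l *\<^sub>R x) M (l - \<omega>)"
proof -
  have "generated_semigroup (\<lambda>t x. exp (of_real t * (- l)) *\<^sub>R T t x) D (\<lambda>x. A x + (- l) *\<^sub>R x)"
    by (rule scaled_semigroup) (auto simp: bounded_bilinear_scaleR lin_simps generated_semigroup_axioms)
  then have "generated_semigroup (\<lambda>t x. exp (- l * t) *\<^sub>R T t x) D (\<lambda>x. A x - l *\<^sub>R x)"
    by (simp add: mult.commute)
  moreover have "norm (exp (- l * t) *\<^sub>R T t x) \<le> M * exp (- (l - \<omega>) * t) * norm x" if "0 \<le> t" for t x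
  proof -
    have "norm (exp (- l * t) *\<^sub>R T t x) \<le> exp (- l * t) * (M * exp (\<omega> * t) * norm x)"
      using assms(1)[OF that, of x] by simp
    also have "\<dots> = M * (exp (- l * t) * exp (\<omega> * t)) * norm x" by (simp add: mult_ac)
    also have "exp (- l * t) * exp (\<omega> * t) = exp (- (l - \<omega>) * t)"
      by (simp flip: exp_add add: algebra_simps)
    finally show ?thesis .
  qed
  ultimately show ?thesis
    using assms(2) by (simp add: stable_semigroup_def stable_semigroup_axioms_def)
qed

section \<open>Positivity from resolvents: Euler's exponential formula\<close>

text \<open>
Euler's formula \<open>T t x = lim (n/t R(n/t))\<^sup>n x\<close>, stated as what it gives for closed sets: a set closed
under nonnegative multiples and under the resolvents \<open>R l\<close> is invariant under the semigroup.
The two families commute, so \<open>T (n h) x - L\<^sup>n x\<close> is a sum of \<open>n\<close> terms, each of which is at most \<open>M\<close>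
times the error \<open>T h x - L x\<close> of a single step of length \<open>h = t/n\<close>. On the domain that error is
\<open>o(h)\<close>, because \<open>T h\<close> and \<open>L\<close> have the same derivative \<open>A x\<close> at \<open>h = 0\<close>.
\<close>

lemma (in generated_semigroup) euler_invariance:
  assumes bdd: "\<And>t x. 0 \<le> t \<Longrightarrow> norm (T t x) \<le> M * norm x"
    and C: "closed C" "\<And>c x. 0 \<le> c \<Longrightarrow> x \<in> C \<Longrightarrow> c *\<^sub>R x \<in> C"
    and R: "\<And>l x. l > l0 \<Longrightarrow> R l x \<in> D" "\<And>l x. l > l0 \<Longrightarrow> l *\<^sub>R R l x - A (R l x) = x"
      "\<And>l x. l > l0 \<Longrightarrow> x \<in> C \<Longrightarrow> R l x \<in> C"
    and t: "0 \<le> t" and x: "x \<in> C"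
  shows "T t x \<in> C"
proof -
  have stable: "stable_semigroup (\<lambda>t x. exp (- l * t) *\<^sub>R T t x) D (\<lambda>x. A x - l *\<^sub>R x) M l" if "l > 0" for l
    using stable_scaleR[of M 0 l] bdd that by simp
  define L where "L l x = l *\<^sub>R R l x" for l x
  define b where "b = max 0 l0"
  have LD: "L l x \<in> D" if "l > b" for l x
    using that unfolding L_def b_def by (intro generator_scaleR R) auto
  have R_orbit: "R l x = stable_semigroup.orbit_integral (\<lambda>t x. exp (- l * t) *\<^sub>R T t x) x" if "l > b" for l x
  proof -
    interpret W: stable_semigroup "\<lambda>t x. exp (- l * t) *\<^sub>R T t x" D "\<lambda>x. A x - l *\<^sub>R x" M l
      using that by (intro stable) (simp add: b_def)
    interpret J: bounded_linear W.orbit_integral by (rule W.bounded_linear_orbit_integral)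
    have "W.orbit_integral (A (R l x) - l *\<^sub>R R l x) = - R l x"
      using that by (intro W.orbit_integral_generator R) (simp add: b_def)
    moreover have "A (R l x) - l *\<^sub>R R l x = - x" using R(2)[of l x] that by (simp add: b_def algebra_simps)
    moreover have "W.orbit_integral (- x) = - W.orbit_integral x" by (rule linear_neg[OF J.linear])
    ultimately show ?thesis by simp
  qed
  have R_lin: "bounded_linear (R l)" if "l > b" for l
  proof -
    interpret W: stable_semigroup "\<lambda>t x. exp (- l * t) *\<^sub>R T t x" D "\<lambda>x. A x - l *\<^sub>R x" M l
      using that by (intro stable) (simp add: b_def)
    show ?thesis using W.bounded_linear_orbit_integral R_orbit[OF that] by (metis ext)
  qed
  have RT: "T t (R l x) = R l (T t x)" if "l > b" "0 \<le> t" for l t x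
  proof -
    interpret W: stable_semigroup "\<lambda>t x. exp (- l * t) *\<^sub>R T t x" D "\<lambda>x. A x - l *\<^sub>R x" M l
      using that by (intro stable) (simp add: b_def)
    show ?thesis
      using that W.orbit_integral_commute[of "T t" x] by (simp add: R_orbit bounded_linear lin_simps commute)
  qed
  \<comment> \<open>\<open>L l\<close> averages along orbits with total weight one, hence does not increase the bound of
     an orbit. This makes its powers bounded uniformly without renorming the space.\<close>
  have L_bound: "norm (T t (L l x)) \<le> c" if l: "l > b" and "0 \<le> t" "\<And>t. 0 \<le> t \<Longrightarrow> norm (T t x) \<le> c" for l t x c
  proof -
    interpret W: stable_semigroup "\<lambda>t x. exp (- l * t) *\<^sub>R T t x" D "\<lambda>x. A x - l *\<^sub>R x" M l
      using that by (intro stable) (simp add: b_def)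
    have "norm (R l (T t x)) \<le> c / l"
      unfolding R_orbit[OF l]
    proof (rule W.norm_orbit_integral_le)
      fix s :: real assume s: "0 \<le> s"
      have "norm (T s (T t x)) \<le> c" using that s by (simp flip: add)
      then show "norm (exp (- l * s) *\<^sub>R T s (T t x)) \<le> c * exp (- l * s)"
        by (simp add: mult.commute)
    qed
    then show ?thesis using l that(2) W.rate by (simp add: L_def RT lin_simps field_simps)
  qed
  have L_pow: "norm (T t ((L l ^^ k) x)) \<le> M * norm x" if "l > b" "0 \<le> t" for l t k x
    using that by (induction k arbitrary: t) (auto intro: L_bound bdd)
  have L_lin: "bounded_linear (L l)" if "l > b" for l
    unfolding L_def by (intro bounded_linear_compose[OF bounded_linear_scaleR_right] R_lin that)
  have L_comm: "T t (L l x) = L l (T t x)" if "l > b" "0 \<le> t" for l t x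
    using that by (simp add: L_def RT lin_simps)
  have L_diff: "L l x - x = R l (A x)" if l: "l > b" and x: "x \<in> D" for l x
  proof -
    interpret W: stable_semigroup "\<lambda>t x. exp (- l * t) *\<^sub>R T t x" D "\<lambda>x. A x - l *\<^sub>R x" M l
      using that by (intro stable) (simp add: b_def)
    interpret Rl: bounded_linear "R l" by (rule R_lin[OF l])
    have "R l (A x - l *\<^sub>R x) = - x" using W.orbit_integral_generator[OF x] R_orbit[OF l] by simp
    then show ?thesis by (simp add: Rl.diff Rl.scaleR L_def algebra_simps)
  qed
  have L_lim: "((\<lambda>l. L l x) \<longlongrightarrow> x) at_top" for x
  proof -
    have D_lim: "((\<lambda>l. L l x) \<longlongrightarrow> x) at_top" if x: "x \<in> D" for x
    proof -
      have "((\<lambda>l. L l x - x) \<longlongrightarrow> 0) at_top"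
      proof (rule Lim_null_comparison)
        show "\<forall>\<^sub>F l in at_top. norm (L l x - x) \<le> M * norm (A x) / l"
          using eventually_gt_at_top[of b]
        proof eventually_elim
          case (elim l)
          then have "l > 0" by (simp add: b_def)
          have "norm (L l (A x)) \<le> M * norm (A x)" using L_pow[OF elim order_refl, of 1 "A x"] by simp
          then have "norm (R l (A x)) \<le> M * norm (A x) / l"
            using \<open>l > 0\<close> by (simp add: L_def field_simps)
          then show ?case unfolding L_diff[OF elim x] .
        qed
      qed real_asymp
      then show ?thesis by (simp add: LIM_zero_iff)
    qed
    show ?thesis
    proof (rule tendstoI)
      fix e :: real assume e: "e > 0"
      define d where "d = e / (\<bar>M\<bar> + 2)"
      have d: "d > 0" using e by (simp add: d_def)
      obtain y where y: "y \<in> D" "dist y x < d" using domain_dense d by (metis UNIV_I closure_approachable)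
      have "d * (\<bar>M\<bar> + 2) = e" by (simp add: d_def)
      have "\<forall>\<^sub>F l in at_top. dist (L l y) y < d" using D_lim[OF y(1)] d by (rule tendstoD)
      then show "\<forall>\<^sub>F l in at_top. dist (L l x) x < e"
        using eventually_gt_at_top[of b]
      proof eventually_elim
        case (elim l)
        interpret Ll: bounded_linear "L l" by (rule L_lin[OF elim(2)])
        have "norm (L l (x - y)) \<le> M * norm (x - y)" using L_pow[OF elim(2) order_refl, of 1] by simp
        also have "\<dots> \<le> \<bar>M\<bar> * d" using y(2) by (intro mult_mono) (auto simp: dist_norm norm_minus_commute)
        finally have "norm (L l x - L l y) \<le> \<bar>M\<bar> * d" by (simp add: Ll.diff)
        moreover have "L l x - x = (L l x - L l y) + (L l y - y) + (y - x)" by simp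
        then have "norm (L l x - x) \<le> norm (L l x - L l y) + norm (L l y - y) + norm (y - x)"
          using norm_triangle_ineq[of "L l x - L l y + (L l y - y)" "y - x"]
            norm_triangle_ineq[of "L l x - L l y" "L l y - y"] by simp
        ultimately show ?case
          using elim(1) y(2) \<open>d * (\<bar>M\<bar> + 2) = e\<close> unfolding dist_norm distrib_left
          by (simp add: mult.commute)
      qed
    qed
  qed
  have L_C: "L l x \<in> C" if "l > b" "x \<in> C" for l x
    using that R(3) C(2) by (simp add: L_def b_def)
  have main: "T t x \<in> C" if x: "x \<in> C" "x \<in> D" and t: "t > 0" for x
  proof -
    have tele: "norm (T s (T (real n * h) x - (L l ^^ n) x)) \<le> real n * (M * norm (T h x - L l x))"
      if l: "l > b" and h: "h \<ge> 0" and s: "s \<ge> 0" for n h l s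
      using s
    proof (induction n arbitrary: s)
      case (Suc n)
      interpret Ll: bounded_linear "L l" by (rule L_lin[OF l])
      define z where "z = T (real n * h) x - (L l ^^ n) x"
      have "T (real (Suc n) * h) x - (L l ^^ Suc n) x = T (real n * h) (T h x - L l x) + L l z"
        using h add[of "real n * h" h x]
        by (simp add: z_def lin_simps Ll.diff distrib_right add.commute L_comm[OF l])
      then have "norm (T s (T (real (Suc n) * h) x - (L l ^^ Suc n) x)) \<le>
          norm (T s (T (real n * h) (T h x - L l x))) + norm (T s (L l z))"
        using Suc.prems by (simp add: lin_simps norm_triangle_ineq)
      also have "T s (T (real n * h) (T h x - L l x)) = T (s + real n * h) (T h x - L l x)"
        using h Suc.prems by (simp add: add)
      also have "norm \<dots> + norm (T s (L l z)) \<le> M * norm (T h x - L l x) + real n * (M * norm (T h x - L l x))"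
        using h Suc.prems Suc.IH
        by (intro add_mono bdd L_bound[OF l]) (auto simp: z_def)
      finally show ?case by (simp add: distrib_right)
    qed (simp add: lin_simps)
    have h_lim: "filterlim (\<lambda>n. t / real n) (at_right 0) sequentially"
      using t by real_asymp
    have l_lim: "filterlim (\<lambda>n. real n / t) at_top sequentially"
      using t by real_asymp
    have "(\<lambda>n. (T (t / real n) x - x) /\<^sub>R (t / real n) - L (real n / t) (A x)) \<longlonglongrightarrow> A x - A x"
      by (intro tendsto_diff filterlim_compose[OF generator[OF x(2)] h_lim] filterlim_compose[OF L_lim l_lim])
    then have "(\<lambda>n. t * M * norm ((T (t / real n) x - x) /\<^sub>R (t / real n) - L (real n / t) (A x))) \<longlonglongrightarrow> t * M * norm (A x - A x)"
      by (intro tendsto_mult_left tendsto_norm)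
    then have lim: "(\<lambda>n. t * M * norm ((T (t / real n) x - x) /\<^sub>R (t / real n) - L (real n / t) (A x))) \<longlonglongrightarrow> 0"
      by simp
    have ev: "\<forall>\<^sub>F n in sequentially. real n / t > b"
      using l_lim by (rule filterlim_at_top_dense[THEN iffD1, rule_format])
    have "(\<lambda>n. T t x - (L (real n / t) ^^ n) x) \<longlonglongrightarrow> 0"
    proof (rule Lim_null_comparison[OF _ lim])
      show "\<forall>\<^sub>F n in sequentially. norm (T t x - (L (real n / t) ^^ n) x) \<le>
          t * M * norm ((T (t / real n) x - x) /\<^sub>R (t / real n) - L (real n / t) (A x))"
        using ev eventually_gt_at_top[of 0]
      proof eventually_elim
        case (elim n)
        let ?l = "real n / t"
        have l: "?l > 0" using elim(2) t by simp
        have "norm (T t x - (L ?l ^^ n) x) \<le> real n * (M * norm (T (t / real n) x - L ?l x))"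
          using tele[OF elim(1), of "t / real n" 0 n] elim(2) t by simp
        also have "T (t / real n) x - L ?l x =
            (t / real n) *\<^sub>R ((T (t / real n) x - x) /\<^sub>R (t / real n) - L ?l (A x))"
        proof -
          have "L ?l x = x + (t / real n) *\<^sub>R L ?l (A x)"
            using L_diff[OF elim(1) x(2)] elim(2) t by (simp add: L_def[of _ "A x"] algebra_simps)
          then show ?thesis using elim(2) t by (simp add: scaleR_diff_right)
        qed
        also have "real n * (M * norm \<dots>) =
            t * M * norm ((T (t / real n) x - x) /\<^sub>R (t / real n) - L ?l (A x))"
          using elim(2) t by simp
        finally show ?case .
      qed
    qed
    then have "(\<lambda>n. T t x - (T t x - (L (real n / t) ^^ n) x)) \<longlonglongrightarrow> T t x - 0"
      by (intro tendsto_diff tendsto_const)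
    then have "(\<lambda>n. (L (real n / t) ^^ n) x) \<longlonglongrightarrow> T t x" by simp
    moreover have "\<forall>\<^sub>F n in sequentially. (L (real n / t) ^^ n) x \<in> C"
      using ev
    proof eventually_elim
      case (elim n)
      have "(L (real n / t) ^^ k) x \<in> C" for k
        by (induction k) (auto intro: L_C elim x)
      then show ?case .
    qed
    ultimately show ?thesis by (intro Lim_in_closed_set[OF C(1)]) auto
  qed
  \<comment> \<open>A general point of \<open>C\<close> is approximated by the points \<open>L l x\<close> of \<open>C\<close> in the domain.\<close>
  show ?thesis
  proof (cases "t = 0")
    case False
    show ?thesis
    proof (rule Lim_in_closed_set[OF C(1) _ trivial_limit_at_top_linorder])
      show "((\<lambda>l. T t (L l x)) \<longlongrightarrow> T t x) at_top"
        by (intro bounded_linear.tendsto[OF bounded_linear[OF t]] L_lim)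
      show "\<forall>\<^sub>F l in at_top. T t (L l x) \<in> C"
        using eventually_gt_at_top[of b]
        by eventually_elim (use False t x in \<open>auto intro!: main L_C LD\<close>)
    qed
  qed (simp add: x)
qed

section \<open>Bounded perturbations: the Dyson series\<close>

text \<open>
The perturbed orbit \<open>u\<close> solves the Volterra equation \<open>u(t) = T t x + \<integral>\<^sub>0\<^sup>t T (t - s) (B u(s)) ds\<close>. The
rate \<open>l\<close> is chosen so large that, for the norm weighted by \<open>exp (- l t)\<close>, the integral operator is a
contraction with factor \<open>1/2\<close>: the Neumann (Dyson) series converges and solutions are unique.
\<close>

locale bounded_perturbation = generated_semigroup T D A
  for T :: "real \<Rightarrow> 'b::banach \<Rightarrow> 'b" and D A +
  fixes B :: "'b \<Rightarrow> 'b" and M \<omega> b l :: real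
  assumes B: "bounded_linear B" and B_bound: "norm (B x) \<le> b * norm x" and b: "b \<ge> 0"
    and growth: "0 \<le> t \<Longrightarrow> norm (T t x) \<le> M * exp (\<omega> * t) * norm x" and M: "M \<ge> 1"
    and l: "l = \<omega> + 2 * M * b + 1"
begin

definition convolution :: "(real \<Rightarrow> 'b) \<Rightarrow> real \<Rightarrow> 'b" where
  "convolution f t = integral {0..t} (\<lambda>s. T (t - s) (B (f s)))"

text \<open>
The convolution divided by \<open>t\<close>, after the substitution \<open>s = t r\<close>. Its integration range is fixed,
so it is continuous in \<open>t\<close> up to \<open>t = 0\<close>, where it equals \<open>B (f 0)\<close>; this gives both the continuity
of convolutions and their derivative at \<open>0\<close>.
\<close>

definition convolution_mean :: "(real \<Rightarrow> 'b) \<Rightarrow> real \<Rightarrow> 'b" where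
  "convolution_mean f t = integral {0..1} (\<lambda>r. T (t * (1 - r)) (B (f (t * r))))"

lemma integrand_continuous:
  assumes "continuous_on {0..} f"
  shows "continuous_on {0..t} (\<lambda>s. T (t - s) (B (f s)))"
  by (intro continuous_on_orbit continuous_intros bounded_linear.continuous_on[OF B]
      continuous_on_subset[OF assms]) auto

lemma integrand_integrable:
  "continuous_on {0..} f \<Longrightarrow> (\<lambda>s. T (t - s) (B (f s))) integrable_on {0..t}"
  by (intro integrable_continuous_real integrand_continuous)

lemma convolution_eq_mean:
  assumes f: "continuous_on {0..} f" and t: "0 \<le> t"
  shows "convolution f t = t *\<^sub>R convolution_mean f t"
proof (cases "t = 0")
  case False
  with t have t: "t > 0" by simp
  have "((\<lambda>s. T (t - s) (B (f s))) has_integral convolution f t) (cbox 0 t)"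
    unfolding convolution_def using integrand_integrable[OF f] by (simp add: has_integral_integral)
  from has_integral_affinity'[OF this t, of 0]
  have "((\<lambda>r. T (t - t * r) (B (f (t * r)))) has_integral convolution f t /\<^sub>R t) {0..1}"
    using t by simp
  then have "convolution_mean f t = convolution f t /\<^sub>R t"
    unfolding convolution_mean_def by (simp add: has_integral_iff right_diff_distrib)
  then show ?thesis using t by simp
qed (simp add: convolution_def)

lemma convolution_mean_continuous:
  assumes f: "continuous_on {0..} f"
  shows "continuous_on {0..} (convolution_mean f)"
proof -
  have "continuous_on ({0..} \<times> cbox 0 (1::real)) (\<lambda>p. T (fst p * (1 - snd p)) (B (f (fst p * snd p))))"
    by (intro continuous_on_orbit bounded_linear.continuous_on[OF B]
        continuous_on_compose2[OF f] continuous_intros) auto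
  then have "continuous_on ({0..} \<times> cbox 0 (1::real)) (\<lambda>(t, r). T (t * (1 - r)) (B (f (t * r))))"
    by (simp add: case_prod_unfold)
  then have "continuous_on {0..} (\<lambda>t. integral (cbox 0 1) (\<lambda>r. T (t * (1 - r)) (B (f (t * r)))))"
    by (rule integral_continuous_on_param)
  then show ?thesis by (simp add: convolution_mean_def[abs_def])
qed

lemma convolution_continuous:
  assumes f: "continuous_on {0..} f"
  shows "continuous_on {0..} (convolution f)"
proof -
  have "continuous_on {0..} (\<lambda>t. t *\<^sub>R convolution_mean f t)"
    by (intro continuous_intros convolution_mean_continuous f)
  then show ?thesis
    by (rule continuous_on_eq) (simp add: convolution_eq_mean f)
qed

lemma integrand_bound:
  assumes f: "norm (f s) \<le> K * exp (l * s)" and s: "0 \<le> s" "s \<le> t"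
  shows "norm (T (t - s) (B (f s))) \<le> M * b * K * exp (\<omega> * t) * exp ((l - \<omega>) * s)"
proof -
  have "norm (T (t - s) (B (f s))) \<le> M * exp (\<omega> * (t - s)) * norm (B (f s))"
    using s by (intro growth) simp
  also have "norm (B (f s)) \<le> b * (K * exp (l * s))"
    using B_bound[of "f s"] mult_left_mono[OF f b] by linarith
  finally have "norm (T (t - s) (B (f s))) \<le> M * exp (\<omega> * (t - s)) * (b * (K * exp (l * s)))"
    using M by (simp add: mult_left_mono)
  also have "\<dots> = M * b * K * (exp (\<omega> * (t - s)) * exp (l * s))" by (simp add: mult_ac)
  also have "exp (\<omega> * (t - s)) * exp (l * s) = exp (\<omega> * t) * exp ((l - \<omega>) * s)"
    by (simp flip: exp_add add: algebra_simps)
  finally show ?thesis by (simp add: mult_ac)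
qed

lemma convolution_bound:
  assumes f: "continuous_on {0..} f" "\<And>s. 0 \<le> s \<Longrightarrow> norm (f s) \<le> K * exp (l * s)" and t: "0 \<le> t"
  shows "norm (convolution f t) \<le> (K / 2) * exp (l * t)"
proof -
  have K: "0 \<le> K" using order_trans[OF norm_ge_zero f(2)[of 0]] by simp
  have "0 \<le> M * b" using M b by simp
  then have d: "l - \<omega> > 0" "2 * (M * b) \<le> l - \<omega>" using l by linarith+
  have "norm (convolution f t) \<le> M * b * K * exp (\<omega> * t) / (l - \<omega>) * (exp ((l - \<omega>) * t) - exp ((l - \<omega>) * 0))"
    unfolding convolution_def using d t
    by (intro norm_integral_exp_bound integrand_integrable f integrand_bound) auto
  also have "\<dots> \<le> M * b * K * exp (\<omega> * t) / (l - \<omega>) * exp ((l - \<omega>) * t)"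
    using d K M b by (intro mult_left_mono) auto
  also have "\<dots> = (M * b / (l - \<omega>)) * K * (exp (\<omega> * t) * exp ((l - \<omega>) * t))" by simp
  also have "exp (\<omega> * t) * exp ((l - \<omega>) * t) = exp (l * t)"
    by (simp flip: exp_add add: algebra_simps)
  also have "(M * b / (l - \<omega>)) * K * exp (l * t) \<le> (1 / 2) * K * exp (l * t)"
    using d K by (intro mult_right_mono) (auto simp: field_simps)
  finally show ?thesis by simp
qed

lemma convolution_fixpoint_zero:
  assumes f: "continuous_on {0..} f" "\<And>s. 0 \<le> s \<Longrightarrow> norm (f s) \<le> K * exp (l * s)"
    and fp: "\<And>t. 0 \<le> t \<Longrightarrow> f t = convolution f t" and t: "0 \<le> t"
  shows "f t = 0"
proof -
  have "norm (f t) \<le> (K / 2 ^ n) * exp (l * t)" if "0 \<le> t" for n t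
    using that
  proof (induction n arbitrary: t)
    case (Suc n)
    show ?case using convolution_bound[OF f(1) Suc.IH Suc.prems] fp[OF Suc.prems] by (simp add: mult.commute)
  qed (simp add: f)
  moreover have "(\<lambda>n. (K / 2 ^ n) * exp (l * t)) \<longlonglongrightarrow> 0" by real_asymp
  ultimately have "norm (f t) \<le> 0" using t by (intro LIMSEQ_le_const) auto
  then show ?thesis by simp
qed

primrec dyson :: "nat \<Rightarrow> real \<Rightarrow> 'b \<Rightarrow> 'b" where
  "dyson 0 t x = T t x"
| "dyson (Suc n) t x = convolution (\<lambda>s. dyson n s x) t"

lemma dyson_continuous: "continuous_on {0..} (\<lambda>t. dyson n t x)"
proof (induction n)
  case 0 then show ?case by (simp add: continuous_orbit)
next
  case (Suc n) then show ?case using convolution_continuous by simp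
qed

lemma dyson_bound: "0 \<le> t \<Longrightarrow> norm (dyson n t x) \<le> (M * norm x / 2 ^ n) * exp (l * t)"
proof (induction n arbitrary: t)
  case 0
  have "norm (T t x) \<le> M * norm x * exp (\<omega> * t)" using growth[OF 0, of x] by (simp add: mult_ac)
  also have "\<dots> \<le> M * norm x * exp (l * t)"
    using M b l 0 by (intro mult_left_mono) (auto intro!: mult_right_mono)
  finally show ?case by simp
next
  case (Suc n)
  then show ?case using convolution_bound[OF dyson_continuous Suc.IH, of t] by simp
qed

lemma dyson_linear:
  assumes "0 \<le> t"
  shows "dyson n t (x + y) = dyson n t x + dyson n t y" "dyson n t (c *\<^sub>R x) = c *\<^sub>R dyson n t x"
proof -
  interpret B: bounded_linear B by (rule B)
  show "dyson n t (x + y) = dyson n t x + dyson n t y" using assms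
  proof (induction n arbitrary: t)
    case (Suc n)
    have "convolution (\<lambda>s. dyson n s (x + y)) t =
        integral {0..t} (\<lambda>s. T (t - s) (B (dyson n s x)) + T (t - s) (B (dyson n s y)))"
      unfolding convolution_def by (intro integral_cong) (simp add: Suc.IH B.add lin_simps)
    then show ?case
      by (simp add: convolution_def integral_add integrand_integrable dyson_continuous)
  qed (simp add: lin_simps)
  show "dyson n t (c *\<^sub>R x) = c *\<^sub>R dyson n t x" using assms
  proof (induction n arbitrary: t)
    case (Suc n)
    have "convolution (\<lambda>s. dyson n s (c *\<^sub>R x)) t =
        integral {0..t} (\<lambda>s. c *\<^sub>R T (t - s) (B (dyson n s x)))"
      unfolding convolution_def by (intro integral_cong) (simp add: Suc.IH B.scaleR lin_simps)
    then show ?case by (simp add: convolution_def)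
  qed (simp add: lin_simps)
qed

definition perturbed :: "real \<Rightarrow> 'b \<Rightarrow> 'b" where
  "perturbed t x = (\<Sum>n. dyson n t x)"

lemma dyson_summable: "0 \<le> t \<Longrightarrow> summable (\<lambda>n. dyson n t x)"
proof (rule summable_comparison_test')
  show "summable (\<lambda>n. (M * norm x * exp (l * t)) * (1 / 2) ^ n)"
    by (intro summable_mult summable_geometric) simp
  show "norm (dyson n t x) \<le> (M * norm x * exp (l * t)) * (1 / 2) ^ n" if "0 \<le> t" for n
    using dyson_bound[OF that, of n x] by (simp add: power_divide)
qed

lemma perturbed_bound:
  assumes "0 \<le> t" shows "norm (perturbed t x) \<le> 2 * M * norm x * exp (l * t)"
proof -
  have "(\<lambda>n. (M * norm x * exp (l * t)) * (1 / 2) ^ n) sums ((M * norm x * exp (l * t)) * (1 / (1 - 1 / 2)))"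
    by (intro sums_mult geometric_sums) simp
  then have s: "summable (\<lambda>n. (M * norm x * exp (l * t)) * (1 / 2) ^ n)"
    "(\<Sum>n. (M * norm x * exp (l * t)) * (1 / 2) ^ n) = 2 * M * norm x * exp (l * t)"
    by (simp_all add: sums_iff)
  show ?thesis unfolding perturbed_def s(2)[symmetric]
    by (rule norm_suminf_le[OF _ s(1)]) (use dyson_bound[OF assms, of _ x] in \<open>simp add: power_divide\<close>)
qed

lemma perturbed_continuous: "continuous_on {0..} (\<lambda>t. perturbed t x)"
proof -
  have "continuous_on {0..\<tau>} (\<lambda>t. perturbed t x)" for \<tau>
  proof (rule uniform_limit_theorem[OF _ _ trivial_limit_sequentially])
    show "\<forall>\<^sub>F n in sequentially. continuous_on {0..\<tau>} (\<lambda>t. \<Sum>i<n. dyson i t x)"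
      by (intro always_eventually allI continuous_intros continuous_on_subset[OF dyson_continuous]) auto
    show "uniform_limit {0..\<tau>} (\<lambda>n t. \<Sum>i<n. dyson i t x) (\<lambda>t. perturbed t x) sequentially"
      unfolding perturbed_def
    proof (rule Weierstrass_m_test)
      show "summable (\<lambda>n. (M * norm x * exp (\<bar>l\<bar> * \<tau>)) * (1 / 2) ^ n)"
        by (intro summable_mult summable_geometric) simp
      fix n t assume t: "t \<in> {0..\<tau>}"
      have "norm (dyson n t x) \<le> M * norm x * exp (l * t) * (1 / 2) ^ n"
        using dyson_bound[of t n x] t by (simp add: power_divide)
      also have "l * t \<le> \<bar>l\<bar> * \<tau>" using t by (intro mult_mono) auto
      finally show "norm (dyson n t x) \<le> (M * norm x * exp (\<bar>l\<bar> * \<tau>)) * (1 / 2) ^ n"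
        using M by (simp add: mult_left_mono mult_right_mono)
    qed
  qed
  note cont = this
  show ?thesis
    unfolding continuous_on_eq_continuous_within
  proof
    fix t :: real assume t: "t \<in> {0..}"
    have "continuous (at t within {0..t + 1}) (\<lambda>t. perturbed t x)"
      using cont[of "t + 1"] t by (simp add: continuous_on_eq_continuous_within)
    moreover have "at t within {0..t + 1} = at t within {0..}"
      using t by (intro at_within_nhd[of t "{..<t + 1}"]) auto
    ultimately show "continuous (at t within {0..}) (\<lambda>t. perturbed t x)" by simp
  qed
qed

lemma variation_of_constants:
  assumes t: "0 \<le> t"
  shows "perturbed t x = T t x + convolution (\<lambda>s. perturbed s x) t"
proof -
  let ?g = "\<lambda>n s. T (t - s) (B (dyson n s x))"
  let ?K = "M * b * (M * norm x) * exp (\<omega> * t) * exp ((l - \<omega>) * t)"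
  have "uniform_limit {0..t} (\<lambda>n s. \<Sum>i<n. ?g i s) (\<lambda>s. \<Sum>i. ?g i s) sequentially"
  proof (rule Weierstrass_m_test)
    show "summable (\<lambda>n. ?K * (1 / 2) ^ n)"
      by (intro summable_mult summable_geometric) simp
    fix n s assume s: "s \<in> {0..t}"
    have "norm (?g n s) \<le> M * b * (M * norm x / 2 ^ n) * exp (\<omega> * t) * exp ((l - \<omega>) * s)"
      using s by (intro integrand_bound dyson_bound) auto
    also have "\<dots> = (M * b * (M * norm x) * exp (\<omega> * t)) * (1 / 2) ^ n * exp ((l - \<omega>) * s)"
      by (simp add: power_divide)
    also have "\<dots> \<le> (M * b * (M * norm x) * exp (\<omega> * t)) * (1 / 2) ^ n * exp ((l - \<omega>) * t)"
      using s M b l by (intro mult_left_mono) (auto intro!: mult_left_mono)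
    finally show "norm (?g n s) \<le> ?K * (1 / 2) ^ n" by (simp add: mult_ac)
  qed
  then have "(\<lambda>n. integral {0..t} (\<lambda>s. \<Sum>i<n. ?g i s)) \<longlonglongrightarrow> integral {0..t} (\<lambda>s. \<Sum>i. ?g i s)"
    by (rule uniform_limit_integral_tendsto)
      (auto intro!: continuous_on_sum integrand_continuous dyson_continuous)
  moreover have "integral {0..t} (\<lambda>s. \<Sum>i<n. ?g i s) = (\<Sum>i<n. dyson (Suc i) t x)" for n
    by (subst integral_sum) (auto simp: convolution_def intro!: integrand_integrable dyson_continuous)
  moreover have "integral {0..t} (\<lambda>s. \<Sum>i. ?g i s) = convolution (\<lambda>s. perturbed s x) t"
    unfolding convolution_def
  proof (rule integral_cong)
    fix s assume s: "s \<in> {0..t}"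
    have "bounded_linear (\<lambda>y. T (t - s) (B y))"
      using s by (intro bounded_linear_compose[OF bounded_linear B]) auto
    from bounded_linear.suminf[OF this dyson_summable, of s x]
    show "(\<Sum>i. ?g i s) = T (t - s) (B (perturbed s x))"
      using s by (simp add: perturbed_def)
  qed
  ultimately have "(\<lambda>i. dyson (Suc i) t x) sums convolution (\<lambda>s. perturbed s x) t"
    by (simp add: sums_def)
  then have "(\<lambda>i. dyson i t x) sums (convolution (\<lambda>s. perturbed s x) t + dyson 0 t x)"
    by (subst (asm) sums_Suc_iff) simp
  then show ?thesis by (simp add: perturbed_def sums_iff)
qed

lemma perturbed_linear:
  assumes t: "0 \<le> t" shows "bounded_linear (perturbed t)"
proof (rule bounded_linear_intro)
  fix x y and c :: real
  show "perturbed t (x + y) = perturbed t x + perturbed t y"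
    unfolding perturbed_def using t
    by (simp add: dyson_linear suminf_add[symmetric] dyson_summable)
  show "perturbed t (c *\<^sub>R x) = c *\<^sub>R perturbed t x"
    unfolding perturbed_def using t
    by (simp add: dyson_linear suminf_scaleR_right[symmetric] dyson_summable)
  show "norm (perturbed t x) \<le> norm x * (2 * M * exp (l * t))"
    using perturbed_bound[OF t, of x] by (simp add: mult_ac)
qed

lemma perturbed_zero: "perturbed 0 x = x"
  using variation_of_constants[of 0 x] by (simp add: convolution_def)

text \<open>
For fixed \<open>s\<close> and \<open>x\<close>, both sides solve the Volterra equation with initial value
\<open>perturbed s x\<close>, so their difference is a fixed point of the convolution.
\<close>

lemma perturbed_add:
  assumes s: "0 \<le> s" and t: "0 \<le> t"
  shows "perturbed (t + s) x = perturbed t (perturbed s x)"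
proof -
  interpret B: bounded_linear B by (rule B)
  let ?y = "perturbed s x"
  have cont: "continuous_on {0..} (\<lambda>t. perturbed (t + s) x)"
    using s by (intro continuous_on_compose2[OF perturbed_continuous] continuous_intros) auto
  have shifted: "convolution (\<lambda>r. perturbed (r + s) x) t = perturbed (t + s) x - T t ?y" if t: "0 \<le> t" for t
  proof -
    let ?f = "\<lambda>r. T (t + s - r) (B (perturbed r x))"
    have int: "?f integrable_on {0..t + s}" by (intro integrand_integrable perturbed_continuous)
    have "convolution (\<lambda>r. perturbed (r + s) x) t = integral {s - s..t + s - s} (\<lambda>r. ?f (r + s))"
      by (simp add: convolution_def)
    also have "\<dots> = integral {s..t + s} ?f" by (rule integral_shift_real_ivl)
    also have "\<dots> = integral {0..t + s} ?f - integral {0..s} ?f"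
      using Henstock_Kurzweil_Integration.integral_combine[OF s _ int] t by (simp add: algebra_simps)
    also have "integral {0..s} ?f = integral {0..s} (T t \<circ> (\<lambda>r. T (s - r) (B (perturbed r x))))"
    proof (rule integral_cong)
      fix r assume "r \<in> {0..s}"
      then show "?f r = (T t \<circ> (\<lambda>r. T (s - r) (B (perturbed r x)))) r"
        using add[of t "s - r"] t by (simp add: algebra_simps)
    qed
    also have "\<dots> = T t (convolution (\<lambda>r. perturbed r x) s)"
      unfolding convolution_def
      by (intro integral_linear integrand_integrable perturbed_continuous bounded_linear t)
    also have "convolution (\<lambda>r. perturbed r x) s = ?y - T s x"
      using variation_of_constants[OF s, of x] by simp
    also have "integral {0..t + s} ?f = perturbed (t + s) x - T (t + s) x"
      using variation_of_constants[of "t + s" x] s t by (simp add: convolution_def)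
    finally show ?thesis using s t by (simp add: lin_simps add)
  qed
  define f where "f t = perturbed (t + s) x - perturbed t ?y" for t
  have f_cont: "continuous_on {0..} f"
    unfolding f_def by (intro continuous_intros cont perturbed_continuous)
  have "f t = 0"
  proof (rule convolution_fixpoint_zero[OF f_cont _ _ t])
    fix t :: real assume t: "0 \<le> t"
    have "norm (f t) \<le> 2 * M * norm x * exp (l * (t + s)) + 2 * M * norm ?y * exp (l * t)"
      unfolding f_def using perturbed_bound[of "t + s" x] perturbed_bound[OF t, of ?y] s t
      by (intro order_trans[OF norm_triangle_ineq4] add_mono) auto
    also have "\<dots> = (2 * M * norm x * exp (l * s) + 2 * M * norm ?y) * exp (l * t)"
      by (simp add: algebra_simps exp_add)
    finally show "norm (f t) \<le> (2 * M * norm x * exp (l * s) + 2 * M * norm ?y) * exp (l * t)" .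
    have "convolution f t = convolution (\<lambda>r. perturbed (r + s) x) t - convolution (\<lambda>r. perturbed r ?y) t"
    proof -
      have "convolution f t = integral {0..t} (\<lambda>r. T (t - r) (B (perturbed (r + s) x)) - T (t - r) (B (perturbed r ?y)))"
        unfolding convolution_def f_def by (intro integral_cong) (simp add: B.diff lin_simps)
      then show ?thesis
        by (simp add: convolution_def integral_diff integrand_integrable cont perturbed_continuous)
    qed
    also have "\<dots> = f t"
      using shifted[OF t] variation_of_constants[OF t, of ?y] by (simp add: f_def)
    finally show "f t = convolution f t" by simp
  qed
  then show ?thesis by (simp add: f_def)
qed

text \<open>
The difference quotients at \<open>0\<close> of the perturbed and of the original semigroup differ by
\<open>convolution_mean\<close>, which tends to \<open>B x\<close>. Hence the domains coincide.
\<close>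

lemma perturbed_generated: "generated_semigroup perturbed D (\<lambda>x. A x + B x)"
proof (intro generated_semigroup.intro c0_semigroup.intro generated_semigroup_axioms.intro)
  have mean: "((\<lambda>h. convolution_mean (\<lambda>s. perturbed s x) h) \<longlongrightarrow> B x) (at_right 0)" for x
  proof -
    have "continuous_on {0..} (convolution_mean (\<lambda>s. perturbed s x))"
      by (intro convolution_mean_continuous perturbed_continuous)
    then have "((\<lambda>h. convolution_mean (\<lambda>s. perturbed s x) h) \<longlongrightarrow> convolution_mean (\<lambda>s. perturbed s x) 0) (at 0 within {0..})"
      by (simp add: continuous_on_def)
    then have "((\<lambda>h. convolution_mean (\<lambda>s. perturbed s x) h) \<longlongrightarrow> convolution_mean (\<lambda>s. perturbed s x) 0) (at_right 0)"
      by (rule tendsto_within_subset) auto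
    then show ?thesis by (simp add: convolution_mean_def perturbed_zero)
  qed
  have quotient: "(perturbed h x - x) /\<^sub>R h = (T h x - x) /\<^sub>R h + convolution_mean (\<lambda>s. perturbed s x) h"
    if "h > 0" for h x
    using that variation_of_constants[of h x] convolution_eq_mean[OF perturbed_continuous, of h x]
    by (simp add: scaleR_diff_right scaleR_add_right)
  have pos: "\<forall>\<^sub>F h in at_right (0::real). h > 0" by (simp add: eventually_at_filter)
  have fwd: "((\<lambda>h. (perturbed h x - x) /\<^sub>R h) \<longlongrightarrow> y + B x) (at_right 0)"
    if "((\<lambda>h. (T h x - x) /\<^sub>R h) \<longlongrightarrow> y) (at_right 0)" for x y
    by (rule Lim_transform_eventually[OF tendsto_add[OF that mean]])
      (use pos in eventually_elim, simp add: quotient)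
  have bwd: "((\<lambda>h. (T h x - x) /\<^sub>R h) \<longlongrightarrow> y - B x) (at_right 0)"
    if "((\<lambda>h. (perturbed h x - x) /\<^sub>R h) \<longlongrightarrow> y) (at_right 0)" for x y
    by (rule Lim_transform_eventually[OF tendsto_diff[OF that mean]])
      (use pos in eventually_elim, simp add: quotient)
  fix s t :: real and x
  show "0 \<le> t \<Longrightarrow> bounded_linear (perturbed t)" by (rule perturbed_linear)
  show "perturbed 0 x = x" by (rule perturbed_zero)
  show "0 \<le> s \<Longrightarrow> 0 \<le> t \<Longrightarrow> perturbed (s + t) x = perturbed s (perturbed t x)"
    by (rule perturbed_add)
  have "((\<lambda>t. perturbed t x) \<longlongrightarrow> perturbed 0 x) (at 0 within {0..})"
    using perturbed_continuous[of x] by (simp add: continuous_on_def)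
  then have "((\<lambda>t. perturbed t x) \<longlongrightarrow> perturbed 0 x) (at_right 0)"
    by (rule tendsto_within_subset) auto
  then show "((\<lambda>t. perturbed t x) \<longlongrightarrow> x) (at_right 0)" by (simp add: perturbed_zero)
  show "x \<in> D \<Longrightarrow> ((\<lambda>h. (perturbed h x - x) /\<^sub>R h) \<longlongrightarrow> A x + B x) (at_right 0)"
    by (intro fwd generator)
  show "D = {x. \<exists>y. ((\<lambda>h. (perturbed h x - x) /\<^sub>R h) \<longlongrightarrow> y) (at_right 0)}"
    using fwd bwd domain by blast
qed

lemma perturbed_cone:
  assumes C: "closed C" "convex_cone C" "\<And>t x. 0 \<le> t \<Longrightarrow> x \<in> C \<Longrightarrow> T t x \<in> C" "\<And>x. x \<in> C \<Longrightarrow> B x \<in> C"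
    and "0 \<le> t" "x \<in> C"
  shows "perturbed t x \<in> C"
proof -
  have dyson: "dyson n t x \<in> C" if "0 \<le> t" for n t
    using that
  proof (induction n arbitrary: t)
    case (Suc n)
    then show ?case
      by (auto simp: convolution_def intro!: integral_mem_closed_convex_cone integrand_integrable dyson_continuous C)
  qed (simp add: assms)
  have "(\<lambda>n. \<Sum>i<n. dyson i t x) \<longlonglongrightarrow> perturbed t x"
    unfolding perturbed_def using dyson_summable[OF \<open>0 \<le> t\<close>] by (rule summable_LIMSEQ)
  moreover have "(\<Sum>i<n. dyson i t x) \<in> C" for n
    by (induction n) (auto intro: convex_cone_add convex_cone_contains_0 C dyson \<open>0 \<le> t\<close>)
  ultimately show ?thesis using C(1) by (meson closed_sequentially)
qed

end

text \<open>
Invariant cones are part of the statement because they are visible only from the construction: every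
term of the Dyson series is built from \<open>T\<close> and \<open>B\<close> by composition and integration.
\<close>

theorem (in generated_semigroup) bounded_perturbation_exists:
  assumes B: "bounded_linear B"
  shows "\<exists>S. generated_semigroup S D (\<lambda>x. A x + B x) \<and>
    (\<forall>C. closed C \<longrightarrow> convex_cone C \<longrightarrow> (\<forall>t\<ge>0. T t ` C \<subseteq> C) \<longrightarrow> B ` C \<subseteq> C \<longrightarrow> (\<forall>t\<ge>0. S t ` C \<subseteq> C))"
proof -
  obtain M \<omega> where M: "M \<ge> 1" "\<And>t x. 0 \<le> t \<Longrightarrow> norm (T t x) \<le> M * exp (\<omega> * t) * norm x"
    by (rule growth_bound) blast
  interpret P: bounded_perturbation T D A B M \<omega> "onorm B" "\<omega> + 2 * M * onorm B + 1"
    by (intro bounded_perturbation.intro bounded_perturbation_axioms.intro generated_semigroup_axioms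
        B onorm onorm_pos_le M refl)
  show ?thesis
    by (intro exI[of _ P.perturbed] conjI allI impI P.perturbed_generated)
      (auto intro!: P.perturbed_cone)
qed

section \<open>Positive functionals\<close>

text \<open>
An inequality for positive multiples suffices: applied to the inverse factor it becomes an equality.
\<close>

definition sublinear :: "('b::real_vector \<Rightarrow> real) \<Rightarrow> bool" where
  "sublinear q \<longleftrightarrow> (\<forall>x y. q (x + y) \<le> q x + q y) \<and> (\<forall>c>0. \<forall>x. q (c *\<^sub>R x) \<le> c * q x)"

lemma sublinearD:
  assumes "sublinear q"
  shows "q (x + y) \<le> q x + q y" "c > 0 \<Longrightarrow> q (c *\<^sub>R x) = c * q x" "q 0 = 0" "- q (- x) \<le> q x"
proof -
  have le: "q (c *\<^sub>R x) \<le> c * q x" if "c > 0" for c x using assms that by (simp add: sublinear_def)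
  have eq: "q (c *\<^sub>R x) = c * q x" if c: "c > 0" for c x
  proof -
    have "q x \<le> inverse c * q (c *\<^sub>R x)"
      using le[of "inverse c" "c *\<^sub>R x"] c by simp
    then have "c * q x \<le> q (c *\<^sub>R x)" using c by (simp add: field_simps)
    then show ?thesis using le[OF c, of x] by simp
  qed
  show add: "q (x + y) \<le> q x + q y" for x y using assms by (simp add: sublinear_def)
  show "c > 0 \<Longrightarrow> q (c *\<^sub>R x) = c * q x" by (rule eq)
  show q0: "q 0 = 0" using eq[of 2 0] by simp
  show "- q (- x) \<le> q x" using add[of x "- x"] q0 by simp
qed

text \<open>
The infimum of \<open>q (x + t a) - t q(a)\<close> over \<open>t > 0\<close> lowers \<open>q\<close> so as to be additive on the line
through \<open>a\<close>. It is used twice: to prescribe the value of the functional at \<open>a\<close>, and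
to see that a minimal sublinear functional is odd, hence linear.
\<close>

lemma sublinear_lower:
  assumes q: "sublinear q"
  obtains r where "sublinear r" "\<And>x. r x \<le> q x" "r (- a) \<le> - q a"
proof -
  define r where "r x = (INF t\<in>{0<..}. q (x + t *\<^sub>R a) - t * q a)" for x
  have bdd: "bdd_below ((\<lambda>t. q (x + t *\<^sub>R a) - t * q a) ` {0<..})" for x
  proof (rule bdd_belowI2)
    fix t :: real assume "t \<in> {0<..}"
    then show "- q (- x) \<le> q (x + t *\<^sub>R a) - t * q a"
      using sublinearD(1)[OF q, of "x + t *\<^sub>R a" "- x"] sublinearD(2)[OF q, of t a] by simp
  qed
  have le: "r x \<le> q (x + t *\<^sub>R a) - t * q a" if "t > 0" for x t
    unfolding r_def using that by (intro cINF_lower bdd) auto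
  have ge: "c \<le> r x" if "\<And>t. t > 0 \<Longrightarrow> c \<le> q (x + t *\<^sub>R a) - t * q a" for c x
    unfolding r_def using that by (intro cINF_greatest) auto
  have "sublinear r"
    unfolding sublinear_def
  proof (intro conjI allI impI)
    fix x y
    have "r (x + y) - (q (y + s *\<^sub>R a) - s * q a) \<le> r x" if s: "s > 0" for s
    proof (rule ge)
      fix t :: real assume t: "t > 0"
      have "r (x + y) \<le> q ((x + t *\<^sub>R a) + (y + s *\<^sub>R a)) - (t + s) * q a"
        using le[of "t + s" "x + y"] s t by (simp add: algebra_simps)
      then show "r (x + y) - (q (y + s *\<^sub>R a) - s * q a) \<le> q (x + t *\<^sub>R a) - t * q a"
        using sublinearD(1)[OF q, of "x + t *\<^sub>R a" "y + s *\<^sub>R a"] by (simp add: algebra_simps)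
    qed
    then have "r (x + y) - r x \<le> r y" by (intro ge) (simp add: algebra_simps)
    then show "r (x + y) \<le> r x + r y" by simp
  next
    fix c :: real and x assume c: "c > 0"
    have "r (c *\<^sub>R x) / c \<le> r x"
    proof (rule ge)
      fix t :: real assume t: "t > 0"
      have "r (c *\<^sub>R x) \<le> q (c *\<^sub>R (x + t *\<^sub>R a)) - c * t * q a"
        using le[of "c * t" "c *\<^sub>R x"] c t by (simp add: scaleR_add_right)
      also have "\<dots> = c * (q (x + t *\<^sub>R a) - t * q a)"
        by (simp only: sublinearD(2)[OF q c]) (simp add: algebra_simps)
      finally show "r (c *\<^sub>R x) / c \<le> q (x + t *\<^sub>R a) - t * q a"
        using c by (simp add: field_simps)
    qed
    then show "r (c *\<^sub>R x) \<le> c * r x" using c by (simp add: field_simps)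
  qed
  moreover have "r x \<le> q x" for x
  proof (rule field_le_epsilon)
    fix e :: real assume "e > 0"
    show "r x \<le> q x + e"
      using le[of 1 x] sublinearD(1)[OF q, of x a] \<open>e > 0\<close> by simp
  qed
  moreover have "r (- a) \<le> - q a" using le[of 1 "- a"] sublinearD(3)[OF q] by simp
  ultimately show ?thesis using that by blast
qed

lemma minimal_sublinear:
  assumes p: "sublinear p"
  obtains q where "sublinear q" "\<And>x. q x \<le> p x"
    "\<And>r. sublinear r \<Longrightarrow> (\<And>x. r x \<le> q x) \<Longrightarrow> r = q"
proof -
  define S where "S = {q. sublinear q \<and> (\<forall>x. q x \<le> p x)}"
  have "\<exists>m\<in>S. \<forall>r\<in>S. r \<le> m \<longrightarrow> r = m"
  proof (rule predicate_Zorn[where P = "\<lambda>a b. b \<le> a" and A = S])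
    show "partial_order_on S (relation_of (\<lambda>a b. b \<le> a) S)"
      by (rule partial_order_on_relation_ofI) auto
    fix C assume chain: "C \<in> Chains (relation_of (\<lambda>a b. b \<le> a) S)"
    then have CS: "C \<subseteq> S" and lin: "\<And>q r. q \<in> C \<Longrightarrow> r \<in> C \<Longrightarrow> q \<le> r \<or> r \<le> q"
      unfolding Chains_def relation_of_def by blast+
    show "\<exists>u\<in>S. \<forall>q\<in>C. u \<le> q"
    proof (cases "C = {}")
      case True
      then show ?thesis using p by (auto simp: S_def)
    next
      case False
      define u where "u x = (INF q\<in>C. q x)" for x
      have bdd: "bdd_below ((\<lambda>q. q x) ` C)" for x
      proof (rule bdd_belowI2)
        fix q assume "q \<in> C"
        then have "sublinear q" "q (- x) \<le> p (- x)" using CS by (auto simp: S_def)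
        then show "- p (- x) \<le> q x" using sublinearD(4)[of q x] by linarith
      qed
      have le: "u x \<le> q x" if "q \<in> C" for q x
        unfolding u_def using that by (intro cINF_lower bdd)
      have ge: "c \<le> u x" if "\<And>q. q \<in> C \<Longrightarrow> c \<le> q x" for c x
        unfolding u_def using that False by (intro cINF_greatest)
      have "sublinear u"
        unfolding sublinear_def
      proof (intro conjI allI impI)
        fix x y
        have "u (x + y) - r y \<le> u x" if r: "r \<in> C" for r
        proof (rule ge)
          fix q assume q: "q \<in> C"
          then obtain m where m: "m \<in> C" "m \<le> q" "m \<le> r" using lin[OF q r] r by blast
          have "u (x + y) \<le> m x + m y"
            using le[OF m(1), of "x + y"] sublinearD(1)[of m x y] m(1) CS by (auto simp: S_def)
          moreover have "m x \<le> q x" "m y \<le> r y" using m(2,3) by (auto simp: le_fun_def)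
          ultimately show "u (x + y) - r y \<le> q x" by linarith
        qed
        then have "u (x + y) - u x \<le> u y" by (intro ge) (simp add: algebra_simps)
        then show "u (x + y) \<le> u x + u y" by simp
      next
        fix c :: real and x assume c: "c > 0"
        have "u (c *\<^sub>R x) / c \<le> u x"
        proof (rule ge)
          fix q assume q: "q \<in> C"
          then have "q (c *\<^sub>R x) = c * q x" using CS sublinearD(2)[OF _ c] by (auto simp: S_def)
          then show "u (c *\<^sub>R x) / c \<le> q x" using le[OF q, of "c *\<^sub>R x"] c by (simp add: field_simps)
        qed
        then show "u (c *\<^sub>R x) \<le> c * u x" using c by (simp add: field_simps)
      qed
      moreover have "u x \<le> p x" for x
      proof -
        obtain q where "q \<in> C" using False by blast
        moreover from this have "q x \<le> p x" using CS by (auto simp: S_def)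
        ultimately show ?thesis using le[of q x] by linarith
      qed
      ultimately show ?thesis using le by (intro bexI[of _ u]) (auto simp: S_def le_fun_def)
    qed
  qed
  then obtain m where m: "m \<in> S" "\<And>r. r \<in> S \<Longrightarrow> r \<le> m \<Longrightarrow> r = m" by blast
  show ?thesis
  proof (rule that[of m])
    fix r assume r: "sublinear r" "\<And>x. r x \<le> m x"
    have "m x \<le> p x" for x using m(1) by (simp add: S_def)
    then have "r x \<le> p x" for x using r(2) by (rule order_trans[rotated])
    then show "r = m" using r by (intro m(2)) (simp_all add: S_def le_fun_def)
  qed (use m(1) in \<open>auto simp: S_def\<close>)
qed

text \<open>
Linear functionals are the minimal sublinear ones, and minimal ones exist by Zorn's lemma.
\<close>

theorem hahn_banach_sublinear:
  assumes p: "sublinear p"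
  obtains f where "linear f" "\<And>x. f x \<le> p x" "f a = p a"
proof -
  obtain p' where p': "sublinear p'" "\<And>x. p' x \<le> p x" "p' (- a) \<le> - p a"
    by (rule sublinear_lower[OF p]) blast
  obtain q where q: "sublinear q" "\<And>x. q x \<le> p' x"
    and min: "\<And>r. sublinear r \<Longrightarrow> (\<And>x. r x \<le> q x) \<Longrightarrow> r = q"
    by (rule minimal_sublinear[OF p'(1)]) blast
  have neg: "q (- x) = - q x" for x
  proof -
    obtain r where r: "sublinear r" "\<And>y. r y \<le> q y" "r (- x) \<le> - q x"
      by (rule sublinear_lower[OF q(1)]) blast
    have "r = q" by (rule min[OF r(1,2)])
    then have "q (- x) \<le> - q x" using r(3) by simp
    then show ?thesis using sublinearD(4)[OF q(1), of x] by linarith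
  qed
  have "linear q"
  proof (rule linearI)
    fix x y and c :: real
    show "q (x + y) = q x + q y"
      using sublinearD(1)[OF q(1), of x y] sublinearD(1)[OF q(1), of "x + y" "- y"] neg[of y] by simp
    show "q (c *\<^sub>R x) = c *\<^sub>R q x"
    proof (cases c "0::real" rule: linorder_cases)
      case less
      then show ?thesis using sublinearD(2)[OF q(1), of "- c" x] neg[of "c *\<^sub>R x"] by simp
    qed (simp_all add: sublinearD[OF q(1)])
  qed
  moreover have "q x \<le> p x" for x using q(2) p'(2) by (rule order_trans)
  moreover have "p a \<le> q a" using q(2)[of "- a"] p'(3) neg[of a] by linarith
  ultimately show ?thesis using that[of q] by (simp add: order.antisym)
qed

text \<open>
Functionals dominated by \<open>x \<mapsto> \<parallel>x\<^sup>+\<parallel>\<close> are automatically positive and bounded, since this sublinear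
functional vanishes on negative vectors and is at most the norm. It does not vanish at
\<open>-v\<close>.
\<close>

theorem positive_functional_separates:
  fixes v :: "'a::banach_lattice"
  assumes "\<not> 0 \<le> v"
  shows "\<exists>\<phi> :: 'a \<Rightarrow> real. bounded_linear \<phi> \<and> (\<forall>x\<ge>0. 0 \<le> \<phi> x) \<and> \<phi> v < 0"
proof -
  define p where "p x = norm (pprt x)" for x :: 'a
  have "sublinear p"
    unfolding sublinear_def
  proof (intro conjI allI impI)
    fix x y :: 'a and c :: real
    have "pprt (x + y) \<le> pprt x + pprt y"
      by (auto simp: pprt_def intro!: sup_least add_mono add_nonneg_nonneg)
    then have "norm (pprt (x + y)) \<le> norm (pprt x + pprt y)" by (intro norm_mono_nonneg) auto
    then show "p (x + y) \<le> p x + p y" unfolding p_def using norm_triangle_ineq order_trans by blast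
    assume c: "c > 0"
    have "pprt (c *\<^sub>R x) \<le> c *\<^sub>R pprt x"
      unfolding pprt_def using c by (intro sup_least scaleR_left_mono scaleR_nonneg_nonneg) auto
    then have "norm (pprt (c *\<^sub>R x)) \<le> norm (c *\<^sub>R pprt x)" by (intro norm_mono_nonneg) auto
    then show "p (c *\<^sub>R x) \<le> c * p x" using c by (simp add: p_def)
  qed
  then obtain \<phi> where \<phi>: "linear \<phi>" "\<And>x. \<phi> x \<le> p x" "\<phi> (- v) = p (- v)"
    using hahn_banach_sublinear by metis
  interpret \<phi>: linear \<phi> by fact
  have p_le: "p x \<le> norm x" for x
  proof -
    have "pprt x \<le> \<bar>x\<bar>" by (auto simp: pprt_def abs_ge_self)
    then show ?thesis unfolding p_def by (metis norm_abs_eq norm_mono_nonneg zero_le_pprt)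
  qed
  have "bounded_linear \<phi>"
  proof (rule bounded_linear_intro)
    fix x
    show "norm (\<phi> x) \<le> norm x * 1"
      using \<phi>(2)[of x] \<phi>(2)[of "- x"] p_le[of x] p_le[of "- x"] \<phi>.neg[of x] by simp
  qed (simp_all add: \<phi>.add \<phi>.scale)
  moreover have "0 \<le> \<phi> x" if "0 \<le> x" for x
  proof -
    have "pprt (- x) = 0" using that by (simp flip: le_zero_iff_zero_pprt)
    then show ?thesis using \<phi>(2)[of "- x"] \<phi>.neg[of x] by (simp add: p_def)
  qed
  moreover have "\<phi> v < 0"
  proof -
    have "pprt (- v) \<noteq> 0" using assms le_zero_iff_zero_pprt[of "- v"] by auto
    then have "p (- v) > 0" by (simp add: p_def)
    then show ?thesis using \<phi>(3) \<phi>.neg[of v] by simp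
  qed
  ultimately show ?thesis by blast
qed

section \<open>Semigroups on a complex Banach lattice\<close>

lemma bounded_bilinear_scaleC:
  "bounded_bilinear (scaleC :: complex \<Rightarrow> 'a::banach_lattice complexification \<Rightarrow> _)"
proof
  show "\<exists>K. \<forall>a (b :: 'a complexification). norm (a *\<^sub>C b) \<le> norm a * norm b * K"
    by (intro exI[of _ 1]) (simp add: norm_scaleC)
qed (simp_all add: complexification_eq_iff algebra_simps)

lemma bounded_linear_re_part: "bounded_linear (re_part :: 'a::banach_lattice complexification \<Rightarrow> 'a)"
  by (rule bounded_linear_intro[where K = 1]) (simp_all add: norm_re_le)

lemma bounded_linear_im_part: "bounded_linear (im_part :: 'a::banach_lattice complexification \<Rightarrow> 'a)"
  by (rule bounded_linear_intro[where K = 1]) (simp_all add: norm_im_le)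

lemma complexification_nonneg_iff:
  "0 \<le> z \<longleftrightarrow> 0 \<le> re_part z \<and> im_part z = 0" for z :: "'a::banach_lattice complexification"
  by (auto simp: less_eq_complexification_def)

definition positive_cone :: "'a::banach_lattice complexification set" where
  "positive_cone = {z. 0 \<le> z}"

lemma convex_coneI:
  assumes "0 \<in> C" "\<And>x y. x \<in> C \<Longrightarrow> y \<in> C \<Longrightarrow> x + y \<in> C" "\<And>c x. 0 \<le> c \<Longrightarrow> x \<in> C \<Longrightarrow> c *\<^sub>R x \<in> C"
  shows "convex_cone C"
  using assms by (auto simp: convex_cone_iff)

lemma closed_positive_cone: "closed (positive_cone :: 'a::banach_lattice complexification set)"
proof -
  have "x \<in> positive_cone" if "\<And>n. X n \<in> positive_cone" "X \<longlonglongrightarrow> x"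
    for X :: "nat \<Rightarrow> 'a complexification" and x
  proof -
    have "(\<lambda>n. re_part (X n)) \<longlonglongrightarrow> re_part x" "(\<lambda>n. im_part (X n)) \<longlonglongrightarrow> im_part x"
      using bounded_linear.tendsto[OF bounded_linear_re_part that(2)]
        bounded_linear.tendsto[OF bounded_linear_im_part that(2)] by auto
    moreover have "0 \<le> re_part (X n)" "im_part (X n) = 0" for n
      using that(1)[of n] by (auto simp: positive_cone_def complexification_nonneg_iff)
    ultimately show ?thesis
      by (auto simp: positive_cone_def complexification_nonneg_iff LIMSEQ_const_iff intro: nonneg_closed)
  qed
  then show ?thesis unfolding closed_sequential_limits by blast
qed

lemma convex_cone_positive_cone: "convex_cone (positive_cone :: 'a::banach_lattice complexification set)"
  by (rule convex_coneI) (auto simp: positive_cone_def complexification_nonneg_iff scaleR_nonneg_nonneg)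

lemma closed_real_elements: "closed (real_elements :: 'a::banach_lattice complexification set)"
  unfolding real_elements_def
  by (intro closed_Collect_eq linear_continuous_on bounded_linear_im_part continuous_on_const)

lemma convex_cone_real_elements: "convex_cone (real_elements :: 'a::banach_lattice complexification set)"
  by (rule convex_coneI) (auto simp: real_elements_def)

lemma bounded_clinear_iff:
  "bounded_clinear f \<longleftrightarrow> bounded_linear f \<and> (\<forall>c x. f (c *\<^sub>C x) = c *\<^sub>C f x)"
proof
  assume "bounded_clinear f"
  then show "bounded_linear f \<and> (\<forall>c x. f (c *\<^sub>C x) = c *\<^sub>C f x)"
    by (simp add: bounded_clinear_def Vector_Spaces.linear_iff)
next
  assume f: "bounded_linear f \<and> (\<forall>c x. f (c *\<^sub>C x) = c *\<^sub>C f x)"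
  then interpret bounded_linear f by simp
  show "bounded_clinear f"
    using f by (simp add: bounded_clinear_def Vector_Spaces.linear_iff add complexification.vector_space_axioms)
qed

locale complex_semigroup =
  fixes T :: "real \<Rightarrow> 'a::banach_lattice complexification \<Rightarrow> 'a complexification" and D A
  assumes semigroup: "C0_semigroup T" and has_gen: "has_generator T D A"
begin

lemma scaleC: "0 \<le> t \<Longrightarrow> T t (c *\<^sub>C x) = c *\<^sub>C T t x"
  using semigroup by (simp add: C0_semigroup_def bounded_clinear_iff)

sublocale generated_semigroup T D A
proof (intro generated_semigroup.intro c0_semigroup.intro generated_semigroup_axioms.intro)
  fix s t :: real and x
  show "0 \<le> t \<Longrightarrow> bounded_linear (T t)"
    using semigroup by (simp add: C0_semigroup_def bounded_clinear_iff)
  show "T 0 x = x" "((\<lambda>t. T t x) \<longlongrightarrow> x) (at_right 0)"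
    using semigroup by (simp_all add: C0_semigroup_def)
  show "0 \<le> s \<Longrightarrow> 0 \<le> t \<Longrightarrow> T (s + t) x = T s (T t x)"
    using semigroup by (simp add: C0_semigroup_def)
  show "D = {x. \<exists>y. ((\<lambda>h. (T h x - x) /\<^sub>R h) \<longlongrightarrow> y) (at_right 0)}"
    using has_gen unfolding has_generator_def by (rule conjunct1)
  show "x \<in> D \<Longrightarrow> ((\<lambda>h. (T h x - x) /\<^sub>R h) \<longlongrightarrow> A x) (at_right 0)"
    using has_gen by (simp add: has_generator_def)
qed

lemma generator_scaleC: "x \<in> D \<Longrightarrow> c *\<^sub>C x \<in> D" "x \<in> D \<Longrightarrow> A (c *\<^sub>C x) = c *\<^sub>C A x"
  using generator_linear_image[of "\<lambda>x. c *\<^sub>C x" x]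
    bounded_bilinear.bounded_linear_right[OF bounded_bilinear_scaleC, of c]
  by (auto simp: scaleC)

lemma generator_diff: "x \<in> D \<Longrightarrow> y \<in> D \<Longrightarrow> x - y \<in> D" "x \<in> D \<Longrightarrow> y \<in> D \<Longrightarrow> A (x - y) = A x - A y"
  using generator_add[of x "(-1) *\<^sub>R y"] generator_scaleR[of y "-1"] by simp_all

lemma resolventD:
  assumes "\<mu> \<in> resolvent_set D A"
  shows "resolvent D A \<mu> x \<in> D" "\<mu> *\<^sub>C resolvent D A \<mu> x - A (resolvent D A \<mu> x) = x"
    "y \<in> D \<Longrightarrow> resolvent D A \<mu> (\<mu> *\<^sub>C y - A y) = y" "bounded_clinear (resolvent D A \<mu>)"
proof -
  have bij: "bij_betw (\<lambda>x. \<mu> *\<^sub>C x - A x) D UNIV" and lin: "bounded_clinear (resolvent D A \<mu>)"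
    using assms by (auto simp: resolvent_set_def)
  show "bounded_clinear (resolvent D A \<mu>)" by (rule lin)
  have x: "x \<in> (\<lambda>x. \<mu> *\<^sub>C x - A x) ` D" using bij by (simp add: bij_betw_def)
  show "resolvent D A \<mu> x \<in> D" unfolding resolvent_def using x by (rule inv_into_into)
  show "\<mu> *\<^sub>C resolvent D A \<mu> x - A (resolvent D A \<mu> x) = x"
    unfolding resolvent_def using f_inv_into_f[OF x] by simp
  show "y \<in> D \<Longrightarrow> resolvent D A \<mu> (\<mu> *\<^sub>C y - A y) = y"
    unfolding resolvent_def using bij inv_into_f_f[of "\<lambda>x. \<mu> *\<^sub>C x - A x" D y] by (simp add: bij_betw_def)
qed

lemma resolventD_real:
  assumes "complex_of_real l \<in> resolvent_set D A"
  shows "resolvent D A l x \<in> D" "A (resolvent D A l x) = l *\<^sub>R resolvent D A l x - x"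
    "y \<in> D \<Longrightarrow> resolvent D A l (l *\<^sub>R y - A y) = y"
proof -
  show "resolvent D A l x \<in> D" using resolventD(1)[OF assms] .
  show "A (resolvent D A l x) = l *\<^sub>R resolvent D A l x - x"
    using resolventD(2)[OF assms, of x] by (simp add: scaleC_of_real algebra_simps)
  show "y \<in> D \<Longrightarrow> resolvent D A l (l *\<^sub>R y - A y) = y"
    using resolventD(3)[OF assms, of y] by (simp add: scaleC_of_real)
qed

lemma resolvent_identity:
  assumes l: "complex_of_real l \<in> resolvent_set D A" and m: "complex_of_real m \<in> resolvent_set D A"
  shows "resolvent D A m x = resolvent D A l (x + (l - m) *\<^sub>R resolvent D A m x)"
proof -
  let ?y = "resolvent D A m x"
  have "l *\<^sub>R ?y - A ?y = x + (l - m) *\<^sub>R ?y"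
    using resolventD_real(2)[OF m, of x] by (simp add: algebra_simps)
  then show ?thesis using resolventD_real(3)[OF l resolventD_real(1)[OF m, of x]] by simp
qed

text \<open>
The resolvent at \<open>\<mu>\<close> is the orbit integral of the stable semigroup \<open>exp (- \<mu> t) T t\<close>.
\<close>

lemma right_halfplane_in_resolvent_set:
  assumes growth: "\<And>t x. 0 \<le> t \<Longrightarrow> norm (T t x) \<le> M * exp (\<omega> * t) * norm x" and \<mu>: "\<omega> < Re \<mu>"
  shows "\<mu> \<in> resolvent_set D A"
proof -
  let ?W = "\<lambda>t x. exp (complex_of_real t * (- \<mu>)) *\<^sub>C T t x"
  have "generated_semigroup ?W D (\<lambda>x. A x + (- \<mu>) *\<^sub>C x)"
    by (rule scaled_semigroup) (auto simp: bounded_bilinear_scaleC scaleC generated_semigroup_axioms)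
  moreover have "norm (?W t x) \<le> M * exp (- (Re \<mu> - \<omega>) * t) * norm x" if "0 \<le> t" for t x
  proof -
    have "norm (?W t x) = exp (- Re \<mu> * t) * norm (T t x)"
      by (simp add: norm_scaleC norm_exp_eq_Re mult.commute)
    also have "\<dots> \<le> exp (- Re \<mu> * t) * (M * exp (\<omega> * t) * norm x)"
      using growth[OF that, of x] by simp
    also have "\<dots> = M * (exp (- Re \<mu> * t) * exp (\<omega> * t)) * norm x" by (simp add: mult_ac)
    also have "exp (- Re \<mu> * t) * exp (\<omega> * t) = exp (- (Re \<mu> - \<omega>) * t)"
      by (simp flip: exp_add add: algebra_simps)
    finally show ?thesis .
  qed
  ultimately interpret W: stable_semigroup ?W D "\<lambda>x. A x + (- \<mu>) *\<^sub>C x" M "Re \<mu> - \<omega>"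
    using \<mu> by (simp add: stable_semigroup_def stable_semigroup_axioms_def)
  interpret J: bounded_linear W.orbit_integral by (rule W.bounded_linear_orbit_integral)
  have J_left: "W.orbit_integral (\<mu> *\<^sub>C x - A x) = x" if "x \<in> D" for x
  proof -
    have "\<mu> *\<^sub>C x - A x = - (A x + (- \<mu>) *\<^sub>C x)" by simp
    also have "W.orbit_integral \<dots> = - W.orbit_integral (A x + (- \<mu>) *\<^sub>C x)"
      by (rule linear_neg[OF J.linear])
    finally show ?thesis using W.orbit_integral_generator[OF that] by simp
  qed
  have J_right: "\<mu> *\<^sub>C W.orbit_integral x - A (W.orbit_integral x) = x" for x
  proof -
    have "A (W.orbit_integral x) + (- \<mu>) *\<^sub>C W.orbit_integral x = - x" by (rule W.generator_orbit_integral)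
    then have "A (W.orbit_integral x) = \<mu> *\<^sub>C W.orbit_integral x - x" by (simp add: algebra_simps)
    then show ?thesis by simp
  qed
  have inj: "inj_on (\<lambda>x. \<mu> *\<^sub>C x - A x) D" by (rule inj_on_inverseI[of _ W.orbit_integral]) (rule J_left)
  have res: "resolvent D A \<mu> x = W.orbit_integral x" for x
    unfolding resolvent_def by (rule inv_into_f_eq[OF inj W.generator_orbit_integral(1) J_right])
  have "bij_betw (\<lambda>x. \<mu> *\<^sub>C x - A x) D UNIV"
    by (rule bij_betw_byWitness[of _ W.orbit_integral])
      (use J_left J_right W.generator_orbit_integral(1) in auto)
  moreover have "bounded_clinear (resolvent D A \<mu>)"
  proof -
    have "W.orbit_integral (c *\<^sub>C x) = c *\<^sub>C W.orbit_integral x" for c x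
      by (rule W.orbit_integral_commute[symmetric])
        (simp_all add: bounded_bilinear.bounded_linear_right[OF bounded_bilinear_scaleC] scaleC mult.commute)
    then have "bounded_clinear W.orbit_integral"
      unfolding bounded_clinear_iff using W.bounded_linear_orbit_integral by blast
    moreover have "resolvent D A \<mu> = W.orbit_integral" using res by (rule ext)
    ultimately show ?thesis by simp
  qed
  ultimately show ?thesis by (simp add: resolvent_set_def)
qed

lemma resolvent_mem_cone:
  assumes growth: "\<And>t x. 0 \<le> t \<Longrightarrow> norm (T t x) \<le> M * exp (\<omega> * t) * norm x" and l: "\<omega> < l"
    and C: "closed C" "convex_cone C" "\<And>t. 0 \<le> t \<Longrightarrow> T t x \<in> C"
  shows "resolvent D A l x \<in> C"
proof -
  interpret W: stable_semigroup "\<lambda>t x. exp (- l * t) *\<^sub>R T t x" D "\<lambda>x. A x - l *\<^sub>R x" M "l - \<omega>"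
    by (rule stable_scaleR[OF growth l])
  define y where "y = W.orbit_integral x"
  have y: "y \<in> D" "A y - l *\<^sub>R y = - x" unfolding y_def by (rule W.generator_orbit_integral)+
  then have "l *\<^sub>R y - A y = x" by (metis minus_diff_eq minus_equation_iff)
  moreover have "complex_of_real l \<in> resolvent_set D A"
    using growth l by (intro right_halfplane_in_resolvent_set) auto
  ultimately have "resolvent D A l x = y" using resolventD_real(3)[OF _ y(1)] by metis
  also have "y \<in> C"
    unfolding y_def by (rule W.orbit_integral_mem_cone) (use C in \<open>auto intro: convex_cone_scaleR\<close>)
  finally show ?thesis .
qed

lemma spectral_bound_not_infty: "spectral_bound D A \<noteq> \<infinity>"
proof -
  obtain M \<omega> where M: "\<And>t x. 0 \<le> t \<Longrightarrow> norm (T t x) \<le> M * exp (\<omega> * t) * norm x"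
    by (rule growth_bound) blast
  have "spectral_bound D A \<le> ereal \<omega>"
    unfolding spectral_bound_def
  proof (rule SUP_least)
    fix \<mu> assume "\<mu> \<in> spectrum D A"
    then show "ereal (Re \<mu>) \<le> ereal \<omega>"
      using right_halfplane_in_resolvent_set[OF M, of \<mu>] by (force simp: spectrum_def)
  qed
  then show ?thesis by auto
qed

lemma above_spectral_bound:
  assumes "spectral_bound D A = ereal s" "s < l"
  shows "complex_of_real l \<in> resolvent_set D A"
proof (rule ccontr)
  assume "complex_of_real l \<notin> resolvent_set D A"
  then have "ereal (Re (complex_of_real l)) \<le> spectral_bound D A"
    unfolding spectral_bound_def spectrum_def by (intro SUP_upper) simp
  then show False using assms by simp
qed

text \<open>
Around a point \<open>i\<close> the resolvents are bounded by \<open>4b/3\<close>, where \<open>b\<close> bounds the one at \<open>i\<close>. For \<open>m \<le> l\<close>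
near \<open>i\<close>, the vector \<open>R(m) x\<close> is therefore the limit of the iteration
\<open>y \<mapsto> R(l) (x + (l - m) y)\<close> started at \<open>0\<close>, and a convex cone invariant under \<open>R(l)\<close> contains all iterates.
The radius does not depend on the cone or on \<open>l\<close>.
\<close>

lemma resolvent_cone_step:
  assumes \<rho>: "\<And>l. s < l \<Longrightarrow> complex_of_real l \<in> resolvent_set D A" and i: "s < i"
  obtains \<epsilon> where "\<epsilon> > 0" "\<And>l m C. \<bar>l - i\<bar> < \<epsilon> \<Longrightarrow> \<bar>m - i\<bar> < \<epsilon> \<Longrightarrow> m \<le> l \<Longrightarrow> closed C \<Longrightarrow> convex_cone C \<Longrightarrow>
      resolvent D A l ` C \<subseteq> C \<Longrightarrow> resolvent D A m ` C \<subseteq> C"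
proof -
  let ?R = "\<lambda>l. resolvent D A (complex_of_real l)"
  have Rlin: "bounded_linear (?R l)" if "s < l" for l
    using resolventD(4)[OF \<rho>[OF that]] by (simp add: bounded_clinear_iff)
  obtain b where b: "b > 0" "\<And>x. norm (?R i x) \<le> b * norm x"
    using bounded_linear.pos_bounded[OF Rlin[OF i]] by (auto simp: mult.commute)
  define \<epsilon> where "\<epsilon> = min (i - s) (1 / (4 * b))"
  have near: "s < l" "norm (?R l x) \<le> 4 / 3 * b * norm x" if l: "\<bar>l - i\<bar> < \<epsilon>" for l x
  proof -
    show "s < l" using l by (auto simp: \<epsilon>_def)
    let ?y = "?R l x"
    have "\<bar>i - l\<bar> * b \<le> 1 / (4 * b) * b"
      using l b by (intro mult_right_mono) (auto simp: \<epsilon>_def)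
    then have "\<bar>i - l\<bar> * b \<le> 1 / 4" using b by simp
    then have q: "\<bar>i - l\<bar> * b * norm ?y \<le> 1 / 4 * norm ?y" by (rule mult_right_mono) simp
    have "norm ?y \<le> b * norm (x + (i - l) *\<^sub>R ?y)"
      using resolvent_identity[OF \<rho>[OF i] \<rho>[OF \<open>s < l\<close>], of x] b(2) by metis
    also have "\<dots> \<le> b * (norm x + \<bar>i - l\<bar> * norm ?y)"
      using b(1) norm_triangle_ineq[of x "(i - l) *\<^sub>R ?y"] by (intro mult_left_mono) auto
    finally show "norm ?y \<le> 4 / 3 * b * norm x" using q by (simp add: algebra_simps)
  qed
  show ?thesis
  proof (rule that[of \<epsilon>])
    show "\<epsilon> > 0" using i b by (simp add: \<epsilon>_def)
    fix l m C assume l: "\<bar>l - i\<bar> < \<epsilon>" and m: "\<bar>m - i\<bar> < \<epsilon>" "m \<le> l"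
      and C: "closed C" "convex_cone C" "?R l ` C \<subseteq> C"
    show "?R m ` C \<subseteq> C"
    proof (intro subsetI, elim imageE)
      fix z x assume z: "z = ?R m x" and x: "x \<in> C"
      interpret R: bounded_linear "?R l" by (rule Rlin[OF near(1)[OF l]])
      define y where "y = rec_nat 0 (\<lambda>_ y. ?R l (x + (l - m) *\<^sub>R y))"
      have y: "y 0 = 0" "y (Suc k) = ?R l (x + (l - m) *\<^sub>R y k)" for k by (simp_all add: y_def)
      have "y k \<in> C" for k
      proof (induction k)
        case (Suc k)
        then have "x + (l - m) *\<^sub>R y k \<in> C"
          using m x C(2) by (intro convex_cone_add convex_cone_scaleR) auto
        then show ?case using C(3) by (auto simp: y)
      qed (simp add: y convex_cone_contains_0 C)
      moreover have "norm (y k - z) \<le> (2 / 3) ^ k * norm z" for k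
      proof (induction k)
        case (Suc k)
        have "z = ?R l (x + (l - m) *\<^sub>R z)"
          unfolding z using resolvent_identity[OF \<rho> \<rho>] near(1) l m(1) by blast
        then have "y (Suc k) - z = ?R l ((l - m) *\<^sub>R (y k - z))"
          by (metis R.diff add_diff_cancel_left scaleR_diff_right y(2))
        then have "norm (y (Suc k) - z) \<le> 4 / 3 * b * ((l - m) * norm (y k - z))"
          using near(2)[OF l, of "(l - m) *\<^sub>R (y k - z)"] m(2) by simp
        also have "\<dots> = 4 / 3 * (b * (l - m)) * norm (y k - z)" by simp
        also have "b * (l - m) \<le> b * (2 * (1 / (4 * b)))"
          using l m b by (intro mult_left_mono) (auto simp: \<epsilon>_def)
        also have "b * (2 * (1 / (4 * b))) = 1 / 2" using b by simp
        finally have "norm (y (Suc k) - z) \<le> 2 / 3 * norm (y k - z)"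
          by (simp add: mult_right_mono)
        then show ?case using Suc.IH by simp
      qed (simp add: y)
      then have "\<forall>\<^sub>F k in sequentially. norm (y k - z) \<le> (2 / 3) ^ k * norm z"
        by (intro always_eventually allI)
      then have "(\<lambda>k. y k - z) \<longlonglongrightarrow> 0"
      proof (rule Lim_null_comparison)
        show "(\<lambda>k. (2 / 3) ^ k * norm z) \<longlonglongrightarrow> 0" by real_asymp
      qed
      then have "y \<longlonglongrightarrow> z" by (simp add: LIM_zero_iff)
      ultimately show "z \<in> C" using C(1) by (meson closed_sequentially)
    qed
  qed
qed

text \<open>
The Laplace transform represents the resolvent only to the right of the growth bound, which may
exceed \<open>s\<close>. Invariance is carried to the left down to \<open>s\<close>: by the local step, the infimum of the points
above \<open>m\<close> from which on all resolvents leave the cone invariant can only be \<open>m\<close>.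
\<close>

lemma resolvent_cone_invariant:
  assumes \<rho>: "\<And>l. s < l \<Longrightarrow> complex_of_real l \<in> resolvent_set D A" and m: "s < m"
    and C: "closed C" "convex_cone C" "\<And>t x. 0 \<le> t \<Longrightarrow> x \<in> C \<Longrightarrow> T t x \<in> C"
  shows "resolvent D A m ` C \<subseteq> C"
proof -
  obtain M \<omega> where M: "\<And>t x. 0 \<le> t \<Longrightarrow> norm (T t x) \<le> M * exp (\<omega> * t) * norm x"
    by (rule growth_bound) blast
  define good where "good l \<longleftrightarrow> resolvent D A (complex_of_real l) ` C \<subseteq> C" for l :: real
  have large: "good l" if "\<omega> < l" for l
    unfolding good_def using C by (auto intro: resolvent_mem_cone[OF M that])
  define S where "S = {l. m \<le> l \<and> (\<forall>l'\<ge>l. good l')}"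
  have "max m (\<omega> + 1) \<in> S" by (auto simp: S_def large)
  then have ne: "S \<noteq> {}" by blast
  have bdd: "bdd_below S" by (rule bdd_belowI[of _ m]) (simp add: S_def)
  define i where "i = Inf S"
  have mi: "m \<le> i" unfolding i_def by (rule cInf_greatest[OF ne]) (simp add: S_def)
  with m have "s < i" by simp
  obtain \<epsilon> where \<epsilon>: "\<epsilon> > 0"
    "\<And>l m. \<bar>l - i\<bar> < \<epsilon> \<Longrightarrow> \<bar>m - i\<bar> < \<epsilon> \<Longrightarrow> m \<le> l \<Longrightarrow> good l \<Longrightarrow> good m"
    by (rule resolvent_cone_step[OF \<rho> \<open>s < i\<close>]) (use C(1,2) in \<open>auto simp: good_def\<close>)
  obtain l where l: "l \<in> S" "l < i + \<epsilon>"
    using cInf_lessD[OF ne, of "i + \<epsilon>"] \<epsilon>(1) by (auto simp: i_def)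
  have "i \<le> l" unfolding i_def by (rule cInf_lower[OF l(1) bdd])
  have good: "good l'" if "i - \<epsilon> < l'" for l'
  proof (cases "l \<le> l'")
    case False
    then show ?thesis using \<epsilon>(2)[of l l'] l that \<open>i \<le> l\<close> by (auto simp: S_def)
  qed (use l in \<open>simp add: S_def\<close>)
  have "max m (i - \<epsilon> / 2) \<in> S" using \<epsilon>(1) by (auto simp: S_def intro!: good)
  then have "i \<le> max m (i - \<epsilon> / 2)" unfolding i_def by (rule cInf_lower[OF _ bdd])
  then have "i = m" using mi \<epsilon>(1) by (auto simp: max_def split: if_splits)
  then show ?thesis using good[of m] \<epsilon>(1) by (simp add: good_def)
qed

end

section \<open>Poles of the resolvent and positive eigenvectors\<close>

text \<open>
At half of the radius of convergence the terms are bounded, so on a quarter of it the series converges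
uniformly and its sum is continuous up to \<open>0\<close>.
\<close>

lemma power_series_limit:
  fixes a :: "nat \<Rightarrow> 'b::banach"
  assumes r: "r > 0" and sums: "\<And>h. 0 < h \<Longrightarrow> h < r \<Longrightarrow> (\<lambda>k. h ^ k *\<^sub>R a k) sums f h"
  shows "(f \<longlongrightarrow> a 0) (at_right (0::real))"
proof -
  define h0 where "h0 = r / 2"
  have h0: "h0 > 0" "h0 < r" using r by (auto simp: h0_def)
  obtain c where c: "\<And>k. norm (h0 ^ k *\<^sub>R a k) \<le> c"
    using sums_summable[OF sums[OF h0], THEN summable_LIMSEQ_zero]
    by (metis BseqE Bseq_eq_bounded convergentI convergent_imp_Bseq)
  have "continuous_on {0..h0 / 2} (\<lambda>h. \<Sum>k. h ^ k *\<^sub>R a k)"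
  proof (rule uniform_limit_theorem[OF _ _ trivial_limit_sequentially])
    show "\<forall>\<^sub>F n in sequentially. continuous_on {0..h0 / 2} (\<lambda>h. \<Sum>k<n. h ^ k *\<^sub>R a k)"
      by (intro always_eventually allI continuous_intros)
    show "uniform_limit {0..h0 / 2} (\<lambda>n h. \<Sum>k<n. h ^ k *\<^sub>R a k) (\<lambda>h. \<Sum>k. h ^ k *\<^sub>R a k) sequentially"
    proof (rule Weierstrass_m_test)
      show "summable (\<lambda>k. c * (1 / 2) ^ k)" by (intro summable_mult summable_geometric) simp
      fix k h assume h: "h \<in> {0..h0 / 2}"
      have "norm (h ^ k *\<^sub>R a k) = h ^ k * norm (a k)" using h by simp
      also have "\<dots> \<le> (h0 / 2) ^ k * norm (a k)" using h by (intro mult_right_mono power_mono) auto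
      also have "\<dots> = norm (h0 ^ k *\<^sub>R a k) * (1 / 2) ^ k" using h0 by (simp add: power_divide)
      also have "\<dots> \<le> c * (1 / 2) ^ k" using c by (intro mult_right_mono) auto
      finally show "norm (h ^ k *\<^sub>R a k) \<le> c * (1 / 2) ^ k" .
    qed
  qed
  then have "((\<lambda>h. \<Sum>k. h ^ k *\<^sub>R a k) \<longlongrightarrow> (\<Sum>k. 0 ^ k *\<^sub>R a k)) (at 0 within {0..h0 / 2})"
    using h0 by (auto simp: continuous_on_def)
  moreover have "(\<lambda>k. 0 ^ k *\<^sub>R a k) sums (\<Sum>k\<in>{0}. 0 ^ k *\<^sub>R a k)"
    by (rule sums_finite) auto
  then have "(\<Sum>k. 0 ^ k *\<^sub>R a k) = a 0" by (simp add: sums_iff)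
  ultimately have lim: "((\<lambda>h. \<Sum>k. h ^ k *\<^sub>R a k) \<longlongrightarrow> a 0) (at_right 0)"
    using h0 by (simp add: at_within_Icc_at_right)
  have "\<forall>\<^sub>F h in at_right 0. (\<Sum>k. h ^ k *\<^sub>R a k) = f h"
    unfolding eventually_at_right_field using sums r by (intro exI[of _ r]) (auto simp: sums_iff)
  then show ?thesis by (rule Lim_transform_eventually[OF lim])
qed

context complex_semigroup
begin

text \<open>
Multiplied by \<open>h\<^sup>m\<close>, the Laurent expansion becomes a power series in \<open>h\<close>. Its constant term, the
leading Laurent coefficient, is the limit \<open>U\<close>.
\<close>

lemma resolvent_pole_limit:
  assumes "resolvent_pole D A (complex_of_real s)"
  obtains m U where "m \<ge> 1" "bounded_clinear U" "U \<noteq> (\<lambda>x. 0)"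
    "\<And>x. ((\<lambda>h. h ^ m *\<^sub>R resolvent D A (complex_of_real (s + h)) x) \<longlongrightarrow> U x) (at_right 0)"
proof -
  from assms obtain r m U where r: "r > 0" and m: "m \<ge> 1" and U: "\<And>k. bounded_clinear (U k)" "U 0 \<noteq> (\<lambda>x. 0)"
    and \<rho>: "\<And>\<mu>. \<mu> \<in> ball (complex_of_real s) r - {complex_of_real s} \<Longrightarrow> \<mu> \<in> resolvent_set D A"
    and lim: "\<And>\<mu>. \<mu> \<in> ball (complex_of_real s) r - {complex_of_real s} \<Longrightarrow>
      (\<lambda>n. onorm (\<lambda>x. resolvent D A \<mu> x -
         (\<Sum>k<n. ((\<mu> - complex_of_real s) powi (int k - int m)) *\<^sub>C U k x))) \<longlonglongrightarrow> 0"
    unfolding resolvent_pole_def by blast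
  have "(\<lambda>k. h ^ k *\<^sub>R U k x) sums (h ^ m *\<^sub>R resolvent D A (complex_of_real (s + h)) x)"
    if h: "0 < h" "h < r" for h x
  proof -
    let ?\<mu> = "complex_of_real (s + h)"
    have \<mu>: "?\<mu> \<in> ball (complex_of_real s) r - {complex_of_real s}"
      using h by (auto simp: dist_norm)
    let ?E = "\<lambda>n x. resolvent D A ?\<mu> x - (\<Sum>k<n. ((?\<mu> - complex_of_real s) powi (int k - int m)) *\<^sub>C U k x)"
    have E: "bounded_linear (?E n)" for n
    proof (intro bounded_linear_sub bounded_linear_sum)
      show "bounded_linear (resolvent D A ?\<mu>)"
        using resolventD(4)[OF \<rho>[OF \<mu>]] by (simp add: bounded_clinear_iff)
      show "bounded_linear (\<lambda>x. c *\<^sub>C U k x)" for c k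
        using bounded_linear_compose[OF bounded_bilinear.bounded_linear_right[OF bounded_bilinear_scaleC, of c], of "U k"] U(1)[of k]
        by (simp add: bounded_clinear_iff)
    qed
    have "(\<lambda>n. ?E n x) \<longlonglongrightarrow> 0"
    proof (rule Lim_null_comparison)
      show "\<forall>\<^sub>F n in sequentially. norm (?E n x) \<le> onorm (?E n) * norm x"
        by (intro always_eventually allI onorm E)
      show "(\<lambda>n. onorm (?E n) * norm x) \<longlonglongrightarrow> 0"
        by (rule tendsto_mult_left_zero[OF lim[OF \<mu>]])
    qed
    then have "(\<lambda>n. h ^ m *\<^sub>R (resolvent D A ?\<mu> x - ?E n x)) \<longlonglongrightarrow> h ^ m *\<^sub>R (resolvent D A ?\<mu> x - 0)"
      by (intro tendsto_scaleR tendsto_diff tendsto_const)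
    moreover have "h ^ m *\<^sub>R (resolvent D A ?\<mu> x - ?E n x) = (\<Sum>k<n. h ^ k *\<^sub>R U k x)" for n
    proof -
      have "h ^ m *\<^sub>R (((?\<mu> - complex_of_real s) powi (int k - int m)) *\<^sub>C U k x) = h ^ k *\<^sub>R U k x" for k
      proof -
        have "(?\<mu> - complex_of_real s) powi (int k - int m) = complex_of_real (h powi (int k - int m))"
          by simp
        moreover have "h ^ m * h powi (int k - int m) = h ^ k"
          using h by (simp add: power_int_diff)
        ultimately show ?thesis by (simp only: scaleC_of_real scaleR_scaleR)
      qed
      then show ?thesis by (simp only: diff_diff_eq2 add_diff_cancel_left' add_diff_cancel scaleR_sum_right)
    qed
    ultimately show ?thesis by (simp add: sums_def)
  qed
  then have "((\<lambda>h. h ^ m *\<^sub>R resolvent D A (complex_of_real (s + h)) x) \<longlongrightarrow> U 0 x) (at_right 0)" for x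
    by (intro power_series_limit[OF r]) auto
  then show ?thesis using that m U by blast
qed

text \<open>
The map \<open>r \<mapsto> r w\<close> intertwines the semigroup \<open>exp (c t)\<close> on the real line with \<open>T\<close>.
\<close>

lemma orbit_eigenvector:
  assumes w: "w \<in> D" "A w = c *\<^sub>R w" and t: "0 \<le> t"
  shows "T t w = exp (c * t) *\<^sub>R w"
proof -
  have "generated_semigroup (\<lambda>t x::real. x) UNIV (\<lambda>x. 0)"
    by (intro generated_semigroup.intro c0_semigroup.intro generated_semigroup_axioms.intro)
      (auto simp: bounded_linear_ident)
  from scaled_semigroup[OF this bounded_bilinear_mult, of c]
  have "generated_semigroup (\<lambda>t x. exp (t * c) * x) UNIV (\<lambda>x. 0 + c * x)" by simp
  from semigroup_intertwine[OF generated_semigroup_axioms this, of "\<lambda>r. r *\<^sub>R w" t 1]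
  show ?thesis
    using w t by (simp add: bounded_linear_scaleR_left generator_scaleR mult.commute)
qed

lemma pole_eigenvector:
  assumes \<rho>: "\<And>l. s < l \<Longrightarrow> complex_of_real l \<in> resolvent_set D A" and m: "m \<ge> 1"
    and lim: "((\<lambda>h. h ^ m *\<^sub>R resolvent D A (complex_of_real (s + h)) x) \<longlongrightarrow> w) (at_right 0)"
  shows "w \<in> D" "A w = s *\<^sub>R w"
proof -
  define h where "h n = 1 / real (Suc n)" for n
  have h: "h n > 0" "h n \<noteq> 0" for n by (simp_all add: h_def)
  have h_lim: "h \<longlonglongrightarrow> 0" unfolding h_def by real_asymp
  have "filterlim h (at_right 0) sequentially"
    unfolding filterlim_at using h h_lim by simp
  from filterlim_compose[OF lim this]
  have X: "(\<lambda>n. h n ^ m *\<^sub>R resolvent D A (complex_of_real (s + h n)) x) \<longlonglongrightarrow> w" .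
  let ?X = "\<lambda>n. h n ^ m *\<^sub>R resolvent D A (complex_of_real (s + h n)) x"
  have XD: "?X n \<in> D" for n by (intro generator_scaleR resolventD_real \<rho>) (simp add: h)
  have "A (?X n) = (s + h n) *\<^sub>R ?X n - h n ^ m *\<^sub>R x" for n
    using resolventD_real(1,2)[OF \<rho>, of "s + h n" x] h[of n]
    by (simp add: generator_scaleR scaleR_diff_right mult.commute)
  moreover have "(\<lambda>n. (s + h n) *\<^sub>R ?X n - h n ^ m *\<^sub>R x) \<longlonglongrightarrow> (s + 0) *\<^sub>R w - 0 ^ m *\<^sub>R x"
    by (intro tendsto_intros X h_lim)
  ultimately have "(\<lambda>n. A (?X n)) \<longlonglongrightarrow> s *\<^sub>R w" using m by (simp add: power_0_left)
  from generator_closed[OF XD X this] show "w \<in> D" "A w = s *\<^sub>R w" .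
qed

lemma positive_decomposition:
  fixes x :: "'a complexification"
  obtains p1 p2 p3 p4 where "0 \<le> p1" "0 \<le> p2" "0 \<le> p3" "0 \<le> p4" "x = (p1 - p2) + \<i> *\<^sub>C (p3 - p4)"
proof (rule that)
  show "0 \<le> Cplx (pprt (re_part x)) 0" "0 \<le> Cplx (- nprt (re_part x)) 0"
    "0 \<le> Cplx (pprt (im_part x)) 0" "0 \<le> Cplx (- nprt (im_part x)) 0"
    by (auto simp: complexification_nonneg_iff)
  show "x = (Cplx (pprt (re_part x)) 0 - Cplx (- nprt (re_part x)) 0) +
     \<i> *\<^sub>C (Cplx (pprt (im_part x)) 0 - Cplx (- nprt (im_part x)) 0)"
    by (simp add: complexification_eq_iff prts[symmetric])
qed

text \<open>
Let \<open>K\<close> be the closed convex cone of vectors with positive orbits. It is invariant under the semigroup,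
hence under the resolvents at all \<open>l > s\<close>, hence under the leading Laurent coefficient \<open>U\<close> at \<open>s\<close>, whose
range consists of eigenvectors. Some positive \<open>p\<close> has \<open>U p \<noteq> 0\<close>, and its orbit
enters \<open>K\<close> at some time \<open>t0\<close>; since \<open>U (T t0 p) = exp (s t0) U p\<close>, the point of entry is still mapped to
a nonzero vector.
\<close>

lemma positive_eigenvector:
  assumes \<rho>: "\<And>l. s < l \<Longrightarrow> complex_of_real l \<in> resolvent_set D A"
    and pole: "resolvent_pole D A (complex_of_real s)"
    and pos: "individually_eventually_positive T"
  obtains w where "w > 0" "w \<in> D" "A w = s *\<^sub>R w"
proof -
  obtain m U where m: "m \<ge> 1" and U: "bounded_clinear U" "U \<noteq> (\<lambda>x. 0)"
    and lim: "\<And>x. ((\<lambda>h. h ^ m *\<^sub>R resolvent D A (complex_of_real (s + h)) x) \<longlongrightarrow> U x) (at_right 0)"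
    by (rule resolvent_pole_limit[OF pole]) blast
  interpret U: bounded_linear U using U(1) by (simp add: bounded_clinear_iff)
  have UC: "U (c *\<^sub>C x) = c *\<^sub>C U x" for c x using U(1) by (simp add: bounded_clinear_iff)
  have "\<exists>p\<ge>0. U p \<noteq> 0"
  proof (rule ccontr)
    assume "\<not> (\<exists>p\<ge>0. U p \<noteq> 0)"
    then have zero: "U p = 0" if "0 \<le> p" for p using that by blast
    have "U x = 0" for x
    proof -
      obtain p1 p2 p3 p4 where p: "0 \<le> p1" "0 \<le> p2" "0 \<le> p3" "0 \<le> p4" "x = (p1 - p2) + \<i> *\<^sub>C (p3 - p4)"
        by (rule positive_decomposition)
      show ?thesis unfolding p(5) by (simp add: U.add U.diff UC zero p(1-4))
    qed
    then show False using U(2) by blast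
  qed
  then obtain p where p: "0 \<le> p" "U p \<noteq> 0" by blast
  obtain t0 where t0: "t0 \<ge> 0" "\<And>t. t \<ge> t0 \<Longrightarrow> 0 \<le> T t p"
    using pos p(1) unfolding individually_eventually_positive_def by blast
  define K where "K = (\<Inter>t\<in>{0..}. T t -` positive_cone)"
  have K_iff: "g \<in> K \<longleftrightarrow> (\<forall>t\<ge>0. 0 \<le> T t g)" for g by (auto simp: K_def positive_cone_def)
  have K_closed: "closed K"
    unfolding K_def
    by (intro closed_INT ballI continuous_closed_vimage closed_positive_cone linear_continuous_at bounded_linear) auto
  have K_cone: "convex_cone K"
    by (rule convex_coneI) (auto simp: K_iff lin_simps scaleR_nonneg_nonneg)
  have K_inv: "T t g \<in> K" if "0 \<le> t" "g \<in> K" for t g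
    using that by (auto simp: K_iff simp flip: add)
  define g where "g = T t0 p"
  have "T t g = T (t + t0) p" if "0 \<le> t" for t using add[OF that t0(1)] by (simp add: g_def)
  then have "g \<in> K" using t0 by (simp add: K_iff)
  have w: "U x \<in> D" "A (U x) = s *\<^sub>R U x" for x
    using pole_eigenvector[OF \<rho> m lim] by blast+
  have "U g \<in> K"
  proof (rule Lim_in_closed_set[OF K_closed _ trivial_limit_at_right_real lim])
    have "h ^ m *\<^sub>R resolvent D A (complex_of_real (s + h)) g \<in> K" if "h > 0" for h
      using resolvent_cone_invariant[OF \<rho> _ K_closed K_cone K_inv, of s "s + h"] that \<open>g \<in> K\<close>
      by (intro convex_cone_scaleR K_cone) auto
    then show "\<forall>\<^sub>F h in at_right 0. h ^ m *\<^sub>R resolvent D A (complex_of_real (s + h)) g \<in> K"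
      by (simp add: eventually_at_filter)
  qed
  then have "0 \<le> U g" using K_iff[of "U g"] by force
  moreover have "U g \<noteq> 0"
  proof -
    have "U (T t0 p) = T t0 (U p)"
    proof (rule tendsto_unique[OF trivial_limit_at_right_real lim])
      have "((\<lambda>h. T t0 (h ^ m *\<^sub>R resolvent D A (complex_of_real (s + h)) p)) \<longlongrightarrow> T t0 (U p)) (at_right 0)"
        by (intro bounded_linear.tendsto[OF bounded_linear[OF t0(1)]] lim)
      moreover have "\<forall>\<^sub>F h in at_right 0. T t0 (h ^ m *\<^sub>R resolvent D A (complex_of_real (s + h)) p) =
          h ^ m *\<^sub>R resolvent D A (complex_of_real (s + h)) (T t0 p)"
        unfolding eventually_at_filter
      proof (intro always_eventually allI impI)
        fix h :: real assume "h \<in> {0<..}"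
        then have l: "complex_of_real (s + h) \<in> resolvent_set D A" by (intro \<rho>) simp
        let ?y = "resolvent D A (complex_of_real (s + h)) p"
        have "(s + h) *\<^sub>R T t0 ?y - A (T t0 ?y) = T t0 p"
          using resolventD_real(1,2)[OF l, of p] t0(1) by (simp add: generator_orbit lin_simps)
        then have "resolvent D A (complex_of_real (s + h)) (T t0 p) = T t0 ?y"
          using resolventD_real(3)[OF l, of "T t0 ?y"] generator_orbit(1)[OF resolventD_real(1)[OF l] t0(1)]
          by metis
        then show "T t0 (h ^ m *\<^sub>R ?y) = h ^ m *\<^sub>R resolvent D A (complex_of_real (s + h)) (T t0 p)"
          using t0(1) by (simp add: lin_simps)
      qed
      ultimately show "((\<lambda>h. h ^ m *\<^sub>R resolvent D A (complex_of_real (s + h)) (T t0 p)) \<longlongrightarrow> T t0 (U p)) (at_right 0)"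
        by (rule Lim_transform_eventually)
    qed
    also have "\<dots> = exp (s * t0) *\<^sub>R U p" using w t0(1) by (intro orbit_eigenvector) auto
    finally show ?thesis using p(2) by (simp add: g_def)
  qed
  ultimately show ?thesis using that[of "U g"] w by (simp add: less_complexification_def)
qed

end

section \<open>Positive perturbations of rank one\<close>

text \<open>
A positive functional that vanishes at \<open>u\<close> vanishes on the ideal generated by \<open>u\<close>, which is dense.
\<close>

lemma positive_functional_quasi_interior:
  fixes \<phi> :: "'a::banach_lattice \<Rightarrow> real"
  assumes u: "quasi_interior u" and \<phi>: "bounded_linear \<phi>" "\<And>x. 0 \<le> x \<Longrightarrow> 0 \<le> \<phi> x" "\<phi> v \<noteq> 0"
  shows "\<phi> (re_part u) > 0"
proof (rule ccontr)
  assume "\<not> \<phi> (re_part u) > 0"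
  moreover have "0 \<le> u" "closure (principal_ideal u) = UNIV" using u by (auto simp: quasi_interior_def)
  ultimately have u0: "\<phi> (re_part u) = 0"
    using \<phi>(2)[of "re_part u"] by (simp add: complexification_nonneg_iff)
  interpret \<phi>: bounded_linear \<phi> by fact
  have mono: "\<phi> x \<le> \<phi> y" if "x \<le> y" for x y
    using \<phi>(2)[of "y - x"] that by (simp add: \<phi>.diff)
  have "principal_ideal u \<subseteq> {x. \<phi> (re_part x) = 0}"
  proof
    fix x assume "x \<in> principal_ideal u"
    then obtain c where "c \<ge> 0" "modulus x \<le> c *\<^sub>R re_part u"
      by (auto simp: principal_ideal_def less_eq_complexification_def abs_complexification_def)
    then have "\<bar>re_part x\<bar> \<le> c *\<^sub>R re_part u" using abs_re_le_modulus order_trans by blast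
    then have "re_part x \<le> c *\<^sub>R re_part u" "- re_part x \<le> c *\<^sub>R re_part u"
      by (meson abs_ge_self abs_ge_minus_self order_trans)+
    from mono[OF this(1)] mono[OF this(2)] show "x \<in> {x. \<phi> (re_part x) = 0}"
      by (simp add: \<phi>.scaleR u0 linear_neg[OF \<phi>.linear])
  qed
  moreover have "closed {x. \<phi> (re_part x) = 0}"
    by (intro closed_Collect_eq linear_continuous_on bounded_linear_compose[OF \<phi>(1) bounded_linear_re_part]
        continuous_on_const)
  ultimately have "UNIV \<subseteq> {x. \<phi> (re_part x) = 0}"
    using \<open>closure _ = UNIV\<close> closure_minimal by metis
  then have "\<phi> (re_part (Cplx v 0)) = 0" by blast
  then show False using \<phi>(3) by simp
qed

text \<open>
The complex-linear extension of a real functional.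
\<close>

definition complex_functional ::
    "('a::banach_lattice \<Rightarrow> real) \<Rightarrow> 'a complexification \<Rightarrow> complex" where
  "complex_functional \<phi> x = Complex (\<phi> (re_part x)) (\<phi> (im_part x))"

lemma complex_functional_scaleC:
  assumes "bounded_linear \<phi>"
  shows "complex_functional \<phi> (c *\<^sub>C x) = c * complex_functional \<phi> x"
proof -
  interpret bounded_linear \<phi> by fact
  show ?thesis by (simp add: complex_functional_def complex_eq_iff diff add scaleR)
qed

lemma bounded_linear_complex_functional:
  assumes "bounded_linear \<phi>"
  shows "bounded_linear (complex_functional \<phi>)"
proof -
  interpret \<phi>: bounded_linear \<phi> by fact
  have eq: "complex_functional \<phi> =
      (\<lambda>x. complex_of_real (\<phi> (re_part x)) + \<i> * of_real (\<phi> (im_part x)))"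
    by (rule ext) (simp add: complex_functional_def complex_eq_iff)
  show ?thesis
    unfolding eq
    by (intro bounded_linear_add bounded_linear_const_mult
        bounded_linear_compose[OF bounded_linear_of_real]
        bounded_linear_compose[OF assms bounded_linear_re_part]
        bounded_linear_compose[OF assms bounded_linear_im_part])
qed

lemma rank_one_operator:
  fixes \<phi> :: "'a::banach_lattice \<Rightarrow> real"
  assumes \<phi>: "bounded_linear \<phi>" "\<And>x. 0 \<le> x \<Longrightarrow> 0 \<le> \<phi> x" "\<phi> v \<noteq> 0" and w: "w > 0"
  defines "B \<equiv> \<lambda>x. complex_functional \<phi> x *\<^sub>C w"
  shows "bounded_clinear B" "positive_operator B" "rank_one B"
proof -
  interpret \<phi>: bounded_linear \<phi> by fact
  interpret sc: bounded_bilinear "scaleC :: complex \<Rightarrow> 'a complexification \<Rightarrow> _" by (rule bounded_bilinear_scaleC)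
  show "bounded_clinear B"
    unfolding B_def bounded_clinear_iff
    using bounded_linear_compose[OF sc.bounded_linear_left bounded_linear_complex_functional[OF \<phi>(1)]]
    by (simp add: complex_functional_scaleC[OF \<phi>(1)])
  show "positive_operator B"
    using w \<phi>(2)
    by (auto simp: positive_operator_def B_def complexification_nonneg_iff complex_functional_def
        less_complexification_def \<phi>.zero intro!: scaleR_nonneg_nonneg)
  have "range B = complexification.span {w}"
  proof -
    have "c *\<^sub>C w \<in> range B" for c
    proof -
      have "complex_functional \<phi> (Cplx v 0) = of_real (\<phi> v)"
        by (simp add: complex_functional_def complex_eq_iff \<phi>.zero)
      then have "B ((c / of_real (\<phi> v)) *\<^sub>C Cplx v 0) = c *\<^sub>C w"
        using \<phi>(3) by (simp add: B_def complex_functional_scaleC[OF \<phi>(1)])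
      then show ?thesis by (metis rangeI)
    qed
    then show ?thesis by (auto simp: complexification.span_singleton B_def)
  qed
  moreover have "complexification.independent {w}"
    using w by (auto simp: less_complexification_def)
  ultimately show "rank_one B"
    unfolding rank_one_def using complexification.dim_span_eq_card_independent[of "{w}"] by simp
qed

lemma scaleC_positive_imp_Re_nonneg:
  fixes w :: "'a::banach_lattice complexification"
  assumes "0 \<le> c *\<^sub>C w" "w > 0"
  shows "0 \<le> Re c"
proof (rule ccontr)
  assume "\<not> 0 \<le> Re c"
  then have c: "Re c < 0" by simp
  have w: "0 \<le> re_part w" "im_part w = 0" "w \<noteq> 0"
    using assms(2) by (auto simp: less_complexification_def complexification_nonneg_iff)
  have "0 \<le> Re c *\<^sub>R re_part w" using assms(1) w(2) by (simp add: complexification_nonneg_iff)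
  moreover have "0 \<le> inverse (- Re c)" using c by simp
  ultimately have "0 \<le> inverse (- Re c) *\<^sub>R (Re c *\<^sub>R re_part w)"
    by (rule scaleR_nonneg_nonneg[rotated])
  also have "inverse (- Re c) *\<^sub>R (Re c *\<^sub>R re_part w) = - re_part w" using c by simp
  finally have "re_part w \<le> 0" by simp
  then show False using w by (simp add: complexification_eq_iff)
qed

context complex_semigroup
begin

text \<open>
With \<open>B x = \<phi>(x) w\<close> the vector \<open>w\<close> becomes an eigenvector of \<open>A + B\<close> for the eigenvalue \<open>l\<close>, and
\<open>\<psi> = \<phi> \<circ> R(l)\<close> an eigenfunctional with \<open>\<psi>(w) = 1\<close>. The complementary projection \<open>P x = x - \<psi>(x) w\<close>
satisfies \<open>(A + B) P = P A\<close>, so that \<open>S t g = P (T t g) + exp (l t) \<psi>(g) w\<close>. As \<open>l\<close> exceeds the growth bound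
of \<open>T\<close>, multiplication by \<open>exp (- l t)\<close> makes the first term vanish in the limit, and \<open>\<psi>(g) w\<close> is a limit of
positive vectors.
\<close>

lemma resolvent_functional_nonneg:
  assumes growth: "\<And>t x. 0 \<le> t \<Longrightarrow> norm (T t x) \<le> M * exp (\<omega> * t) * norm x"
    and l: "\<omega> < l" "s < l"
    and w: "w > 0" "w \<in> D" "A w = s *\<^sub>R w"
    and \<phi>: "bounded_linear \<phi>" "\<phi> (re_part w) = l - s"
    and S: "perturbed_semigroup D A (\<lambda>x. complex_functional \<phi> x *\<^sub>C w) S" "individually_eventually_positive S"
    and g: "0 \<le> g"
  shows "0 \<le> \<phi> (re_part (resolvent D A (complex_of_real l) g))"
proof -
  let ?R = "resolvent D A (complex_of_real l)" and ?F = "complex_functional \<phi>"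
  let ?B = "\<lambda>x. ?F x *\<^sub>C w"
  interpret \<phi>: bounded_linear \<phi> by fact
  interpret F: bounded_linear ?F by (rule bounded_linear_complex_functional[OF \<phi>(1)])
  interpret sc: bounded_bilinear "scaleC :: complex \<Rightarrow> 'a complexification \<Rightarrow> _" by (rule bounded_bilinear_scaleC)
  interpret S: complex_semigroup S D "\<lambda>x. A x + ?B x"
    using S(1) by (simp add: perturbed_semigroup_def complex_semigroup_def)
  have \<rho>: "complex_of_real l \<in> resolvent_set D A"
    by (rule right_halfplane_in_resolvent_set[OF growth]) (use l in auto)
  interpret R: bounded_linear ?R using resolventD(4)[OF \<rho>] by (simp add: bounded_clinear_iff)
  have im_w: "im_part w = 0" using w(1) by (simp add: less_complexification_def complexification_nonneg_iff)
  have Fw: "?F w = of_real (l - s)"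
    by (simp add: complex_functional_def complex_eq_iff \<phi>(2) im_w \<phi>.zero)
  define \<psi> where "\<psi> x = ?F (?R x)" for x
  have \<psi>: "bounded_linear \<psi>" unfolding \<psi>_def by (rule bounded_linear_compose[OF F.bounded_linear_axioms R.bounded_linear_axioms])
  interpret \<psi>: bounded_linear \<psi> by (rule \<psi>)
  have \<psi>A: "\<psi> (A x) = of_real l * \<psi> x - ?F x" if "x \<in> D" for x
  proof -
    have "?R (A x) = l *\<^sub>R ?R x - x"
      using resolventD_real(3)[OF \<rho> that] by (simp add: R.diff R.scaleR algebra_simps)
    then show ?thesis by (simp add: \<psi>_def F.diff F.scaleR scaleR_conv_of_real)
  qed
  define P where "P x = x - \<psi> x *\<^sub>C w" for x
  have P: "bounded_linear P"
    unfolding P_def by (intro bounded_linear_sub bounded_linear_ident bounded_linear_compose[OF sc.bounded_linear_left \<psi>])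
  have PD: "P x \<in> D" "A (P x) + ?B (P x) = P (A x)" if x: "x \<in> D" for x
  proof -
    show "P x \<in> D" unfolding P_def by (intro generator_diff generator_scaleC x w)
    have "A (P x) = A x - \<psi> x *\<^sub>C s *\<^sub>R w"
      unfolding P_def using x w by (simp add: generator_diff generator_scaleC)
    then have AP: "A (P x) = A x - (\<psi> x * of_real s) *\<^sub>C w"
      by (simp flip: scaleC_of_real)
    have FP: "?F (P x) = ?F x - \<psi> x * of_real (l - s)"
      by (simp add: P_def F.diff complex_functional_scaleC[OF \<phi>(1)] Fw)
    have "A (P x) + ?B (P x) = A x - (\<psi> x * of_real s - ?F (P x)) *\<^sub>C w"
      by (simp only: AP sc.diff_left) simp
    also have "\<psi> x * of_real s - ?F (P x) = \<psi> (A x)"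
      unfolding \<psi>A[OF x] FP by (simp add: algebra_simps)
    finally show "A (P x) + ?B (P x) = P (A x)" by (simp add: P_def)
  qed
  have inter: "S t (P x) = P (T t x)" if "0 \<le> t" for t x
    by (rule semigroup_intertwine[OF S.generated_semigroup_axioms generated_semigroup_axioms P PD that])
  have Sw: "S t w = exp (l * t) *\<^sub>R w" if "0 \<le> t" for t
    by (rule S.orbit_eigenvector[OF w(2) _ that])
      (simp only: w(3) Fw scaleC_of_real, simp flip: scaleR_add_left)
  have S_eq: "exp (- l * t) *\<^sub>R S t g = P (exp (- l * t) *\<^sub>R T t g) + \<psi> g *\<^sub>C w" if t: "0 \<le> t" for t
  proof -
    interpret P: bounded_linear P by (rule P)
    have "S t g = S t (P g + \<psi> g *\<^sub>C w)" by (simp add: P_def)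
    also have "\<dots> = P (T t g) + \<psi> g *\<^sub>C exp (l * t) *\<^sub>R w"
      using t by (simp add: S.lin_simps S.scaleC inter Sw)
    finally have "exp (- l * t) *\<^sub>R S t g = P (exp (- l * t) *\<^sub>R T t g) + (exp (- l * t) * exp (l * t)) *\<^sub>R (\<psi> g *\<^sub>C w)"
      by (simp add: P.scaleR scaleR_add_right sc.scaleR_right)
    then show ?thesis by (simp flip: exp_add)
  qed
  have "((\<lambda>t. exp (- l * t) *\<^sub>R T t g) \<longlongrightarrow> 0) at_top"
  proof (rule Lim_null_comparison)
    show "\<forall>\<^sub>F t in at_top. norm (exp (- l * t) *\<^sub>R T t g) \<le> M * exp (- (l - \<omega>) * t) * norm g"
      using eventually_ge_at_top[of 0]
    proof eventually_elim
      case (elim t)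
      have "norm (exp (- l * t) *\<^sub>R T t g) \<le> exp (- l * t) * (M * exp (\<omega> * t) * norm g)"
        using growth[OF elim, of g] by simp
      also have "\<dots> = M * (exp (- l * t) * exp (\<omega> * t)) * norm g" by (simp add: mult_ac)
      also have "exp (- l * t) * exp (\<omega> * t) = exp (- (l - \<omega>) * t)"
        by (simp flip: exp_add add: algebra_simps)
      finally show ?case .
    qed
    show "((\<lambda>t. M * exp (- (l - \<omega>) * t) * norm g) \<longlongrightarrow> 0) at_top" using l by real_asymp
  qed
  then have "((\<lambda>t. P (exp (- l * t) *\<^sub>R T t g) + \<psi> g *\<^sub>C w) \<longlongrightarrow> P 0 + \<psi> g *\<^sub>C w) at_top"
    by (intro tendsto_add bounded_linear.tendsto[OF P] tendsto_const)
  then have lim: "((\<lambda>t. P (exp (- l * t) *\<^sub>R T t g) + \<psi> g *\<^sub>C w) \<longlongrightarrow> \<psi> g *\<^sub>C w) at_top"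
    by (simp add: linear_0[OF bounded_linear.linear[OF P]])
  obtain t0 where t0: "t0 \<ge> 0" "\<And>t. t \<ge> t0 \<Longrightarrow> 0 \<le> S t g"
    using S(2) g unfolding individually_eventually_positive_def by blast
  have "\<psi> g *\<^sub>C w \<in> positive_cone"
  proof (rule Lim_in_closed_set[OF closed_positive_cone _ trivial_limit_at_top_linorder lim])
    show "\<forall>\<^sub>F t in at_top. P (exp (- l * t) *\<^sub>R T t g) + \<psi> g *\<^sub>C w \<in> positive_cone"
      using eventually_ge_at_top[of t0]
    proof eventually_elim
      case (elim t)
      then have "0 \<le> exp (- l * t) *\<^sub>R S t g" using t0 by (intro scaleR_nonneg_nonneg) auto
      then show ?case using S_eq[of t] elim t0(1) by (simp add: positive_cone_def)
    qed
  qed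
  then have "0 \<le> Re (\<psi> g)" by (intro scaleC_positive_imp_Re_nonneg[OF _ w(1)]) (simp add: positive_cone_def)
  then show ?thesis by (simp add: \<psi>_def complex_functional_def)
qed

text \<open>
Euler's formula is applied to the bounded semigroup \<open>exp (- c t) T t\<close>.
\<close>

lemma positive_if_resolvent_positive:
  assumes growth: "\<And>t x. 0 \<le> t \<Longrightarrow> norm (T t x) \<le> M * exp (\<omega> * t) * norm x" and M: "M \<ge> 1"
    and pos: "\<And>l x. l > l0 \<Longrightarrow> 0 \<le> x \<Longrightarrow> 0 \<le> resolvent D A (complex_of_real l) x"
  shows "positive_semigroup T"
proof -
  define c where "c = \<omega> + 1"
  interpret V: stable_semigroup "\<lambda>t x. exp (- c * t) *\<^sub>R T t x" D "\<lambda>x. A x - c *\<^sub>R x" M "c - \<omega>"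
    by (rule stable_scaleR[OF growth]) (simp_all add: c_def)
  let ?R = "\<lambda>l. resolvent D A (complex_of_real (l + c))"
  have \<rho>: "complex_of_real (l + c) \<in> resolvent_set D A" if "l > 0" for l
    by (rule right_halfplane_in_resolvent_set[OF growth]) (use that in \<open>simp_all add: c_def\<close>)
  have "0 \<le> T t f" if t: "0 \<le> t" and f: "0 \<le> f" for t f
  proof -
    have "exp (- c * t) *\<^sub>R T t f \<in> positive_cone"
    proof (rule V.euler_invariance[where R = ?R and ?l0.0 = "max 0 (l0 - c)"])
      fix l x assume l: "l > max 0 (l0 - c)"
      then have \<rho>: "complex_of_real (l + c) \<in> resolvent_set D A" by (intro \<rho>) simp
      show "?R l x \<in> D" by (rule resolventD_real[OF \<rho>])
      show "l *\<^sub>R ?R l x - (A (?R l x) - c *\<^sub>R ?R l x) = x"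
        using resolventD_real(2)[OF \<rho>, of x] by (simp add: algebra_simps)
      show "x \<in> positive_cone \<Longrightarrow> ?R l x \<in> positive_cone"
        using pos[of "l + c" x] l by (simp add: positive_cone_def)
    next
      fix t x assume "0 \<le> (t::real)"
      have "norm (exp (- c * t) *\<^sub>R T t x) \<le> M * exp (- (c - \<omega>) * t) * norm x"
        by (rule V.stable) fact
      also have "\<dots> \<le> M * 1 * norm x"
        using M \<open>0 \<le> t\<close> by (intro mult_right_mono mult_left_mono) (auto simp: c_def)
      finally show "norm (exp (- c * t) *\<^sub>R T t x) \<le> M * norm x" by simp
    qed (use t f closed_positive_cone in \<open>auto simp: positive_cone_def scaleR_nonneg_nonneg\<close>)
    then have "0 \<le> exp (- c * t) *\<^sub>R T t f" by (simp only: positive_cone_def mem_Collect_eq)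
    then have "0 \<le> exp (c * t) *\<^sub>R (exp (- c * t) *\<^sub>R T t f)"
      by (rule scaleR_nonneg_nonneg[rotated]) simp
    then show ?thesis by (simp flip: exp_add)
  qed
  then show ?thesis by (simp add: positive_semigroup_def positive_operator_def)
qed

lemma positive_perturbation:
  assumes pos: "positive_semigroup T" and B: "bounded_clinear B" "positive_operator B"
  shows "\<exists>S. perturbed_semigroup D A B S \<and> positive_semigroup S"
proof -
  have "bounded_linear B" using B(1) by (simp add: bounded_clinear_iff)
  from bounded_perturbation_exists[OF this] obtain S where S: "generated_semigroup S D (\<lambda>x. A x + B x)"
    and inv: "\<And>C. closed C \<Longrightarrow> convex_cone C \<Longrightarrow> (\<forall>t\<ge>0. T t ` C \<subseteq> C) \<Longrightarrow> B ` C \<subseteq> C \<Longrightarrow> (\<forall>t\<ge>0. S t ` C \<subseteq> C)"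
    by metis
  interpret S: generated_semigroup S D "\<lambda>x. A x + B x" by fact
  have scale: "S t (c *\<^sub>C x) = c *\<^sub>C S t x" if "0 \<le> t" for t c x
  proof (rule semigroup_intertwine[OF S S _ _ _ that])
    show "bounded_linear ((*\<^sub>C) c :: 'a complexification \<Rightarrow> _)"
      by (rule bounded_bilinear.bounded_linear_right[OF bounded_bilinear_scaleC])
    fix x assume "x \<in> D"
    then show "c *\<^sub>C x \<in> D" "A (c *\<^sub>C x) + B (c *\<^sub>C x) = c *\<^sub>C (A x + B x)"
      using B(1) by (simp_all add: generator_scaleC bounded_clinear_iff complexification.scale_right_distrib)
  qed
  have "C0_semigroup S"
    unfolding C0_semigroup_def bounded_clinear_iff
    by (auto simp: S.bounded_linear scale S.add S.right_continuous)
  moreover have "has_generator S D (\<lambda>x. A x + B x)"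
    unfolding has_generator_def using S.domain S.generator by blast
  moreover have "\<forall>t\<ge>0. S t ` positive_cone \<subseteq> positive_cone"
    using pos B(2)
    by (intro inv closed_positive_cone convex_cone_positive_cone)
      (auto simp: positive_semigroup_def positive_operator_def positive_cone_def)
  then have "positive_semigroup S"
    by (auto simp: positive_semigroup_def positive_operator_def positive_cone_def)
  ultimately show ?thesis by (auto simp: perturbed_semigroup_def)
qed

end

lemma strongly_positive_imp_positive:
  assumes "strongly_positive_wrt u f" "0 \<le> u"
  shows "0 \<le> f"
  using assms by (meson less_imp_le order_trans scaleR_nonneg_nonneg strongly_positive_wrt_def)

theorem theorem2p3:
  fixes T :: "real \<Rightarrow> 'a::banach_lattice complexification \<Rightarrow> 'a complexification"
    and D :: "'a complexification set"
    and A :: "'a complexification \<Rightarrow> 'a complexification"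
    and u :: "'a complexification"
  assumes "C0_semigroup T"
    and "real_semigroup T"
    and "has_generator T D A"
    and "quasi_interior u"
    and "individually_eventually_strongly_positive u T"
    and "spectral_bound D A \<noteq> -\<infinity>"
    and "resolvent_pole D A (complex_of_real (real_of_ereal (spectral_bound D A)))"
  shows
    "((\<forall>B. bounded_clinear B \<and> positive_operator B \<longrightarrow>
         (\<exists>S. perturbed_semigroup D A B S \<and> individually_eventually_positive S))
      \<longleftrightarrow>
      (\<forall>B. bounded_clinear B \<and> positive_operator B \<and> rank_one B \<longrightarrow>
         (\<exists>S. perturbed_semigroup D A B S \<and> individually_eventually_positive S)))
     \<and>
     ((\<forall>B. bounded_clinear B \<and> positive_operator B \<and> rank_one B \<longrightarrow>
         (\<exists>S. perturbed_semigroup D A B S \<and> individually_eventually_positive S))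
      \<longleftrightarrow>
      positive_semigroup T)"
proof -
  interpret complex_semigroup T D A using assms(1,3) by (rule complex_semigroup.intro)
  have u: "0 \<le> u" using assms(4) by (simp add: quasi_interior_def)
  have all: "\<exists>S. perturbed_semigroup D A B S \<and> individually_eventually_positive S"
    if "positive_semigroup T" "bounded_clinear B" "positive_operator B" for B
    using positive_perturbation[OF that]
    by (auto simp: positive_semigroup_def positive_operator_def individually_eventually_positive_def)
  have positive: "positive_semigroup T"
    if rank_one: "\<And>B. bounded_clinear B \<Longrightarrow> positive_operator B \<Longrightarrow> rank_one B \<Longrightarrow>
      \<exists>S. perturbed_semigroup D A B S \<and> individually_eventually_positive S"
  proof -
    obtain s where s: "spectral_bound D A = ereal s"
      using assms(6) spectral_bound_not_infty by (cases "spectral_bound D A") auto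
    have \<rho>: "complex_of_real l \<in> resolvent_set D A" if "s < l" for l
      by (rule above_spectral_bound[OF s that])
    have "individually_eventually_positive T"
      unfolding individually_eventually_positive_def
    proof (intro allI impI)
      fix f :: "'a complexification" assume f: "0 \<le> f"
      show "\<exists>t0\<ge>0. \<forall>t\<ge>t0. 0 \<le> T t f"
      proof (cases "f = 0")
        case True
        then show ?thesis by (intro exI[of _ 0]) (auto simp: lin_simps)
      next
        case False
        then have "f > 0" using f by (simp add: less_complexification_def)
        then show ?thesis
          using assms(5) strongly_positive_imp_positive[OF _ u]
          unfolding individually_eventually_strongly_positive_def by blast
      qed
    qed
    then obtain w where w: "w > 0" "w \<in> D" "A w = s *\<^sub>R w"
      using positive_eigenvector[OF \<rho>] assms(7) s by (metis real_of_ereal.simps(1))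
    \<comment> \<open>The orbit of \<open>w\<close> consists of positive multiples of \<open>w\<close>.\<close>
    obtain \<epsilon> where \<epsilon>: "\<epsilon> > 0" "\<epsilon> *\<^sub>R u \<le> w"
    proof -
      obtain t \<epsilon> where t: "t \<ge> 0" and \<epsilon>: "\<epsilon> > 0" "\<epsilon> *\<^sub>R u \<le> T t w"
        using assms(5) w(1)
        unfolding individually_eventually_strongly_positive_def strongly_positive_wrt_def by blast
      have "exp (- (s * t)) *\<^sub>R (\<epsilon> *\<^sub>R u) \<le> exp (- (s * t)) *\<^sub>R (exp (s * t) *\<^sub>R w)"
        using \<epsilon>(2) orbit_eigenvector[OF w(2,3) t] by (intro scaleR_left_mono) auto
      then have "(exp (- (s * t)) * \<epsilon>) *\<^sub>R u \<le> w" by (simp flip: exp_add)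
      then show ?thesis using that \<epsilon>(1) by (metis exp_gt_zero mult_pos_pos)
    qed
    obtain M \<omega> where M: "M \<ge> 1" "\<And>t x. 0 \<le> t \<Longrightarrow> norm (T t x) \<le> M * exp (\<omega> * t) * norm x"
      by (rule growth_bound) blast
    have "0 \<le> resolvent D A (complex_of_real l) g" if l: "l > max \<omega> s" and g: "0 \<le> g" for l g
    proof -
      let ?v = "resolvent D A (complex_of_real l) g"
      have "g \<in> real_elements" using g by (simp add: real_elements_def complexification_nonneg_iff)
      moreover have "T t ` (real_elements \<inter> UNIV) \<subseteq> real_elements" if "0 \<le> t" for t
      proof -
        have "real_operator UNIV (T t)" using assms(2) that by (simp add: real_semigroup_def)
        then show ?thesis unfolding real_operator_def by (rule conjunct2)
      qed
      ultimately have "T t g \<in> real_elements" if "0 \<le> t" for t using that by blast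
      from resolvent_mem_cone[OF M(2) _ closed_real_elements convex_cone_real_elements this]
      have "?v \<in> real_elements" using l by simp
      moreover have "0 \<le> re_part ?v"
      proof (rule ccontr)
        assume "\<not> 0 \<le> re_part ?v"
        then obtain \<phi> :: "'a \<Rightarrow> real" where \<phi>: "bounded_linear \<phi>"
          "\<And>x. 0 \<le> x \<Longrightarrow> 0 \<le> \<phi> x" "\<phi> (re_part ?v) < 0"
          using positive_functional_separates by blast
        interpret \<phi>: bounded_linear \<phi> by fact
        have "0 < \<epsilon> * \<phi> (re_part u)"
          using \<epsilon>(1) positive_functional_quasi_interior[OF assms(4) \<phi>(1,2), of "re_part ?v"] \<phi>(3)
          by simp
        also have "\<dots> \<le> \<phi> (re_part w)"
          using \<phi>(2)[of "re_part w - \<epsilon> *\<^sub>R re_part u"] \<epsilon>(2)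
          by (simp add: less_eq_complexification_def \<phi>.diff \<phi>.scaleR)
        finally have \<phi>w: "\<phi> (re_part w) > 0" .
        \<comment> \<open>The normalisation makes \<open>w\<close> an eigenvector of the perturbed generator for the eigenvalue \<open>l\<close>.\<close>
        define k where "k = (l - s) / \<phi> (re_part w)"
        have k: "k > 0" using l \<phi>w by (simp add: k_def)
        let ?\<phi> = "\<lambda>x. k * \<phi> x"
        have \<phi>': "bounded_linear ?\<phi>" "\<And>x. 0 \<le> x \<Longrightarrow> 0 \<le> ?\<phi> x" "?\<phi> (re_part w) = l - s"
          using k \<phi>w \<phi>(2) by (auto intro: bounded_linear_const_mult \<phi>(1)) (simp add: k_def)
        then have "?\<phi> (re_part w) \<noteq> 0" using l by simp
        from rank_one[OF rank_one_operator[OF \<phi>'(1,2) this w(1)]] obtain S where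
          S: "perturbed_semigroup D A (\<lambda>x. complex_functional ?\<phi> x *\<^sub>C w) S" "individually_eventually_positive S"
          by blast
        have "0 \<le> ?\<phi> (re_part ?v)"
          using l by (intro resolvent_functional_nonneg[OF M(2) _ _ w \<phi>'(1,3) S g]) auto
        then show False using k \<phi>(3) by (simp add: zero_le_mult_iff)
      qed
      ultimately show ?thesis by (simp add: complexification_nonneg_iff real_elements_def)
    qed
    from positive_if_resolvent_positive[OF M(2,1) this] show ?thesis .
  qed
  show ?thesis using all positive by blast
qed

end
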